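(* Let $\lambda,\mu\in\mathbb C$ and let $E_{\lambda,\mu}$ be the differential operator on $C^\infty(\mathbb R^n\times\mathbb R^n,\mathbb S\otimes\mathbb S')$ given by $$\begin{aligned}E_{\lambda,\mu}={}&|x-y|^2\Delta_x\otimes\Delta_y+2(2\lambda-n+1)\sum_{j=1}^n(x_j-y_j)\tfrac{\partial}{\partial x_j}\otimes\Delta_y+2(2\mu-n+1)\sum_{j=1}^n(y_j-x_j)\Delta_x\otimes\tfrac{\partial}{\partial y_j}\\&-2\rho(x-y)\mathbf D_x\otimes\Delta_y-2\Delta_x\otimes\rho'(y-x)\mathbf D'_y\\&+(2\mu-n+1)(2\mu+1)\Delta_x\otimes\mathrm{id}+(2\lambda-n+1)(2\lambda+1)\,\mathrm{id}\otimes\Delta_y\\&-2(2\lambda-n+1)(2\mu-n+1)\sum_{j=1}^n\tfrac{\partial}{\partial x_j}\otimes\tfrac{\partial}{\partial y_j}+2(2\lambda-n+1)\sum_{j=1}^n\tfrac{\partial}{\partial x_j}\otimes\rho'(e_j)\mathbf D'_y\\&+2(2\mu-n+1)\sum_{j=1}^n\rho(e_j)\mathbf D_x\otimes\tfrac{\partial}{\partial y_j}-2\sum_{j=1}^n\rho(e_j)\mathbf D_x\otimes\rho'(e_j)\mathbf D'_y .\end{aligned}$$ Then for every $g\in\mathbf G$ $$E_{\lambda,\mu}\circ\big(\pi_\lambda(g)\otimes\pi'_\mu(g)\big)=\big(\pi_{\lambda+1}(g)\otimes\pi'_{\mu+1}(g)\big)\circ E_{\lambda,\mu},$$ where the equality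 holds when applied to functions $F\in C^\infty(\mathbb R^n\times\mathbb R^n,\mathbb S\otimes\mathbb S')$ with compact support and such that the (diagonal) action of $g$ is defined on the support of $F$.
   Context: Let $n\ge 1$, $e_1,\dots,e_n$ the standard basis of Euclidean $\mathbb R^n$, and $C\ell(\mathbb R^n)$ the real unital algebra generated by $\mathbb R^n$ with $xy+yx=-2\langle x,y\rangle$. Let $\mathbb S$ be a finite-dimensional complex vector space with a unital algebra homomorphism $\rho\colon C\ell(\mathbb R^n)\otimes\mathbb C\to\mathrm{End}(\mathbb S)$ (a Clifford module). On the dual $\mathbb S'$, $\rho'(x)t'=-t'\circ\rho(x)$ for $x\in\mathbb R^n$, extended to an algebra homomorphism on $C\ell(\mathbb R^n)\otimes\mathbb C$. Dirac operators: $\mathbf D=\sum_j\rho(e_j)\partial_j$ on $\mathbb S$-valued functions, $\mathbf D'=\sum_j\rho'(e_j)\partial_j$ on $\mathbb S'$-valued functions; $\Delta=\sum_j\partial_j^2$; subscripts $x,y$ indicate the variable. In $P\otimes P'$, $P$ acts in the variable $x$ and on the factor $\mathbb S$, $P'$ in the variable $y$ and on the factor $\mathbb S'$; coefficients depending on $x,y$ act by multiplication on the left, after the derivatives. On $\mathbb R^{1,n+1}$ with basis $e_0,\dots,e_{n+1}$ let $\mathbf Q(\mathbf x,\mathbf y)=x_0y_0-x_1y_1-\dots-x_{n+1}y_{n+1}$, $\mathbf Q(\mathbf x)=\mathbf Q(\mathbf x,\mathbf x)$, with Clifford algebra generated by $\mathbb R^{1,n+1}$ and $\mathbf x\mathbf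 y+\mathbf y\mathbf x=2\mathbf Q(\mathbf x,\mathbf y)$; it contains $C\ell(\mathbb R^n)$ as the subalgebra generated by $\mathbb R^n=\mathrm{span}(e_1,\dots,e_n)$. Let $\mathbf G=\mathrm{Spin}_0(1,n+1)$ be the group of products $\mathbf v_1\cdots\mathbf v_{2k}$ with $\mathbf v_j\in\mathbb R^{1,n+1}$, $\mathbf Q(\mathbf v_j)=\pm1$, the number of $j$ with $\mathbf Q(\mathbf v_j)=-1$ being even. Let $\mathbf M=\mathrm{Spin}(n)$ be the group of products of an even number of unit vectors of $\mathbb R^n$, $A=\{a_t=\cosh t+\sinh t\,e_0e_{n+1}:t\in\mathbb R\}$, $N=\{1+\tfrac12 y(e_0-e_{n+1}):y\in\mathbb R^n\}$, $\overline N=\{\overline n_x=1+\tfrac12x(e_0+e_{n+1}):x\in\mathbb R^n\}$. The map $\overline N\times\mathbf M\times A\times N\to\mathbf G$, $(\overline n,m,a,n)\mapsto\overline nman$, is injective with dense open image. The action of $g\in\mathbf G$ is defined at $x\in\mathbb R^n$ if $g\overline n_x$ lies in this image; then write $g\overline n_x=\overline n_{g(x)}\,m(g,x)\,a(g,x)\,n$ with $g(x)\in\mathbb R^n$, $m(g,x)\in\mathbf M$, $a(g,x)\in A$, $n\in N$. For $\lambda\in\mathbb C$, $\chi_\lambda(a_t)=e^{2t\lambda}$. Then $$\big((\pi_\lambda(g)\otimes\pi'_\mu(g))F\big)(x,y)=\chi_\lambda(a(g^{-1},x))^{-1}\chi_\mu(a(g^{-1},y))^{-1}\big(\rho(m(g^{-1},x))^{-1}\otimes\rho'(m(g^{-1},y))^{-1}\big)F(g^{-1}(x),g^{-1}(y)).$$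 If $F$ is smooth with compact support and $g$ is defined at $x$ and at $y$ for every $(x,y)\in\mathrm{supp}F$, this is extended by $0$ at the points where $g^{-1}$ is not defined, giving a smooth compactly supported function. *)

theory Defs
  imports "HOL-Analysis.Analysis"
begin

section \<open>The Clifford algebra of Minkowski space\<close>

text \<open>A triple \<open>(s, x, t)\<close> stands for \<open>s e\<^sub>0 + x + t e\<^sub>n\<^sub>+\<^sub>1\<close> with
  \<open>x \<in> span (e\<^sub>1, \<dots>, e\<^sub>n)\<close> and \<open>n = CARD('n)\<close>.\<close>

type_synonym 'n minkowski = "real \<times> (real ^ 'n) \<times> real"

definition mink_form :: "'n::finite minkowski \<Rightarrow> 'n minkowski \<Rightarrow> real" where
  "mink_form v w = (case (v, w) of ((s, x, t), (s', x', t')) \<Rightarrow> s * s' - x \<bullet> x' - t * t')"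

text \<open>The Clifford algebra is given by its presentation: formal algebra expressions in the vectors
  of Minkowski space, modulo the least congruence that contains the laws of unital associative
  real algebras, the linearity of the inclusion of the vectors, and the Clifford relation
  \<open>v w + w v = 2 Q(v, w)\<close>.\<close>

datatype 'n clifford_term =
    Scalar real
  | Vector "'n minkowski"
  | Plus "'n clifford_term" "'n clifford_term"
  | Times "'n clifford_term" "'n clifford_term"

inductive clifford_eq :: "'n::finite clifford_term \<Rightarrow> 'n clifford_term \<Rightarrow> bool" where
  refl: "clifford_eq a a"
| sym: "clifford_eq a b \<Longrightarrow> clifford_eq b a"
| trans: "clifford_eq a b \<Longrightarrow> clifford_eq b c \<Longrightarrow> clifford_eq a c"
| plus_cong: "clifford_eq a a' \<Longrightarrow> clifford_eq b b' \<Longrightarrow> clifford_eq (Plus a b) (Plus a' b')"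
| times_cong: "clifford_eq a a' \<Longrightarrow> clifford_eq b b' \<Longrightarrow> clifford_eq (Times a b) (Times a' b')"
| plus_assoc: "clifford_eq (Plus (Plus a b) c) (Plus a (Plus b c))"
| plus_commute: "clifford_eq (Plus a b) (Plus b a)"
| plus_zero: "clifford_eq (Plus (Scalar 0) a) a"
| plus_minus: "clifford_eq (Plus (Times (Scalar (- 1)) a) a) (Scalar 0)"
| times_assoc: "clifford_eq (Times (Times a b) c) (Times a (Times b c))"
| times_one: "clifford_eq (Times (Scalar 1) a) a"
| distrib_left: "clifford_eq (Times a (Plus b c)) (Plus (Times a b) (Times a c))"
| distrib_right: "clifford_eq (Times (Plus a b) c) (Plus (Times a c) (Times b c))"
| scalar_plus: "clifford_eq (Scalar (r + s)) (Plus (Scalar r) (Scalar s))"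
| scalar_times: "clifford_eq (Scalar (r * s)) (Times (Scalar r) (Scalar s))"
| scalar_central: "clifford_eq (Times (Scalar r) a) (Times a (Scalar r))"
| vector_plus: "clifford_eq (Vector (v + w)) (Plus (Vector v) (Vector w))"
| vector_scale: "clifford_eq (Vector (r *\<^sub>R v)) (Times (Scalar r) (Vector v))"
| clifford: "clifford_eq (Plus (Times (Vector v) (Vector w)) (Times (Vector w) (Vector v)))
               (Scalar (2 * mink_form v w))"

quotient_type (overloaded) 'n clifford = "'n::finite clifford_term" / clifford_eq
  by (intro equivpI reflpI sympI transpI)
    (rule clifford_eq.refl, erule clifford_eq.sym, erule (1) clifford_eq.trans)

text \<open>The class \<open>real_algebra_1\<close> would in addition ask for a proof of \<open>1 \<noteq> 0\<close>, which is true but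
  not needed to state anything below.\<close>

instantiation clifford :: (finite) "{real_algebra, monoid_mult}"
begin

lift_definition zero_clifford :: "'a clifford" is "Scalar 0" .
lift_definition one_clifford :: "'a clifford" is "Scalar 1" .
lift_definition plus_clifford :: "'a clifford \<Rightarrow> 'a clifford \<Rightarrow> 'a clifford" is Plus
  by (rule clifford_eq.plus_cong)
lift_definition times_clifford :: "'a clifford \<Rightarrow> 'a clifford \<Rightarrow> 'a clifford" is Times
  by (rule clifford_eq.times_cong)
lift_definition scaleR_clifford :: "real \<Rightarrow> 'a clifford \<Rightarrow> 'a clifford" is "\<lambda>r. Times (Scalar r)"
  by (intro clifford_eq.times_cong clifford_eq.refl)
lift_definition uminus_clifford :: "'a clifford \<Rightarrow> 'a clifford" is "Times (Scalar (- 1))"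
  by (intro clifford_eq.times_cong clifford_eq.refl)
definition minus_clifford :: "'a clifford \<Rightarrow> 'a clifford \<Rightarrow> 'a clifford" where
  "minus_clifford a b = a + - b"

instance
proof
  fix a b c :: "'a clifford" and r s :: real
  show "a + b + c = a + (b + c)" by transfer (rule clifford_eq.plus_assoc)
  show "a + b = b + a" by transfer (rule clifford_eq.plus_commute)
  show "0 + a = a" by transfer (rule clifford_eq.plus_zero)
  show "- a + a = 0" by transfer (rule clifford_eq.plus_minus)
  show "a - b = a + - b" by (rule minus_clifford_def)
  show "a * b * c = a * (b * c)" by transfer (rule clifford_eq.times_assoc)
  show "(a + b) * c = a * c + b * c" by transfer (rule clifford_eq.distrib_right)
  show "a * (b + c) = a * b + a * c" by transfer (rule clifford_eq.distrib_left)
  show "1 * a = a" by transfer (rule clifford_eq.times_one)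
  show "a * 1 = a"
    by transfer (rule clifford_eq.trans[OF clifford_eq.sym[OF clifford_eq.scalar_central]
          clifford_eq.times_one])
  show "r *\<^sub>R (a + b) = r *\<^sub>R a + r *\<^sub>R b" by transfer (rule clifford_eq.distrib_left)
  show "(r + s) *\<^sub>R a = r *\<^sub>R a + s *\<^sub>R a"
    by transfer (rule clifford_eq.trans[OF clifford_eq.times_cong[OF clifford_eq.scalar_plus
            clifford_eq.refl] clifford_eq.distrib_right])
  show "r *\<^sub>R s *\<^sub>R a = (r * s) *\<^sub>R a"
    by transfer (rule clifford_eq.sym[OF clifford_eq.trans[OF clifford_eq.times_cong[OF
              clifford_eq.scalar_times clifford_eq.refl] clifford_eq.times_assoc]])
  show "1 *\<^sub>R a = a" by transfer (rule clifford_eq.times_one)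
  show "r *\<^sub>R a * b = r *\<^sub>R (a * b)" by transfer (rule clifford_eq.times_assoc)
  show "a * r *\<^sub>R b = r *\<^sub>R (a * b)"
    by transfer (rule clifford_eq.trans[OF clifford_eq.sym[OF clifford_eq.times_assoc]
          clifford_eq.trans[OF clifford_eq.times_cong[OF clifford_eq.sym[OF
                clifford_eq.scalar_central] clifford_eq.refl] clifford_eq.times_assoc]])
qed

end

lift_definition cl_vector :: "'n::finite minkowski \<Rightarrow> 'n clifford" is Vector .

lemma cl_vector_relation:
  "cl_vector v * cl_vector w + cl_vector w * cl_vector v = (2 * mink_form v w) *\<^sub>R 1"
  by transfer (rule clifford_eq.trans[OF clifford_eq.clifford clifford_eq.sym[OF
        clifford_eq.trans[OF clifford_eq.scalar_central clifford_eq.times_one]]])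

definition cl_e0 :: "'n::finite clifford" where "cl_e0 = cl_vector (1, 0, 0)"

definition cl_elast :: "'n::finite clifford" where "cl_elast = cl_vector (0, 0, 1)"

definition cl_vec :: "real ^ 'n \<Rightarrow> 'n::finite clifford" where "cl_vec x = cl_vector (0, x, 0)"

text \<open>The Clifford algebra of Euclidean space, as the unital subalgebra generated by
  \<open>span (e\<^sub>1, \<dots>, e\<^sub>n)\<close>.\<close>

inductive_set euclid_clifford :: "'n::finite clifford set" where
  one: "1 \<in> euclid_clifford"
| vec: "cl_vec x \<in> euclid_clifford"
| scale: "a \<in> euclid_clifford \<Longrightarrow> r *\<^sub>R a \<in> euclid_clifford"
| add: "a \<in> euclid_clifford \<Longrightarrow> b \<in> euclid_clifford \<Longrightarrow> a + b \<in> euclid_clifford"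
| mult: "a \<in> euclid_clifford \<Longrightarrow> b \<in> euclid_clifford \<Longrightarrow> a * b \<in> euclid_clifford"


section \<open>Clifford modules\<close>

text \<open>In the complexification, the pair \<open>(a, b)\<close> stands for \<open>a \<otimes> 1 + b \<otimes> \<i>\<close>.\<close>

type_synonym 'n complex_clifford = "'n clifford \<times> 'n clifford"

definition cc_mult :: "'n::finite complex_clifford \<Rightarrow> 'n complex_clifford \<Rightarrow> 'n complex_clifford" where
  "cc_mult p q = (fst p * fst q - snd p * snd q, fst p * snd q + snd p * fst q)"

definition cc_scale :: "complex \<Rightarrow> 'n::finite complex_clifford \<Rightarrow> 'n complex_clifford" where
  "cc_scale z p = (Re z *\<^sub>R fst p - Im z *\<^sub>R snd p, Re z *\<^sub>R snd p + Im z *\<^sub>R fst p)"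

definition cc_of :: "'n::finite clifford \<Rightarrow> 'n complex_clifford" where "cc_of a = (a, 0)"

text \<open>The module is \<open>\<complex>\<^sup>d\<close> with \<open>d = CARD('s)\<close>, its endomorphisms are matrices. The values of
  \<open>\<rho>\<close> outside the complexified Euclidean Clifford algebra are irrelevant.\<close>

definition clifford_module :: "('n::finite complex_clifford \<Rightarrow> complex ^ 's::finite ^ 's) \<Rightarrow> bool" where
  "clifford_module \<rho> \<longleftrightarrow>
     \<rho> (cc_of 1) = mat 1 \<and>
     (\<forall>p \<in> euclid_clifford \<times> euclid_clifford. \<forall>q \<in> euclid_clifford \<times> euclid_clifford.
        \<rho> (p + q) = \<rho> p + \<rho> q \<and> \<rho> (cc_mult p q) = \<rho> p ** \<rho> q) \<and>
     (\<forall>z. \<forall>p \<in> euclid_clifford \<times> euclid_clifford. \<rho> (cc_scale z p) = mat z ** \<rho> p)"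

text \<open>Functionals on \<open>\<complex>\<^sup>d\<close> are row vectors, so that \<open>t \<circ> A\<close> is \<open>t v* A\<close>. The algebra homomorphism
  \<open>\<rho>'\<close> is determined by its values on vectors.\<close>

definition dual_module ::
  "('n::finite complex_clifford \<Rightarrow> complex ^ 's::finite ^ 's) \<Rightarrow>
   ('n complex_clifford \<Rightarrow> complex ^ 's ^ 's) \<Rightarrow> bool" where
  "dual_module \<rho> \<rho>' \<longleftrightarrow> clifford_module \<rho>' \<and>
     (\<forall>x t. \<rho>' (cc_of (cl_vec x)) *v t = - (t v* \<rho> (cc_of (cl_vec x))))"


section \<open>The conformal action\<close>

definition Spin0 :: "'n::finite clifford set" where
  "Spin0 = {prod_list (map cl_vector vs) | vs.
     even (length vs) \<and>
     (\<forall>v \<in> set vs. mink_form v v = 1 \<or> mink_form v v = - 1) \<and>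
     even (length (filter (\<lambda>v. mink_form v v = - 1) vs))}"

definition Spin_M :: "'n::finite clifford set" where
  "Spin_M = {prod_list (map cl_vec xs) | xs. even (length xs) \<and> (\<forall>x \<in> set xs. norm x = 1)}"

definition a_elt :: "real \<Rightarrow> 'n::finite clifford" where
  "a_elt t = cosh t *\<^sub>R 1 + sinh t *\<^sub>R (cl_e0 * cl_elast)"

definition n_elt :: "real ^ 'n \<Rightarrow> 'n::finite clifford" where
  "n_elt y = 1 + (1 / 2) *\<^sub>R (cl_vec y * (cl_e0 - cl_elast))"

definition nbar_elt :: "real ^ 'n \<Rightarrow> 'n::finite clifford" where
  "nbar_elt x = 1 + (1 / 2) *\<^sub>R (cl_vec x * (cl_e0 + cl_elast))"

definition cl_inv :: "'n::finite clifford \<Rightarrow> 'n clifford" where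
  "cl_inv g = (THE h. g * h = 1 \<and> h * g = 1)"

definition factorization ::
  "'n::finite clifford \<Rightarrow> real ^ 'n \<Rightarrow> 'n clifford \<Rightarrow> 'n clifford \<Rightarrow> 'n clifford \<Rightarrow> bool" where
  "factorization h y m a n \<longleftrightarrow>
     m \<in> Spin_M \<and> a \<in> range a_elt \<and> n \<in> range n_elt \<and> h = nbar_elt y * m * a * n"

definition act_defined :: "'n::finite clifford \<Rightarrow> real ^ 'n \<Rightarrow> bool" where
  "act_defined g x \<longleftrightarrow> (\<exists>y m a n. factorization (g * nbar_elt x) y m a n)"

definition act :: "'n::finite clifford \<Rightarrow> real ^ 'n \<Rightarrow> real ^ 'n" where
  "act g x = (THE y. \<exists>m a n. factorization (g * nbar_elt x) y m a n)"

definition m_part :: "'n::finite clifford \<Rightarrow> real ^ 'n \<Rightarrow> 'n clifford" where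
  "m_part g x = (THE m. \<exists>y a n. factorization (g * nbar_elt x) y m a n)"

definition a_part :: "'n::finite clifford \<Rightarrow> real ^ 'n \<Rightarrow> 'n clifford" where
  "a_part g x = (THE a. \<exists>y m n. factorization (g * nbar_elt x) y m a n)"

definition chi :: "complex \<Rightarrow> 'n::finite clifford \<Rightarrow> complex" where
  "chi lam a = exp (2 * of_real (THE t. a = a_elt t) * lam)"

text \<open>The tensor product of \<open>\<complex>\<^sup>d\<close> and its dual is \<open>\<complex>\<^sup>d\<^sup>\<times>\<^sup>d\<close>, with \<open>(u \<otimes> t) $ (i, j) = u $ i * t $ j\<close>.\<close>

definition kron :: "complex ^ 's::finite ^ 's \<Rightarrow> complex ^ 't::finite ^ 't \<Rightarrow>
    complex ^ ('s \<times> 't) ^ ('s \<times> 't)" (infixr "\<otimes>\<^sub>K" 72) where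
  "A \<otimes>\<^sub>K B = (\<chi> p q. A $ fst p $ fst q * B $ snd p $ snd q)"

type_synonym ('n, 's) spinor_field = "(real ^ 'n) \<times> (real ^ 'n) \<Rightarrow> complex ^ ('s \<times> 's)"

text \<open>The operator \<open>\<pi>(g) \<otimes> \<pi>'(g)\<close> with parameters \<open>lam\<close> and \<open>mu\<close>, extended by \<open>0\<close>.\<close>

definition pi_tensor ::
  "('n::finite complex_clifford \<Rightarrow> complex ^ 's::finite ^ 's) \<Rightarrow>
   ('n complex_clifford \<Rightarrow> complex ^ 's ^ 's) \<Rightarrow> complex \<Rightarrow> complex \<Rightarrow> 'n clifford \<Rightarrow>
   ('n, 's) spinor_field \<Rightarrow> ('n, 's) spinor_field" where
  "pi_tensor \<rho> \<rho>' lam mu g F = (\<lambda>(x, y). let h = cl_inv g in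
     if act_defined h x \<and> act_defined h y
     then (inverse (chi lam (a_part h x)) * inverse (chi mu (a_part h y))) *s
       ((matrix_inv (\<rho> (cc_of (m_part h x))) \<otimes>\<^sub>K matrix_inv (\<rho>' (cc_of (m_part h y))))
         *v F (act h x, act h y))
     else 0)"


section \<open>Smooth functions and differential operators\<close>

fun times_cont_diff :: "nat \<Rightarrow> ('a::euclidean_space \<Rightarrow> 'b::real_normed_vector) \<Rightarrow> bool" where
  "times_cont_diff 0 f \<longleftrightarrow> continuous_on UNIV f"
| "times_cont_diff (Suc k) f \<longleftrightarrow> (\<forall>x. f differentiable (at x)) \<and>
     (\<forall>v. times_cont_diff k (\<lambda>x. frechet_derivative f (at x) v))"

definition smooth :: "('a::euclidean_space \<Rightarrow> 'b::real_normed_vector) \<Rightarrow> bool" where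
  "smooth f \<longleftrightarrow> (\<forall>k. times_cont_diff k f)"

definition supp :: "('a::topological_space \<Rightarrow> 'b::zero) \<Rightarrow> 'a set" where
  "supp f = closure {x. f x \<noteq> 0}"

definition dx :: "'n::finite \<Rightarrow> ('n, 's::finite) spinor_field \<Rightarrow> ('n, 's) spinor_field" where
  "dx j F = (\<lambda>p. frechet_derivative F (at p) (axis j 1, 0))"

definition dy :: "'n::finite \<Rightarrow> ('n, 's::finite) spinor_field \<Rightarrow> ('n, 's) spinor_field" where
  "dy j F = (\<lambda>p. frechet_derivative F (at p) (0, axis j 1))"

definition laplace_x :: "('n::finite, 's::finite) spinor_field \<Rightarrow> ('n, 's) spinor_field" where
  "laplace_x F = (\<lambda>p. \<Sum>j\<in>UNIV. dx j (dx j F) p)"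

definition laplace_y :: "('n::finite, 's::finite) spinor_field \<Rightarrow> ('n, 's) spinor_field" where
  "laplace_y F = (\<lambda>p. \<Sum>j\<in>UNIV. dy j (dy j F) p)"

text \<open>The operators \<open>\<^bold>D\<^sub>x \<otimes> id\<close> and \<open>id \<otimes> \<^bold>D'\<^sub>y\<close>.\<close>

definition dirac_x :: "('n::finite complex_clifford \<Rightarrow> complex ^ 's::finite ^ 's) \<Rightarrow>
    ('n, 's) spinor_field \<Rightarrow> ('n, 's) spinor_field" where
  "dirac_x \<rho> F = (\<lambda>p. \<Sum>j\<in>UNIV. (\<rho> (cc_of (cl_vec (axis j 1))) \<otimes>\<^sub>K mat 1) *v dx j F p)"

definition dirac_y :: "('n::finite complex_clifford \<Rightarrow> complex ^ 's::finite ^ 's) \<Rightarrow>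
    ('n, 's) spinor_field \<Rightarrow> ('n, 's) spinor_field" where
  "dirac_y \<rho>' F = (\<lambda>p. \<Sum>j\<in>UNIV. (mat 1 \<otimes>\<^sub>K \<rho>' (cc_of (cl_vec (axis j 1)))) *v dy j F p)"

definition E_op ::
  "('n::finite complex_clifford \<Rightarrow> complex ^ 's::finite ^ 's) \<Rightarrow>
   ('n complex_clifford \<Rightarrow> complex ^ 's ^ 's) \<Rightarrow> complex \<Rightarrow> complex \<Rightarrow>
   ('n, 's) spinor_field \<Rightarrow> ('n, 's) spinor_field" where
  "E_op \<rho> \<rho>' lam mu F = (\<lambda>(x, y).
     let n = of_nat CARD('n) :: complex;
         R = (\<lambda>v. \<rho> (cc_of (cl_vec v)));
         R' = (\<lambda>v. \<rho>' (cc_of (cl_vec v)));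
         e = (\<lambda>j. axis j 1 :: real ^ 'n)
     in (norm (x - y))\<^sup>2 *\<^sub>R laplace_x (laplace_y F) (x, y)
      + (2 * (2 * lam - n + 1)) *s (\<Sum>j\<in>UNIV. (x $ j - y $ j) *\<^sub>R dx j (laplace_y F) (x, y))
      + (2 * (2 * mu - n + 1)) *s (\<Sum>j\<in>UNIV. (y $ j - x $ j) *\<^sub>R laplace_x (dy j F) (x, y))
      - 2 *s ((R (x - y) \<otimes>\<^sub>K mat 1) *v dirac_x \<rho> (laplace_y F) (x, y))
      - 2 *s ((mat 1 \<otimes>\<^sub>K R' (y - x)) *v laplace_x (dirac_y \<rho>' F) (x, y))
      + ((2 * mu - n + 1) * (2 * mu + 1)) *s laplace_x F (x, y)
      + ((2 * lam - n + 1) * (2 * lam + 1)) *s laplace_y F (x, y)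
      - (2 * (2 * lam - n + 1) * (2 * mu - n + 1)) *s (\<Sum>j\<in>UNIV. dx j (dy j F) (x, y))
      + (2 * (2 * lam - n + 1)) *s
          (\<Sum>j\<in>UNIV. dx j (\<lambda>p. (mat 1 \<otimes>\<^sub>K R' (e j)) *v dirac_y \<rho>' F p) (x, y))
      + (2 * (2 * mu - n + 1)) *s
          (\<Sum>j\<in>UNIV. (R (e j) \<otimes>\<^sub>K mat 1) *v dirac_x \<rho> (dy j F) (x, y))
      - 2 *s (\<Sum>j\<in>UNIV. (R (e j) \<otimes>\<^sub>K R' (e j)) *v dirac_x \<rho> (dirac_y \<rho>' F) (x, y)))"

end

theory Submission
  imports Defs
begin

text \<open>Put \<open>s = 2\<lambda> - n + 1\<close>, \<open>\<kappa>\<^sub>\<lambda> = s (s + n)\<close> and \<open>L\<^sub>v = s \<partial>\<^sub>v - \<rho>(v) D\<close>. The second order operators \<open>\<Delta>\<close>, \<open>L\<^sub>e\<^sub>j\<close>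
  and \<open>\<kappa>\<^sub>\<lambda>\<close> are the components, in a moving frame of \<open>\<real>\<^sup>1\<^sup>,\<^sup>n\<^sup>+\<^sup>1\<close> attached to the point \<open>x\<close> of the null cone, of one
  vector valued operator \<open>\<Omega>\<^sub>\<lambda>\<close> which is covariant: \<open>\<Omega>\<^sub>\<lambda> \<circ> \<pi>\<^sub>\<lambda>(g) = g \<cdot> \<pi>\<^sub>\<lambda>\<^sub>+\<^sub>1(g) \<circ> \<Omega>\<^sub>\<lambda>\<close>. The operator \<open>E\<^sub>\<lambda>\<^sub>,\<^sub>\<mu>\<close> is
  twice the contraction of \<open>\<Omega>\<^sub>\<lambda>\<close> in \<open>x\<close> with \<open>\<Omega>\<^sub>\<mu>\<close> in \<open>y\<close> by the Lorentz form \<open>Q\<close>, hence it is covariant because \<open>Q\<close>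
  is invariant. The covariance of \<open>\<Omega>\<^sub>\<lambda>\<close> is checked at one point: if \<open>h = g\<^sup>-\<^sup>1\<close> is defined at \<open>x\<close>, the
  factorization of \<open>h n\<^sub>x\<close> reads \<open>h = n\<^sub>b m a n n\<^sub>x\<^sup>-\<^sup>1\<close> (with \<open>n\<^sub>x\<close>, \<open>n\<^sub>b\<close> in the opposite group), so that near \<open>x\<close> the map
  is a special conformal transformation fixing the origin followed by a similarity, and only its
  second order Taylor expansion matters.\<close>

text \<open>The Clifford algebra is a quotient of formal terms, so its collapse has to be excluded:
  \<open>1 \<noteq> 0\<close> follows from the given module, and this gives the definite
  descriptions \<open>act\<close>, \<open>m_part\<close>, \<open>a_part\<close>, \<open>chi\<close>
  their expected values. The Lorentz form is likewise recovered from the algebra, as the scalar in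
  the Clifford relation. The local formula for the action comes from one identity, a Gauss
  decomposition of \<open>n_elt c * nbar_elt z\<close>, valid while |1 - c z| > 0. The number s is
  forced: under z |-> z (1 - c z)^(-1) the Laplacian acquires a first order part, and this is - 2
  L_c exactly because the weight |1 - c z|^(- (2 lambda + 1)) has exponent s + n up to sign; L_v and
  kappa close the system. The tensor Omega is never formed: a bilinear map stands for the pairing of
  its vectors with its operators. There remains the locus where the inverse of g is undefined: the
  right side is 0 there by the extension, and compactness of the support makes the function on the
  left vanish in a whole neighbourhood.\<close>

lemma cl_vector_add: "cl_vector (v + w) = cl_vector v + cl_vector w"
  by transfer (rule clifford_eq.vector_plus)

lemma cl_vector_scaleR: "cl_vector (r *\<^sub>R v) = r *\<^sub>R cl_vector v"
  by transfer (rule clifford_eq.vector_scale)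

lemma cl_vec_add: "cl_vec (x + y) = cl_vec x + cl_vec y"
  using cl_vector_add[of "(0, x, 0)" "(0, y, 0)"] by (simp add: cl_vec_def)

lemma cl_vec_scaleR: "cl_vec (r *\<^sub>R x) = r *\<^sub>R cl_vec x"
  using cl_vector_scaleR[of r "(0, x, 0)"] by (simp add: cl_vec_def)

lemma cl_vec_minus: "cl_vec (- x) = - cl_vec x"
  using cl_vec_scaleR[of "-1" x] by simp

lemma cl_vec_diff: "cl_vec (x - y) = cl_vec x - cl_vec y"
  using cl_vec_add[of x "- y"] by (simp add: cl_vec_minus)

lemma cl_vec_zero [simp]: "cl_vec 0 = 0"
  using cl_vec_scaleR[of 0 0] by simp

lemmas cl_vec_linear = cl_vec_add cl_vec_diff cl_vec_minus cl_vec_scaleR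

section \<open>Null vectors and normal forms in the Clifford algebra\<close>

definition eps :: "'n::finite clifford" where "eps = cl_vector (1, 0, 1)"
definition del :: "'n::finite clifford" where "del = cl_vector (1, 0, - 1)"

lemma cl_e0_plus_elast: "cl_e0 + cl_elast = eps"
  by (simp add: cl_e0_def cl_elast_def eps_def flip: cl_vector_add)

lemma cl_e0_minus_elast: "cl_e0 - cl_elast = del"
proof -
  have "del + cl_elast = (cl_e0 :: 'a clifford)"
    by (simp add: cl_e0_def cl_elast_def del_def zero_prod_def flip: cl_vector_add)
  then show ?thesis by (simp add: algebra_simps)
qed

lemma cl_vector_decomp:
  "cl_vector (r, v, s) = ((r + s) / 2) *\<^sub>R eps + cl_vec v + ((r - s) / 2) *\<^sub>R del"
proof -
  have "(r, v, s) = ((r + s) / 2) *\<^sub>R (1, 0, 1) + (0, v, 0) + ((r - s) / 2) *\<^sub>R (1, 0, - 1)"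
    by (simp add: field_simps)
  then show ?thesis
    by (simp only: cl_vector_add cl_vector_scaleR eps_def cl_vec_def del_def)
qed

lemma cl_vector_square: "cl_vector v * cl_vector v = mink_form v v *\<^sub>R 1"
proof -
  have "2 *\<^sub>R (cl_vector v * cl_vector v) = 2 *\<^sub>R (mink_form v v *\<^sub>R 1)"
    using cl_vector_relation[of v v] by (simp add: scaleR_2 flip: scaleR_add_left)
  then show ?thesis by (simp only: scaleR_cancel_left) simp
qed

lemma eps_square: "eps * eps = 0"
  by (simp add: eps_def cl_vector_square mink_form_def)

lemma del_square: "del * del = 0"
  by (simp add: del_def cl_vector_square mink_form_def)

lemma cl_vec_square: "cl_vec x * cl_vec x = - (x \<bullet> x) *\<^sub>R 1"
  by (simp add: cl_vec_def cl_vector_square mink_form_def)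

text \<open>As a rewrite rule this would loop. The simplifier only receives instances at a fixed
  pair of vectors, and the instance chooses their order.\<close>

lemma cl_vec_swap: "cl_vec y * cl_vec x = - (cl_vec x * cl_vec y) - (2 * (x \<bullet> y)) *\<^sub>R 1"
proof -
  have "cl_vec x * cl_vec y + cl_vec y * cl_vec x = - (2 * (x \<bullet> y)) *\<^sub>R 1"
    using cl_vector_relation[of "(0, x, 0)" "(0, y, 0)"] by (simp add: cl_vec_def mink_form_def)
  moreover have "cl_vec y * cl_vec x = - (cl_vec x * cl_vec y) + (cl_vec x * cl_vec y + cl_vec y * cl_vec x)"
    by simp
  ultimately show ?thesis by simp
qed

lemma eps_vec: "eps * cl_vec x = - (cl_vec x * eps)"
  using cl_vector_relation[of "(1, 0, 1)" "(0, x, 0)"]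
  by (simp add: cl_vec_def eps_def mink_form_def add_eq_0_iff2)

lemma del_vec: "del * cl_vec x = - (cl_vec x * del)"
  using cl_vector_relation[of "(1, 0, - 1)" "(0, x, 0)"]
  by (simp add: cl_vec_def del_def mink_form_def add_eq_0_iff2)

lemma del_eps: "del * eps = 4 *\<^sub>R 1 - eps * del"
  using cl_vector_relation[of "(1, 0, 1)" "(1, 0, - 1)"]
  by (simp add: eps_def del_def mink_form_def algebra_simps)

lemmas cl_rules = eps_square del_square eps_vec del_vec del_eps cl_vec_square

text \<open>Expansion associates products to the right, so each relation is also needed with a tail
  \<open>a\<close>. Together the rules sort words: vectors of R^n come before \<open>eps\<close>,
  and \<open>eps\<close> before \<open>del\<close>.\<close>

lemma cl_rules_assoc:
  "eps * (eps * a) = 0"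
  "del * (del * a) = 0"
  "eps * (cl_vec x * a) = - (cl_vec x * (eps * a))"
  "del * (cl_vec x * a) = - (cl_vec x * (del * a))"
  "del * (eps * a) = 4 *\<^sub>R a - eps * (del * a)"
  "cl_vec x * (cl_vec x * a) = - (x \<bullet> x) *\<^sub>R a"
  by (simp_all add: cl_rules ring_distribs flip: mult.assoc)

lemma cl_vec_swap_assoc:
  "cl_vec y * (cl_vec x * a) = - (cl_vec x * (cl_vec y * a)) - (2 * (x \<bullet> y)) *\<^sub>R a"
proof -
  have "cl_vec y * (cl_vec x * a) = (cl_vec y * cl_vec x) * a" by (simp add: mult.assoc)
  also have "\<dots> = - (cl_vec x * (cl_vec y * a)) - (2 * (x \<bullet> y)) *\<^sub>R a"
    by (subst cl_vec_swap) (simp add: algebra_simps)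
  finally show ?thesis .
qed

lemma eps_del_eps: "eps * (del * eps) = 4 *\<^sub>R eps"
  by (simp add: del_eps algebra_simps cl_rules_assoc)

lemma del_eps_del: "del * (eps * del) = 4 *\<^sub>R del"
  by (simp add: cl_rules_assoc cl_rules)

text \<open>A quarter of \<open>del * eps\<close> and a quarter of \<open>eps * del\<close> are
  complementary idempotents, and \<open>cl_e0 * cl_elast\<close> is their difference. This is the
  spectral decomposition of \<open>a_elt t\<close>.\<close>

lemma a_elt_eps_del:
  "a_elt t = (exp t / 4) *\<^sub>R (del * eps) + (exp (- t) / 4) *\<^sub>R (eps * del)"
proof -
  have e0: "cl_e0 = (1/2) *\<^sub>R (eps + del)"
    using cl_vector_decomp[of 1 0 0] by (simp add: cl_e0_def algebra_simps)
  have el: "cl_elast = (1/2) *\<^sub>R (eps - del)"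
    using cl_vector_decomp[of 0 0 1] by (simp add: cl_elast_def algebra_simps)
  have "cl_e0 * cl_elast = (1/4) *\<^sub>R (del * eps - eps * del :: 'a clifford)"
    unfolding e0 el by (simp add: algebra_simps cl_rules flip: scaleR_add_left)
  moreover have "1 = (1/4) *\<^sub>R (del * eps + eps * del :: 'a clifford)"
    by (simp add: del_eps)
  ultimately have "a_elt t = cosh t *\<^sub>R ((1/4) *\<^sub>R (del * eps + eps * del)) +
       sinh t *\<^sub>R ((1/4) *\<^sub>R (del * eps - eps * del :: 'a clifford))"
    unfolding a_elt_def by metis
  also have "\<dots> = ((cosh t + sinh t) / 4) *\<^sub>R (del * eps) + ((cosh t - sinh t) / 4) *\<^sub>R (eps * del)"
    by (simp add: algebra_simps add_divide_distrib diff_divide_distrib)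
  finally show ?thesis
    by (simp add: cosh_plus_sinh cosh_minus_sinh)
qed

lemma a_elt_del: "a_elt t * del = exp t *\<^sub>R del"
  by (simp add: a_elt_eps_del algebra_simps cl_rules cl_rules_assoc)

lemma a_elt_eps: "a_elt t * eps = exp (- t) *\<^sub>R eps"
  by (simp add: a_elt_eps_del algebra_simps cl_rules cl_rules_assoc)

lemma del_a_elt: "del * a_elt t = exp (- t) *\<^sub>R del"
  by (simp add: a_elt_eps_del algebra_simps cl_rules cl_rules_assoc)

lemma eps_a_elt: "eps * a_elt t = exp t *\<^sub>R eps"
  by (simp add: a_elt_eps_del algebra_simps cl_rules cl_rules_assoc)

lemma a_elt_vec: "a_elt t * cl_vec x = cl_vec x * a_elt t"
  by (simp add: a_elt_eps_del algebra_simps cl_rules cl_rules_assoc)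

lemma a_elt_zero [simp]: "a_elt 0 = 1"
  by (simp add: a_elt_def)

lemma a_elt_add: "a_elt s * a_elt t = a_elt (s + t)"
proof -
  have "a_elt s * a_elt t =
      (exp t / 4) *\<^sub>R ((a_elt s * del) * eps) + (exp (- t) / 4) *\<^sub>R ((a_elt s * eps) * del)"
    by (subst a_elt_eps_del[of t]) (simp add: algebra_simps)
  also have "\<dots> = ((exp s * exp t) / 4) *\<^sub>R (del * eps) +
      ((exp (- s) * exp (- t)) / 4) *\<^sub>R (eps * del)"
    unfolding a_elt_del a_elt_eps by (simp add: mult.commute)
  also have "\<dots> = a_elt (s + t)"
    by (simp add: a_elt_eps_del flip: exp_add)
  finally show ?thesis .
qed

lemma nbar_elt_alt: "nbar_elt x = 1 + (1 / 2) *\<^sub>R (cl_vec x * eps)"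
  by (simp add: nbar_elt_def cl_e0_plus_elast)

lemma n_elt_alt: "n_elt x = 1 + (1 / 2) *\<^sub>R (cl_vec x * del)"
  by (simp add: n_elt_def cl_e0_minus_elast)

lemma nbar_elt_zero [simp]: "nbar_elt 0 = 1" by (simp add: nbar_elt_alt)
lemma n_elt_zero [simp]: "n_elt 0 = 1" by (simp add: n_elt_alt)

lemma nbar_elt_add: "nbar_elt x * nbar_elt y = nbar_elt (x + y)"
  by (simp add: nbar_elt_alt algebra_simps cl_rules cl_rules_assoc cl_vec_linear)

lemma n_elt_add: "n_elt x * n_elt y = n_elt (x + y)"
  by (simp add: n_elt_alt algebra_simps cl_rules cl_rules_assoc cl_vec_linear)

lemma a_nbar: "a_elt t * nbar_elt x = nbar_elt (exp (- 2 * t) *\<^sub>R x) * a_elt t"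
proof -
  have "a_elt t * nbar_elt x = a_elt t + (1/2) *\<^sub>R (cl_vec x * (a_elt t * eps))"
    by (simp add: nbar_elt_alt algebra_simps a_elt_vec flip: mult.assoc)
  also have "\<dots> = nbar_elt (exp (- 2 * t) *\<^sub>R x) * a_elt t"
    by (simp add: nbar_elt_alt algebra_simps a_elt_eps eps_a_elt cl_vec_linear flip: exp_add)
  finally show ?thesis .
qed

lemma a_n: "a_elt t * n_elt x = n_elt (exp (2 * t) *\<^sub>R x) * a_elt t"
proof -
  have "a_elt t * n_elt x = a_elt t + (1/2) *\<^sub>R (cl_vec x * (a_elt t * del))"
    by (simp add: n_elt_alt algebra_simps a_elt_vec flip: mult.assoc)
  also have "\<dots> = n_elt (exp (2 * t) *\<^sub>R x) * a_elt t"
    by (simp add: n_elt_alt algebra_simps a_elt_del del_a_elt cl_vec_linear flip: exp_add)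
  finally show ?thesis .
qed

section \<open>The group Spin(n) and its rotations\<close>

lemma Spin_M_one: "1 \<in> Spin_M"
  unfolding Spin_M_def by (auto intro!: exI[of _ "[]"])

lemma Spin_M_mult:
  assumes "m \<in> Spin_M" "m' \<in> Spin_M" shows "m * m' \<in> Spin_M"
proof -
  from assms obtain xs ys where "m = prod_list (map cl_vec xs)" "m' = prod_list (map cl_vec ys)"
    "even (length xs)" "even (length ys)" "\<forall>x\<in>set xs. norm x = 1" "\<forall>x\<in>set ys. norm x = 1"
    unfolding Spin_M_def by auto
  then show ?thesis
    unfolding Spin_M_def by (auto intro!: exI[of _ "xs @ ys"])
qed

lemma unit_vec_product_inverse:
  assumes "\<forall>x\<in>set xs. norm x = 1"
  shows "prod_list (map cl_vec xs) * prod_list (map cl_vec (rev (map uminus xs))) = 1"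
  using assms
proof (induction xs)
  case (Cons x xs)
  have "cl_vec x * cl_vec (- x) = 1"
    using Cons.prems by (simp add: cl_vec_minus cl_vec_square norm_eq_1)
  moreover have "prod_list (map cl_vec (x # xs)) * prod_list (map cl_vec (rev (map uminus (x # xs))))
      = cl_vec x * (prod_list (map cl_vec xs) * prod_list (map cl_vec (rev (map uminus xs)))) * cl_vec (- x)"
    by (simp add: mult.assoc)
  ultimately show ?case using Cons by simp
qed simp

lemma Spin_M_inverse:
  assumes "m \<in> Spin_M"
  obtains m' where "m' \<in> Spin_M" "m * m' = 1" "m' * m = 1"
proof -
  from assms obtain xs where xs: "m = prod_list (map cl_vec xs)" "even (length xs)"
      "\<forall>x\<in>set xs. norm x = 1"
    unfolding Spin_M_def by auto
  define ys where "ys = rev (map uminus xs)"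
  have ys: "\<forall>x\<in>set ys. norm x = 1" "even (length ys)" "rev (map uminus ys) = xs"
    using xs by (auto simp: ys_def rev_map o_def)
  show ?thesis
  proof (rule that)
    show "prod_list (map cl_vec ys) \<in> Spin_M" using ys unfolding Spin_M_def by auto
    show "m * prod_list (map cl_vec ys) = 1"
      using unit_vec_product_inverse[OF xs(3)] by (simp add: xs(1) ys_def)
    show "prod_list (map cl_vec ys) * m = 1"
      using unit_vec_product_inverse[OF ys(1)] ys(3) by (simp add: xs(1))
  qed
qed

lemma Spin_M_euclid: "m \<in> Spin_M \<Longrightarrow> m \<in> euclid_clifford"
proof -
  have "prod_list (map cl_vec xs) \<in> euclid_clifford" for xs :: "(real ^ 'a) list"
    by (induction xs) (auto intro: euclid_clifford.intros)
  then show "m \<in> Spin_M \<Longrightarrow> m \<in> euclid_clifford" by (auto simp: Spin_M_def)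
qed

lemma null_vec_products:
  "del * prod_list (map cl_vec xs) = (- 1) ^ length xs *\<^sub>R (prod_list (map cl_vec xs) * del)"
  "eps * prod_list (map cl_vec xs) = (- 1) ^ length xs *\<^sub>R (prod_list (map cl_vec xs) * eps)"
  by (induction xs) (simp_all add: cl_rules_assoc algebra_simps)

lemma Spin_M_commute:
  assumes "m \<in> Spin_M" shows "eps * m = m * eps" "del * m = m * del" "a_elt t * m = m * a_elt t"
proof -
  show *: "eps * m = m * eps" "del * m = m * del"
    using assms by (auto simp: Spin_M_def null_vec_products)
  show "a_elt t * m = m * a_elt t"
  proof -
    have "del * eps * m = m * (del * eps)" by (simp only: mult.assoc *) (simp only: * flip: mult.assoc)
    moreover have "eps * del * m = m * (eps * del)" by (simp only: mult.assoc *) (simp only: * flip: mult.assoc)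
    ultimately show ?thesis unfolding a_elt_eps_del
      by (simp only: ring_distribs mult_scaleR_left mult_scaleR_right)
  qed
qed

text \<open>Conjugation by a unit vector x is minus the reflection in the hyperplane orthogonal to
  x. The sign is kept apart from the reflections, so that the induction can pass through products of
  odd length.\<close>

lemma unit_vec_product_rotation:
  assumes "\<forall>x\<in>set xs. norm x = 1"
  shows "\<exists>w. orthogonal_transformation w \<and>
    (\<forall>v. prod_list (map cl_vec xs) * cl_vec v =
       ((- 1) ^ length xs) *\<^sub>R (cl_vec (w v) * prod_list (map cl_vec xs)))"
  using assms
proof (induction xs)
  case Nil
  show ?case by (rule exI[of _ id]) (simp add: orthogonal_transformation_id[unfolded id_def] id_def)
next
  case (Cons x xs)
  then obtain w where w: "orthogonal_transformation w"
    "\<And>v. prod_list (map cl_vec xs) * cl_vec v =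
       ((- 1) ^ length xs) *\<^sub>R (cl_vec (w v) * prod_list (map cl_vec xs))" by auto
  define r where "r u = u - (2 * (x \<bullet> u)) *\<^sub>R x" for u
  have x: "x \<bullet> x = 1" using Cons.prems by (simp add: norm_eq_1)
  have "linear r" unfolding r_def
    by (rule linearI) (simp_all add: algebra_simps inner_add_right)
  moreover have "r u \<bullet> r u' = u \<bullet> u'" for u u'
    by (simp add: r_def inner_diff_left inner_diff_right x inner_commute[of u x] algebra_simps)
  ultimately have r: "orthogonal_transformation r"
    by (simp add: orthogonal_transformation_def)
  have rx: "cl_vec x * cl_vec u = - (cl_vec (r u) * cl_vec x)" for u
    by (simp add: r_def cl_vec_linear algebra_simps cl_vec_square x cl_vec_swap[where y = x and x = u] inner_commute)
  have "prod_list (map cl_vec (x # xs)) * cl_vec v =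
       ((- 1) ^ length (x # xs)) *\<^sub>R (cl_vec (r (w v)) * prod_list (map cl_vec (x # xs)))" for v
  proof -
    let ?p = "prod_list (map cl_vec xs)"
    have "cl_vec x * ?p * cl_vec v = cl_vec x * (?p * cl_vec v)" by (rule mult.assoc)
    also have "\<dots> = ((- 1) ^ length xs) *\<^sub>R (cl_vec x * cl_vec (w v) * ?p)"
      unfolding w(2) mult_scaleR_right by (simp only: mult.assoc)
    also have "\<dots> = ((- 1) ^ length (x # xs)) *\<^sub>R (cl_vec (r (w v)) * (cl_vec x * ?p))"
      unfolding rx[of "w v"] by (simp add: mult.assoc)
    finally show ?thesis by simp
  qed
  then show ?case
    using orthogonal_transformation_compose[OF r w(1)] by (intro exI[of _ "r \<circ> w"]) (simp add: o_def)
qed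

lemma Spin_M_rotation:
  assumes "m \<in> Spin_M"
  obtains w where "orthogonal_transformation w" "\<And>v. m * cl_vec v = cl_vec (w v) * m"
proof -
  from assms obtain xs where xs: "m = prod_list (map cl_vec xs)" "even (length xs)"
      "\<forall>x\<in>set xs. norm x = 1"
    unfolding Spin_M_def by auto
  with unit_vec_product_rotation[OF xs(3)] that show ?thesis by auto
qed

lemma Spin_M_nbar:
  fixes m :: "'n::finite clifford"
  assumes "m \<in> Spin_M" "\<And>v. m * cl_vec v = cl_vec (w v) * m"
  shows "m * nbar_elt x = nbar_elt (w x) * m" "m * n_elt x = n_elt (w x) * m"
proof -
  have *: "m * (1 + (1 / 2) *\<^sub>R (cl_vec x * e)) = (1 + (1 / 2) *\<^sub>R (cl_vec (w x) * e)) * m"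
    if e: "e * m = m * e" for e :: "'n clifford"
  proof -
    have "m * (cl_vec x * e) = (m * cl_vec x) * e" by (rule mult.assoc[symmetric])
    also have "\<dots> = cl_vec (w x) * (m * e)" by (simp only: assms(2) mult.assoc)
    also have "\<dots> = cl_vec (w x) * e * m" by (simp only: e[symmetric] mult.assoc)
    finally have **: "m * (cl_vec x * e) = cl_vec (w x) * e * m" .
    show ?thesis
      unfolding ring_distribs mult_scaleR_left mult_scaleR_right mult_1_left mult_1_right ** ..
  qed
  show "m * nbar_elt x = nbar_elt (w x) * m"
    unfolding nbar_elt_alt by (rule *[OF Spin_M_commute(1)[OF assms(1)]])
  show "m * n_elt x = n_elt (w x) * m"
    unfolding n_elt_alt by (rule *[OF Spin_M_commute(2)[OF assms(1)]])
qed

section \<open>Matrix modules of the Euclidean Clifford algebra\<close>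

lemma matrix_vector_mult_scaleR: "A *v (r *\<^sub>R x) = r *\<^sub>R (A *v x)"
  for A :: "complex ^ 'n::finite ^ 'm::finite"
  by (simp add: matrix_vector_mult_def vec_eq_iff scaleR_sum_right)

lemma scaleR_matrix_vector_mult: "(r *\<^sub>R A) *v x = r *\<^sub>R (A *v x)"
  for A :: "complex ^ 'n::finite ^ 'm::finite"
  by (simp add: matrix_vector_mult_def vec_eq_iff scaleR_sum_right)

lemma euclid_clifford_zero: "0 \<in> euclid_clifford"
  using euclid_clifford.scale[OF euclid_clifford.one, of 0] by simp

lemma cc_of_mem: "a \<in> euclid_clifford \<Longrightarrow> cc_of a \<in> euclid_clifford \<times> euclid_clifford"
  by (simp add: cc_of_def euclid_clifford_zero)

context
  fixes \<rho> :: "'n::finite complex_clifford \<Rightarrow> complex ^ 's::finite ^ 's"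
  assumes module: "clifford_module \<rho>"
begin

lemma module_one: "\<rho> (cc_of 1) = mat 1"
  using module by (simp add: clifford_module_def)

lemma module_hom:
  assumes "p \<in> euclid_clifford \<times> euclid_clifford" "q \<in> euclid_clifford \<times> euclid_clifford"
  shows "\<rho> (p + q) = \<rho> p + \<rho> q" "\<rho> (cc_mult p q) = \<rho> p ** \<rho> q" "\<rho> (cc_scale z p) = mat z ** \<rho> p"
  using module assms unfolding clifford_module_def by blast+

lemma module_add:
  assumes "a \<in> euclid_clifford" "b \<in> euclid_clifford"
  shows "\<rho> (cc_of (a + b)) = \<rho> (cc_of a) + \<rho> (cc_of b)"
proof -
  have "cc_of (a + b) = cc_of a + cc_of b" by (simp add: cc_of_def)
  then show ?thesis
    using assms[THEN cc_of_mem] by (simp only: module_hom)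
qed

lemma module_mult:
  assumes "a \<in> euclid_clifford" "b \<in> euclid_clifford"
  shows "\<rho> (cc_of (a * b)) = \<rho> (cc_of a) ** \<rho> (cc_of b)"
proof -
  have "cc_of (a * b) = cc_mult (cc_of a) (cc_of b)" by (simp add: cc_of_def cc_mult_def)
  then show ?thesis
    using assms[THEN cc_of_mem] by (simp only: module_hom)
qed

lemma module_scaleR:
  assumes "a \<in> euclid_clifford"
  shows "\<rho> (cc_of (r *\<^sub>R a)) = r *\<^sub>R \<rho> (cc_of a)"
proof -
  have "cc_of (r *\<^sub>R a) = cc_scale (of_real r) (cc_of a)" by (simp add: cc_of_def cc_scale_def)
  then have "\<rho> (cc_of (r *\<^sub>R a)) = mat (of_real r) ** \<rho> (cc_of a)"
    using assms[THEN cc_of_mem] by (simp only: module_hom)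
  also have "\<dots> = r *\<^sub>R \<rho> (cc_of a)"
    by (simp add: matrix_matrix_mult_def mat_def vec_eq_iff if_distrib[of "\<lambda>x. x * _"]
        scaleR_conv_of_real[where 'a = complex] cong: if_cong)
  finally show ?thesis .
qed

lemma module_vec_add: "\<rho> (cc_of (cl_vec (x + y))) = \<rho> (cc_of (cl_vec x)) + \<rho> (cc_of (cl_vec y))"
  by (simp add: cl_vec_add module_add euclid_clifford.vec)

lemma module_vec_scaleR: "\<rho> (cc_of (cl_vec (r *\<^sub>R x))) = r *\<^sub>R \<rho> (cc_of (cl_vec x))"
  by (simp add: cl_vec_scaleR module_scaleR euclid_clifford.vec)

lemma module_vec_square: "\<rho> (cc_of (cl_vec x)) ** \<rho> (cc_of (cl_vec x)) = - (x \<bullet> x) *\<^sub>R mat 1"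
  using module_mult[of "cl_vec x" "cl_vec x"] module_scaleR[of 1 "- (x \<bullet> x)"]
  by (simp add: cl_vec_square euclid_clifford.vec euclid_clifford.one module_one)

end

text \<open>Evaluation of formal terms as operators, before any quotient is taken: a model in which
  an equality of the presentation can be refuted.\<close>

primrec term_action :: "('n::finite minkowski \<Rightarrow> 'v \<Rightarrow> 'v) \<Rightarrow> 'n clifford_term \<Rightarrow> 'v::real_vector \<Rightarrow> 'v"
  where
    "term_action f (Scalar r) = (\<lambda>p. r *\<^sub>R p)"
  | "term_action f (Vector v) = f v"
  | "term_action f (Plus a b) = (\<lambda>p. term_action f a p + term_action f b p)"
  | "term_action f (Times a b) = (\<lambda>p. term_action f a (term_action f b p))"

text \<open>Soundness of the presentation, by induction over \<open>clifford_eq\<close>. Linearity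
  of each \<open>f v\<close> accounts for left distributivity and for the centrality of the
  scalars.\<close>

lemma term_action_respects:
  assumes "clifford_eq a b"
    and lin: "\<And>v. linear (f v)"
    and f: "\<And>v w p. f (v + w) p = f v p + f w p" "\<And>r v p. f (r *\<^sub>R v) p = r *\<^sub>R f v p"
      "\<And>v w p. f v (f w p) + f w (f v p) = (2 * mink_form v w) *\<^sub>R p"
  shows "term_action f a = term_action f b"
proof -
  have lin': "linear (term_action f a)" for a
    by (induction a) (auto intro!: linearI simp: lin linear_add linear_scale algebra_simps)
  show ?thesis
    using assms(1)
    by (induction) (auto simp: fun_eq_iff f algebra_simps linear_add[OF lin'] linear_scale[OF lin'])
qed

text \<open>A Clifford module of Euclidean space doubles to one of Minkowski space.\<close>

lemma clifford_one_neq_zero: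
  assumes "clifford_module (\<rho> :: 'n::finite complex_clifford \<Rightarrow> complex ^ 's::finite ^ 's)"
  shows "(1 :: 'n clifford) \<noteq> 0"
proof
  define R where "R x = \<rho> (cc_of (cl_vec x))" for x
  have R: "R (x + y) = R x + R y" "R (r *\<^sub>R x) = r *\<^sub>R R x" for x y r
    by (simp_all add: R_def module_vec_add[OF assms] module_vec_scaleR[OF assms])
  have RR: "R x *v (R x *v u) = - (x \<bullet> x) *\<^sub>R u" for x u
    using module_vec_square[OF assms, of x]
    by (simp add: R_def matrix_vector_mul_assoc scaleR_matrix_vector_mult flip: scaleR_minus_left)
  have Rxy: "R x *v (R y *v u) + R y *v (R x *v u) = - (2 * (x \<bullet> y)) *\<^sub>R u" for x y u
  proof -
    have "R x *v (R y *v u) + R y *v (R x *v u) =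
        R (x + y) *v (R (x + y) *v u) - R x *v (R x *v u) - R y *v (R y *v u)"
      by (simp add: R matrix_vector_mult_add_rdistrib matrix_vector_right_distrib)
    also have "\<dots> = - (2 * (x \<bullet> y)) *\<^sub>R u"
      unfolding RR scaleR_diff_left[symmetric] by (simp add: inner_add_left inner_add_right inner_commute)
    finally show ?thesis .
  qed
  have Rxy': "R x *v (R y *v u) = - (2 * (x \<bullet> y)) *\<^sub>R u - R y *v (R x *v u)" for x y u
    using Rxy[of x y u] by (simp add: eq_diff_eq)
  \<comment> \<open>With v = (s, x, t) this is the block matrix with rows (R x, s + t) and (s - t, -
    R x). The opposite signs on the diagonal cancel the off-diagonal part of its square, which
    leaves - |x|^2 + s^2 - t^2 = Q(v).\<close>
  define f :: "'n minkowski \<Rightarrow> (complex ^ 's) \<times> (complex ^ 's) \<Rightarrow> (complex ^ 's) \<times> (complex ^ 's)"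
    where "f v p = (R (fst (snd v)) *v fst p + (fst v + snd (snd v)) *\<^sub>R snd p,
      (fst v - snd (snd v)) *\<^sub>R fst p - R (fst (snd v)) *v snd p)" for v p
  have "linear (f v)" for v
    by (rule linearI) (simp_all add: f_def matrix_vector_right_distrib matrix_vector_mult_scaleR
        algebra_simps)
  moreover have "f (v + w) p = f v p + f w p" "f (r *\<^sub>R v) p = r *\<^sub>R f v p" for v w p r
    by (simp_all add: f_def R matrix_vector_mult_add_rdistrib scaleR_matrix_vector_mult algebra_simps)
  moreover have "f v (f w p) + f w (f v p) = (2 * mink_form v w) *\<^sub>R p" for v w p
  proof -
    obtain s x t where v: "v = (s, x, t)" by (cases v)
    obtain s' x' t' where w: "w = (s', x', t')" by (cases w)
    obtain p1 p2 where p: "p = (p1, p2)" by (cases p)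
    show ?thesis
      by (simp add: v w p f_def mink_form_def matrix_vector_right_distrib
          matrix_vector_mult_diff_distrib matrix_vector_mult_scaleR Rxy'[of x x'] algebra_simps)
        (simp add: vec_eq_iff scaleR_conv_of_real[where 'a = complex])
  qed
  moreover assume "(1 :: 'n clifford) = 0"
  then have "clifford_eq (Scalar 1 :: 'n clifford_term) (Scalar 0)" by transfer
  ultimately have "term_action f (Scalar 1) = term_action f (Scalar 0)"
    by (intro term_action_respects) auto
  then have "(p :: (complex ^ 's) \<times> (complex ^ 's)) = 0" for p
    by (auto dest: fun_cong[of _ _ p])
  from this[of "(vec 1, 0)"] show False by (simp add: vec_eq_iff zero_prod_def)
qed

subsection \<open>The vector representation\<close>

text \<open>\<open>intertwines h u v\<close> says \<open>v = h u h\<^sup>-\<^sup>1\<close> without mentioning the inverse. Half of \<open>del\<close> is conjugated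
  by \<open>nbar_elt x\<close> to \<open>cone_point x\<close>, and \<open>v \<in> \<real>\<^sup>n\<close> to \<open>tangent x v\<close>, so that
  \<open>cone_point x, tangent x e\<^sub>1, \<dots>, tangent x e\<^sub>n, null_eps\<close> is a frame attached to \<open>x\<close>.\<close>

definition intertwines :: "'n::finite clifford \<Rightarrow> 'n minkowski \<Rightarrow> 'n minkowski \<Rightarrow> bool" where
  "intertwines h u v \<longleftrightarrow> h * cl_vector u = cl_vector v * h"

lemma intertwines_mult:
  assumes "intertwines h u v" "intertwines k v w" shows "intertwines (k * h) u w"
proof -
  have "k * h * cl_vector u = (k * cl_vector v) * h"
    using assms(1) by (simp add: intertwines_def mult.assoc)
  also have "\<dots> = cl_vector w * (k * h)"
    using assms(2) by (simp add: intertwines_def mult.assoc)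
  finally show ?thesis by (simp add: intertwines_def)
qed

lemma intertwines_inverse:
  assumes "intertwines h u v" "h * h' = 1" "h' * h = 1" shows "intertwines h' v u"
proof -
  have "h' * cl_vector v = h' * (cl_vector v * h) * h'"
    by (simp add: mult.assoc assms(2))
  also have "\<dots> = h' * (h * cl_vector u) * h'"
    using assms(1) by (simp add: intertwines_def)
  also have "\<dots> = cl_vector u * h'"
    by (simp add: assms(3) flip: mult.assoc)
  finally show ?thesis by (simp add: intertwines_def)
qed

lemma intertwines_add:
  "intertwines h u v \<Longrightarrow> intertwines h u' v' \<Longrightarrow> intertwines h (u + u') (v + v')"
  by (simp add: intertwines_def cl_vector_add ring_distribs)

lemma intertwines_scaleR: "intertwines h u v \<Longrightarrow> intertwines h (r *\<^sub>R u) (r *\<^sub>R v)"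
  by (simp add: intertwines_def cl_vector_scaleR)

text \<open>Conjugating the Clifford relation turns 2 Q(u, v) h into 2 Q(u', v') h. The right
  inverse and \<open>1 \<noteq> 0\<close> make h nonzero, so that the scalars can be
  compared.\<close>

lemma intertwines_form:
  assumes "(1 :: 'n::finite clifford) \<noteq> 0" "(h :: 'n clifford) * h' = 1"
    and "intertwines h u u'" "intertwines h v v'"
  shows "mink_form u v = mink_form u' v'"
proof -
  have *: "h * (cl_vector u * cl_vector v) = cl_vector u' * cl_vector v' * h"
    if "intertwines h u u'" "intertwines h v v'" for u v u' v'
  proof -
    have "h * (cl_vector u * cl_vector v) = cl_vector u' * (h * cl_vector v)"
      using that(1) by (simp add: intertwines_def flip: mult.assoc)
    then show ?thesis using that(2) by (simp add: intertwines_def mult.assoc)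
  qed
  have "(2 * mink_form u v) *\<^sub>R h = (2 * mink_form u' v') *\<^sub>R h"
  proof -
    have "(2 * mink_form u v) *\<^sub>R h = h * (cl_vector u * cl_vector v + cl_vector v * cl_vector u)"
      by (simp add: cl_vector_relation)
    also have "\<dots> = (cl_vector u' * cl_vector v' + cl_vector v' * cl_vector u') * h"
      by (simp only: ring_distribs *[OF assms(3,4)] *[OF assms(4,3)])
    also have "\<dots> = (2 * mink_form u' v') *\<^sub>R h"
      by (simp add: cl_vector_relation)
    finally show ?thesis .
  qed
  moreover have "h \<noteq> 0" using assms(1,2) by auto
  ultimately show ?thesis by simp
qed

definition null_eps :: "'n::finite minkowski" where "null_eps = (1, 0, 1)"
definition null_del :: "'n::finite minkowski" where "null_del = (1, 0, - 1)"

lemma cl_vector_null: "cl_vector null_eps = eps" "cl_vector null_del = del"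
  by (simp_all add: null_eps_def null_del_def eps_def del_def)

text \<open>These points fill the slice of the null cone on which the pairing with
  \<open>null_eps\<close> is 1.\<close>

definition cone_point :: "real ^ 'n \<Rightarrow> 'n::finite minkowski" where
  "cone_point x = ((1 + x \<bullet> x) / 2, x, (x \<bullet> x - 1) / 2)"

text \<open>The derivative of \<open>cone_point\<close> at x in the direction v.\<close>

definition tangent :: "real ^ 'n \<Rightarrow> real ^ 'n \<Rightarrow> 'n::finite minkowski" where
  "tangent x v = (x \<bullet> v, v, x \<bullet> v)"

text \<open>The Gram matrix between the frames at x and y is the origin of the factors |x - y|^2 and
  x_j - y_j in E. The zero entries with \<open>null_eps\<close> are the reason why kappa is never
  paired with kappa or with L_v.\<close>

lemma mink_form_frame:
  "mink_form (cone_point x) (cone_point y) = (norm (x - y))\<^sup>2 / 2"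
  "mink_form (cone_point x) (tangent y v) = - ((x - y) \<bullet> v)"
  "mink_form (tangent x v) (cone_point y) = (x - y) \<bullet> v"
  "mink_form (cone_point x) null_eps = 1"
  "mink_form null_eps (cone_point x) = 1"
  "mink_form (tangent x v) (tangent y w) = - (v \<bullet> w)"
  "mink_form (tangent x v) null_eps = 0"
  "mink_form null_eps (tangent x v) = 0"
  "mink_form null_eps null_eps = 0"
  by (simp_all add: mink_form_def cone_point_def tangent_def null_eps_def power2_norm_eq_inner
      inner_diff_left inner_diff_right inner_commute field_simps)

lemma cl_vector_cone_point:
  "cl_vector (cone_point x) = (1 / 2) *\<^sub>R del + cl_vec x + (x \<bullet> x / 2) *\<^sub>R eps"
  by (simp add: cone_point_def cl_vector_decomp add_divide_distrib diff_divide_distrib)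

lemma cl_vector_tangent: "cl_vector (tangent x v) = cl_vec v + (x \<bullet> v) *\<^sub>R eps"
  by (simp add: tangent_def cl_vector_decomp)

lemma cl_vector_spatial: "cl_vector (0, v, 0) = cl_vec v"
  by (simp add: cl_vec_def)

lemma intertwines_nbar:
  "intertwines (nbar_elt x) null_eps null_eps"
  "intertwines (nbar_elt x) (0, v, 0) (tangent x v)"
  "intertwines (nbar_elt x) ((1 / 2) *\<^sub>R null_del) (cone_point x)"
  by (simp_all add: intertwines_def cl_vector_null cl_vector_tangent cl_vector_cone_point
      cl_vector_scaleR cl_vector_spatial nbar_elt_alt algebra_simps cl_rules cl_rules_assoc
      cl_vec_swap[of v x] cl_vec_swap_assoc[of v x])

lemma intertwines_n:
  "intertwines (n_elt c) null_del null_del"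
  "intertwines (n_elt c) (0, v, 0) ((0, v, 0) + (c \<bullet> v) *\<^sub>R null_del)"
  "intertwines (n_elt c) null_eps (null_eps + 2 *\<^sub>R (0, c, 0) + (c \<bullet> c) *\<^sub>R null_del)"
  by (simp_all only: intertwines_def cl_vector_null cl_vector_add
      cl_vector_scaleR cl_vector_spatial n_elt_alt)
    (simp_all add: algebra_simps cl_rules cl_rules_assoc cl_vec_swap[of v c] cl_vec_swap_assoc[of v c])

lemma intertwines_a:
  "intertwines (a_elt t) null_del (exp (2 * t) *\<^sub>R null_del)"
  "intertwines (a_elt t) (0, v, 0) (0, v, 0)"
  "intertwines (a_elt t) null_eps (exp (- 2 * t) *\<^sub>R null_eps)"
  by (simp_all only: intertwines_def cl_vector_null cl_vector_scaleR cl_vector_spatial a_elt_vec)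
    (simp_all add: a_elt_del del_a_elt a_elt_eps eps_a_elt flip: exp_add)

lemma intertwines_m:
  assumes "m \<in> Spin_M" "\<And>v. m * cl_vec v = cl_vec (w v) * m"
  shows "intertwines m null_del null_del" "intertwines m (0, v, 0) (0, w v, 0)"
    "intertwines m null_eps null_eps"
  using Spin_M_commute[OF assms(1)]
  by (simp_all add: intertwines_def cl_vector_null cl_vector_spatial assms(2))

text \<open>Half of \<open>null_del\<close>, the spatial vectors and \<open>null_eps\<close> form
  the frame at the origin. Read from the right, \<open>n_elt c\<close> shears it,
  \<open>a_elt t\<close> rescales it, m rotates it, and \<open>nbar_elt b\<close> carries it to the
  frame at b.\<close>

lemma intertwines_man:
  assumes m: "m \<in> Spin_M" "\<And>v. m * cl_vec v = cl_vec (w v) * m"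
  shows "intertwines (nbar_elt b * m * a_elt t * n_elt c) ((1 / 2) *\<^sub>R null_del)
      (exp (2 * t) *\<^sub>R cone_point b)"
    "intertwines (nbar_elt b * m * a_elt t * n_elt c) (0, v, 0)
      (tangent b (w v) + (2 * exp (2 * t) * (c \<bullet> v)) *\<^sub>R cone_point b)"
    "intertwines (nbar_elt b * m * a_elt t * n_elt c) null_eps
      (exp (- 2 * t) *\<^sub>R null_eps + 2 *\<^sub>R tangent b (w c) + (2 * exp (2 * t) * (c \<bullet> c)) *\<^sub>R cone_point b)"
proof -
  let ?k = "nbar_elt b * m * a_elt t"
  note nb = intertwines_nbar[of b] and im = intertwines_m[OF m]
  have del: "intertwines ?k null_del ((2 * exp (2 * t)) *\<^sub>R cone_point b)"
    using intertwines_mult[OF intertwines_a(1) intertwines_scaleR[OF intertwines_mult[OF im(1)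
      intertwines_scaleR[OF nb(3), of 2, simplified]]]]
    by (simp add: mult.assoc mult.commute[of 2])
  have vec: "intertwines ?k (0, v, 0) (tangent b (w v))" for v
    using intertwines_mult[OF intertwines_a(2) intertwines_mult[OF im(2) nb(2)]] by (simp add: mult.assoc)
  have eps: "intertwines ?k null_eps (exp (- 2 * t) *\<^sub>R null_eps)"
    using intertwines_mult[OF intertwines_a(3) intertwines_scaleR[OF intertwines_mult[OF im(3) nb(1)]]]
    by (simp add: mult.assoc)
  have 1: "intertwines (?k * n_elt c) null_del ((2 * exp (2 * t)) *\<^sub>R cone_point b)"
    by (rule intertwines_mult[OF intertwines_n(1) del])
  show "intertwines (?k * n_elt c) ((1 / 2) *\<^sub>R null_del) (exp (2 * t) *\<^sub>R cone_point b)"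
    using intertwines_scaleR[OF 1, of "1 / 2"] by simp
  show "intertwines (?k * n_elt c) (0, v, 0)
      (tangent b (w v) + (2 * exp (2 * t) * (c \<bullet> v)) *\<^sub>R cone_point b)"
    using intertwines_mult[OF intertwines_n(2) intertwines_add[OF vec intertwines_scaleR[OF del]]]
    by (simp add: mult_ac)
  show "intertwines (?k * n_elt c) null_eps
      (exp (- 2 * t) *\<^sub>R null_eps + 2 *\<^sub>R tangent b (w c) + (2 * exp (2 * t) * (c \<bullet> c)) *\<^sub>R cone_point b)"
    using intertwines_mult[OF intertwines_n(3) intertwines_add[OF intertwines_add[OF eps
      intertwines_scaleR[OF vec]] intertwines_scaleR[OF del]]]
    by (simp add: mult_ac)
qed

lemma nbar_elt_inverse: "nbar_elt x * nbar_elt (- x) = 1" "nbar_elt (- x) * nbar_elt x = 1"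
  by (simp_all add: nbar_elt_add)

text \<open>The inverse of \<open>nbar_elt x\<close> brings the frame at x to the origin, where
  \<open>intertwines_man\<close> applies. The outcome involves only w, t and c, the same data that
  govern the second order jet of the action at x.\<close>

lemma intertwines_factorization:
  assumes "factorization (h * nbar_elt x) b m (a_elt t) (n_elt c)" "\<And>v. m * cl_vec v = cl_vec (w v) * m"
  shows "intertwines h (cone_point x) (exp (2 * t) *\<^sub>R cone_point b)"
    "intertwines h (tangent x v) (tangent b (w v) + (2 * exp (2 * t) * (c \<bullet> v)) *\<^sub>R cone_point b)"
    "intertwines h null_eps
      (exp (- 2 * t) *\<^sub>R null_eps + 2 *\<^sub>R tangent b (w c) + (2 * exp (2 * t) * (c \<bullet> c)) *\<^sub>R cone_point b)"
proof -
  have m: "m \<in> Spin_M" and k: "nbar_elt b * m * a_elt t * n_elt c = h * nbar_elt x"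
    using assms(1) by (auto simp: factorization_def)
  have h: "h * nbar_elt x * nbar_elt (- x) = h"
    by (simp add: mult.assoc nbar_elt_inverse)
  note 1 = intertwines_man[OF m assms(2), of b t c, unfolded k]
  note 2 = intertwines_nbar[of x, THEN intertwines_inverse[OF _ nbar_elt_inverse(1) nbar_elt_inverse(2)]]
  show "intertwines h (cone_point x) (exp (2 * t) *\<^sub>R cone_point b)"
    using intertwines_mult[OF 2(3) 1(1)] by (simp only: h)
  show "intertwines h (tangent x v) (tangent b (w v) + (2 * exp (2 * t) * (c \<bullet> v)) *\<^sub>R cone_point b)"
    using intertwines_mult[OF 2(2) 1(2)] by (simp only: h)
  show "intertwines h null_eps
      (exp (- 2 * t) *\<^sub>R null_eps + 2 *\<^sub>R tangent b (w c) + (2 * exp (2 * t) * (c \<bullet> c)) *\<^sub>R cone_point b)"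
    using intertwines_mult[OF 2(1) 1(3)] by (simp only: h)
qed

subsection \<open>The factorization\<close>

lemma factorizationE:
  assumes "factorization h y m a n"
  obtains t c where "m \<in> Spin_M" "a = a_elt t" "n = n_elt c" "h = nbar_elt y * m * a_elt t * n_elt c"
  using assms by (auto simp: factorization_def)

lemma a_elt_inverse: "a_elt t * a_elt (- t) = 1" "a_elt (- t) * a_elt t = 1"
  by (simp_all add: a_elt_add)

lemma n_elt_inverse: "n_elt c * n_elt (- c) = 1" "n_elt (- c) * n_elt c = 1"
  by (simp_all add: n_elt_add)

lemma factorization_invertible:
  assumes "factorization h y m a n"
  obtains h' where "h * h' = 1" "h' * h = 1"
proof -
  from assms obtain t c where f: "m \<in> Spin_M" "h = nbar_elt y * m * a_elt t * n_elt c"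
    by (rule factorizationE)
  obtain m' where m': "m * m' = 1" "m' * m = 1" using Spin_M_inverse[OF f(1)] by metis
  have cancel: "u * (u' * z) = z" if "u * u' = 1" for u u' z :: "'a clifford"
    using that by (simp flip: mult.assoc)
  show ?thesis
    by (rule that[of "n_elt (- c) * a_elt (- t) * m' * nbar_elt (- y)"])
      (simp_all add: f(2) mult.assoc cancel m' a_elt_inverse n_elt_inverse nbar_elt_inverse)
qed

lemma cl_vector_inject:
  assumes ne: "(1 :: 'n::finite clifford) \<noteq> 0" and "cl_vector u = (cl_vector v :: 'n clifford)"
  shows "u = v"
proof -
  have "mink_form (u - v) w = 0" for w
  proof -
    have "cl_vector (u - v) + cl_vector v = (cl_vector u :: 'n clifford)"
      by (simp flip: cl_vector_add)
    then have "cl_vector (u - v) = (0 :: 'n clifford)" using assms(2) by simp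
    then show ?thesis using cl_vector_relation[of "u - v" w] ne by simp
  qed
  \<comment> \<open>Testing against the vector with negated spatial components turns Q into a
    positive definite form.\<close>
  then have 1: "mink_form (u - v) (fst (u - v), - fst (snd (u - v)), - snd (snd (u - v))) = 0" .
  obtain r x s where "u - v = (r, x, s)" by (cases "u - v")
  with 1 have "r * r + x \<bullet> x + s * s = 0" by (simp add: mink_form_def)
  moreover have "r * r \<ge> 0" "s * s \<ge> 0" "x \<bullet> x \<ge> 0" by simp_all
  ultimately have "r * r = 0" "s * s = 0" "x \<bullet> x = 0" by linarith+
  then show ?thesis using \<open>u - v = (r, x, s)\<close> by (simp add: zero_prod_def[symmetric])
qed

text \<open>Since \<open>eps * del + del * eps\<close> is 4, it suffices to know u on both products;
  the second follows from the first by commuting \<open>del\<close> past u.\<close>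

lemma cl_scalar_of_eps_del:
  assumes "eps * u = u * eps" "del * u = u * del" "u * (eps * del) = k *\<^sub>R (eps * del)"
  shows "u = k *\<^sub>R 1"
proof -
  have "del * (u * (eps * del)) = del * (k *\<^sub>R (eps * del))" by (simp only: assms(3))
  then have "u * (del * (eps * del)) = k *\<^sub>R (del * (eps * del))"
    using assms(2) by (simp flip: mult.assoc)
  then have ud: "u * del = k *\<^sub>R del"
  proof -
    assume "u * (del * (eps * del)) = k *\<^sub>R (del * (eps * del))"
    then have "4 *\<^sub>R (u * del) = 4 *\<^sub>R (k *\<^sub>R del)" by (simp add: del_eps_del mult.commute[of k])
    then show ?thesis by (simp only: scaleR_cancel_left) simp
  qed
  have "4 *\<^sub>R u = u * (eps * del) + (u * del) * eps"
    by (simp add: mult.assoc del_eps ring_distribs)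
  also have "\<dots> = 4 *\<^sub>R (k *\<^sub>R 1)"
    unfolding ud assms(3) by (simp add: del_eps algebra_simps)
  finally show ?thesis by (simp only: scaleR_cancel_left) simp
qed

text \<open>Conjugation by h sends \<open>null_del\<close> to a multiple of
  \<open>cone_point y\<close>, whose direction gives y and whose length gives t. The factor m is
  read off from \<open>eps * h * del\<close>, in which both unipotent factors disappear.\<close>

lemma factorization_unique:
  assumes ne: "(1 :: 'n::finite clifford) \<noteq> 0"
    and "factorization (h :: 'n clifford) y m a n" "factorization h y' m' a' n'"
  shows "y = y'" "m = m'" "a = a'"
proof -
  from assms(2) obtain t c where f: "m \<in> Spin_M" "a = a_elt t" "h = nbar_elt y * m * a_elt t * n_elt c"
    by (rule factorizationE)
  from assms(3) obtain t' c' where f': "m' \<in> Spin_M" "a' = a_elt t'" "h = nbar_elt y' * m' * a_elt t' * n_elt c'"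
    by (rule factorizationE)
  obtain w where w: "\<And>v. m * cl_vec v = cl_vec (w v) * m" using Spin_M_rotation[OF f(1)] by metis
  obtain w' where w': "\<And>v. m' * cl_vec v = cl_vec (w' v) * m'" using Spin_M_rotation[OF f'(1)] by metis
  obtain h' where h': "h * h' = 1" using factorization_invertible[OF assms(2)] by metis
  have "cl_vector (exp (2 * t) *\<^sub>R cone_point y) * h = cl_vector (exp (2 * t') *\<^sub>R cone_point y') * h"
    using intertwines_man(1)[OF f(1) w, of y t c] intertwines_man(1)[OF f'(1) w', of y' t' c']
    by (simp add: intertwines_def flip: f(3) f'(3))
  then have "cl_vector (exp (2 * t) *\<^sub>R cone_point y) * (h * h') = cl_vector (exp (2 * t') *\<^sub>R cone_point y') * (h * h')"
    by (simp flip: mult.assoc)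
  then have eq: "exp (2 * t) *\<^sub>R cone_point y = exp (2 * t') *\<^sub>R cone_point y'"
    using cl_vector_inject[OF ne] by (simp add: h')
  \<comment> \<open>The first minus the last coordinate is 1 at every
    \<open>cone_point\<close>.\<close>
  have "exp (2 * t) = exp (2 * t')"
    using arg_cong[OF eq, of "\<lambda>u. fst u - snd (snd u)"] by (simp add: cone_point_def field_simps)
  then have t: "t = t'" by simp
  show y: "y = y'" using eq t by (simp add: cone_point_def)
  show "a = a'" using t f f' by simp
  have hd: "eps * (nbar_elt y * m * a_elt t * n_elt c * del) = exp t *\<^sub>R (m * (eps * del))"
    if "m \<in> Spin_M" for m and y c :: "real ^ 'n" and t
  proof -
    have "n_elt c * del = del" by (simp add: n_elt_alt ring_distribs mult.assoc cl_rules)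
    then have "nbar_elt y * m * a_elt t * n_elt c * del = nbar_elt y * m * (a_elt t * del)"
      by (simp add: mult.assoc)
    moreover have "eps * nbar_elt y = eps" by (simp add: nbar_elt_alt ring_distribs cl_rules_assoc cl_rules)
    ultimately have "eps * (nbar_elt y * m * a_elt t * n_elt c * del) = exp t *\<^sub>R (eps * m * del)"
      by (simp add: a_elt_del flip: mult.assoc)
    then show ?thesis by (simp add: Spin_M_commute(1)[OF that] mult.assoc)
  qed
  have "exp t *\<^sub>R (m * (eps * del)) = exp t *\<^sub>R (m' * (eps * del))"
    using hd[OF f(1), of y t c, folded f(3)] hd[OF f'(1), of y' t' c', folded f'(3)] t by simp
  then have mm: "m * (eps * del) = m' * (eps * del)" using t by simp
  obtain k where k: "k \<in> Spin_M" "m' * k = 1" "k * m' = 1" using Spin_M_inverse[OF f'(1)] by metis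
  have "k * m * (eps * del) = eps * del"
    using mm by (simp add: mult.assoc) (simp add: k flip: mult.assoc)
  then have "k * m = 1"
    using cl_scalar_of_eps_del[of "k * m" 1] Spin_M_commute[OF Spin_M_mult[OF k(1) f(1)]] by simp
  then have "m' * (k * m) = m'" by simp
  then show "m = m'" by (simp add: k flip: mult.assoc)
qed

lemma a_elt_inject:
  assumes ne: "(1 :: 'n::finite clifford) \<noteq> 0" and "a_elt s = (a_elt t :: 'n clifford)"
  shows "s = t"
proof -
  have "exp s *\<^sub>R (del :: 'n clifford) = exp t *\<^sub>R del" using assms(2) by (metis a_elt_del)
  moreover have "(del :: 'n clifford) \<noteq> 0" using del_eps ne by (metis diff_zero mult_zero_left mult_zero_right scaleR_eq_0_iff zero_neq_numeral)
  ultimately show ?thesis by simp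
qed

lemma chi_a_elt:
  assumes "(1 :: 'n::finite clifford) \<noteq> 0"
  shows "chi lam (a_elt t :: 'n clifford) = exp (2 * of_real t * lam)"
  unfolding chi_def using a_elt_inject[OF assms] by (metis (mono_tags, lifting) the_equality)

subsection \<open>Special conformal transformations\<close>

text \<open>\<open>sc_norm c z\<close> is the squared length of \<open>1 - c z\<close>, and \<open>sc_map c z\<close> is \<open>z (1 - c z)\<^sup>-\<^sup>1\<close>.\<close>

definition sc_norm :: "real ^ 'n \<Rightarrow> real ^ 'n::finite \<Rightarrow> real" where
  "sc_norm c z = 1 + 2 * (c \<bullet> z) + (c \<bullet> c) * (z \<bullet> z)"

definition sc_map :: "real ^ 'n \<Rightarrow> real ^ 'n::finite \<Rightarrow> real ^ 'n" where
  "sc_map c z = inverse (sc_norm c z) *\<^sub>R (z + (z \<bullet> z) *\<^sub>R c)"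

definition sc_spin :: "real ^ 'n \<Rightarrow> real ^ 'n::finite \<Rightarrow> 'n clifford" where
  "sc_spin c z = inverse (sqrt (sc_norm c z)) *\<^sub>R (1 - cl_vec c * cl_vec z)"

lemma sc_product: "(1 - cl_vec c * cl_vec z) * (1 - cl_vec z * cl_vec c) = sc_norm c z *\<^sub>R 1"
  by (simp add: sc_norm_def algebra_simps cl_rules_assoc cl_rules cl_vec_swap[of z c]
      cl_vec_swap_assoc[of z c])

lemma sc_norm_commute: "sc_norm z c = sc_norm c z"
  by (simp add: sc_norm_def inner_commute mult.commute)

lemma sc_spin_inverse:
  assumes "sc_norm c z > 0"
  shows "sc_spin c z * sc_spin z c = 1"
proof -
  have "inverse (sqrt (sc_norm c z)) * (inverse (sqrt (sc_norm c z)) * sc_norm c z) = 1"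
    using assms by (simp add: divide_simps)
  then show ?thesis by (simp add: sc_spin_def sc_norm_commute[of z c] sc_product)
qed

text \<open>For nonzero c, 1 - c z = c (c^(-1) - z) with c^(-1) = - c / |c|^2. Rescaling the two
  factors to unit length gives u and v.\<close>

lemma sc_spin_mem:
  assumes "sc_norm c z > 0" shows "sc_spin c z \<in> Spin_M"
proof (cases "c = 0")
  case True
  then show ?thesis by (simp add: sc_spin_def sc_norm_def Spin_M_one)
next
  case False
  define u where "u = inverse (norm c) *\<^sub>R c"
  define v where "v = (norm c * inverse (sqrt (sc_norm c z))) *\<^sub>R (- (inverse (c \<bullet> c) *\<^sub>R c) - z)"
  have "(- (inverse (c \<bullet> c) *\<^sub>R c) - z) \<bullet> (- (inverse (c \<bullet> c) *\<^sub>R c) - z) = sc_norm c z / (c \<bullet> c)"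
    using False by (simp add: sc_norm_def inner_diff_left inner_diff_right inner_commute field_simps)
  then have "norm (- (inverse (c \<bullet> c) *\<^sub>R c) - z) = sqrt (sc_norm c z) / norm c"
    by (simp add: norm_eq_sqrt_inner real_sqrt_divide)
  then have "norm v = 1" using False assms by (simp add: v_def)
  moreover have "norm u = 1" using False by (simp add: u_def)
  moreover have "sc_spin c z = cl_vec u * cl_vec v"
  proof -
    have *: "norm c * (inverse (norm c) * k) = k" "c \<bullet> c * (inverse (c \<bullet> c) * k) = k" for k
      using False by simp_all
    show ?thesis
      by (simp add: * sc_spin_def u_def v_def cl_vec_linear algebra_simps cl_vec_square)
  qed
  ultimately show ?thesis
    unfolding Spin_M_def by (auto intro!: exI[of _ "[u, v]"])
qed

text \<open>Gauss elimination. With respect to the idempotents of \<open>a_elt_eps_del\<close> the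
  left side is a two by two matrix with diagonal entries u = 1 - c z and 1, and z, c off the
  diagonal; the right side is its triangular decomposition with pivot u. Of the pivot, u / sqrt N
  belongs to Spin(n) and sqrt N to A.\<close>

lemma n_nbar_factorization:
  assumes N: "sc_norm c z > 0"
  shows "n_elt c * nbar_elt z = nbar_elt (sc_map c z) * sc_spin c z * a_elt (ln (sc_norm c z) / 2) *
    n_elt (inverse (sc_norm c z) *\<^sub>R (c + (c \<bullet> c) *\<^sub>R z))"
proof -
  define N where "N = sc_norm c z"
  define c' where "c' = c + (c \<bullet> c) *\<^sub>R z"
  define z' where "z' = z + (z \<bullet> z) *\<^sub>R c"
  define u where "u = 1 - cl_vec c * cl_vec z"
  have N0: "N > 0" using N by (simp add: N_def)
  \<comment> \<open>The elimination steps: c' / N = u^(-1) c and z' / N = z u^(-1), while u - z c' =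
    N says that the second pivot u / N, corrected by z c' / N, is the entry 1.\<close>
  have uc: "u * cl_vec c' = N *\<^sub>R cl_vec c"
    by (simp add: u_def c'_def N_def sc_norm_def cl_vec_linear algebra_simps cl_rules_assoc cl_rules
        cl_vec_swap[of z c] cl_vec_swap_assoc[of z c])
  have zu: "cl_vec z' * u = N *\<^sub>R cl_vec z"
    by (simp add: u_def z'_def N_def sc_norm_def cl_vec_linear algebra_simps cl_rules_assoc cl_rules
        cl_vec_swap[of z c] cl_vec_swap_assoc[of z c])
  have zc: "u - cl_vec z * cl_vec c' = N *\<^sub>R 1"
    by (simp add: u_def c'_def N_def sc_norm_def cl_vec_linear algebra_simps cl_rules_assoc cl_rules
        cl_vec_swap[of z c] cl_vec_swap_assoc[of z c])
  have eu: "eps * u = u * eps" "del * u = u * del"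
    by (simp_all add: u_def algebra_simps cl_rules_assoc cl_rules)
  have ma: "sc_spin c z * a_elt (ln N / 2) = (1 / 4) *\<^sub>R (u * (del * eps)) + (inverse N / 4) *\<^sub>R (u * (eps * del))"
  proof -
    have 1: "exp (ln N / 2) = sqrt N" using N0 by (simp add: sqrt_def root_powr_inverse powr_def)
    then have "exp (- (ln N / 2)) = inverse (sqrt N)" by (simp add: exp_minus)
    then show ?thesis
      using N0 1 by (simp add: sc_spin_def a_elt_eps_del ring_distribs flip: N_def u_def inverse_mult_distrib)
  qed
  define B where "B = sc_spin c z * a_elt (ln N / 2)"
  have Bd: "B * (cl_vec c' * del) = N *\<^sub>R (cl_vec c * del)"
  proof -
    have "B * (cl_vec c' * del) = u * (cl_vec c' * del)"
      by (simp add: B_def ma ring_distribs mult.assoc cl_rules cl_rules_assoc)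
    then show ?thesis by (simp add: uc flip: mult.assoc)
  qed
  have zB: "cl_vec z' * eps * B = N *\<^sub>R (cl_vec z * eps)"
  proof -
    have "eps * B = (1 / 4) *\<^sub>R (u * (eps * (del * eps))) + (inverse N / 4) *\<^sub>R (u * (eps * (eps * del)))"
      unfolding B_def ma ring_distribs mult_scaleR_right by (simp add: eu(1) flip: mult.assoc)
    then have "eps * B = u * eps" by (simp add: eps_del_eps cl_rules_assoc)
    then show ?thesis by (simp add: mult.assoc) (simp add: zu flip: mult.assoc)
  qed
  have "nbar_elt (inverse N *\<^sub>R z') * B * n_elt (inverse N *\<^sub>R c') =
      B + (inverse N / 2) *\<^sub>R (cl_vec z' * eps * B) + (inverse N / 2) *\<^sub>R (B * (cl_vec c' * del))
      + ((inverse N / 2) * (inverse N / 2)) *\<^sub>R (cl_vec z' * eps * B * (cl_vec c' * del))"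
    by (simp add: nbar_elt_alt n_elt_alt cl_vec_scaleR ring_distribs scaleR_add_right mult.assoc)
  also have "\<dots> = B + (1 / 2) *\<^sub>R (cl_vec z * eps) + (1 / 2) *\<^sub>R (cl_vec c * del)
      - (inverse N / 4) *\<^sub>R ((cl_vec z * cl_vec c') * (eps * del))"
    unfolding zB Bd using N0 by (simp add: mult.assoc cl_rules_assoc)
  also have "\<dots> = (1 / 4) *\<^sub>R (u * (del * eps)) + (1 / 2) *\<^sub>R (cl_vec z * eps) + (1 / 2) *\<^sub>R (cl_vec c * del)
      + (inverse N / 4) *\<^sub>R ((u - cl_vec z * cl_vec c') * (eps * del))"
    by (simp add: B_def ma ring_distribs scaleR_diff_right)
  also have "\<dots> = (1 / 4) *\<^sub>R (u * (del * eps)) + (1 / 2) *\<^sub>R (cl_vec z * eps) + (1 / 2) *\<^sub>R (cl_vec c * del)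
      + (1 / 4) *\<^sub>R (eps * del)"
    unfolding zc using N0 by simp
  also have "\<dots> = n_elt c * nbar_elt z"
    by (simp add: nbar_elt_alt n_elt_alt u_def del_eps algebra_simps cl_rules_assoc cl_rules)
  finally show ?thesis
    by (simp add: sc_map_def B_def N_def z'_def c'_def mult.assoc)
qed

text \<open>Moving \<open>nbar_elt z\<close> to the left past n, a and m produces in turn a special
  conformal map, the dilation by \<open>exp (- 2 * t)\<close> and the rotation w. This makes the
  action and its cocycles explicit near x in terms of the data at x.\<close>

lemma factorization_translate:
  assumes f: "factorization (h * nbar_elt x) b m (a_elt t) (n_elt c)"
    and w: "\<And>v. m * cl_vec v = cl_vec (w v) * m" "linear w" and N: "sc_norm c z > 0"
  shows "\<exists>n. factorization (h * nbar_elt (x + z)) (b + exp (- 2 * t) *\<^sub>R w (sc_map c z))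
    (m * sc_spin c z) (a_elt (t + ln (sc_norm c z) / 2)) n"
proof -
  let ?n = "n_elt (inverse (sc_norm c z) *\<^sub>R (c + (c \<bullet> c) *\<^sub>R z))"
  let ?a = "a_elt (ln (sc_norm c z) / 2)"
  from f have m: "m \<in> Spin_M" and h: "h * nbar_elt x = nbar_elt b * m * a_elt t * n_elt c"
    by (auto simp: factorization_def)
  note s = sc_spin_mem[OF N]
  have "h * nbar_elt (x + z) = h * nbar_elt x * nbar_elt z"
    by (simp add: mult.assoc nbar_elt_add)
  also have "\<dots> = nbar_elt b * m * (a_elt t * nbar_elt (sc_map c z)) * sc_spin c z * ?a * ?n"
    unfolding h using n_nbar_factorization[OF N] by (simp add: mult.assoc)
  also have "\<dots> = nbar_elt b * (m * nbar_elt (exp (- 2 * t) *\<^sub>R sc_map c z)) * (a_elt t * sc_spin c z) * ?a * ?n"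
    unfolding a_nbar by (simp add: mult.assoc)
  also have "\<dots> = (nbar_elt b * nbar_elt (exp (- 2 * t) *\<^sub>R w (sc_map c z))) * (m * sc_spin c z) * (a_elt t * ?a) * ?n"
    unfolding Spin_M_nbar(1)[OF m w(1)] Spin_M_commute(3)[OF s] linear_scale[OF w(2)] by (simp only: mult.assoc)
  finally show ?thesis
    unfolding nbar_elt_add a_elt_add factorization_def using Spin_M_mult[OF m s] by blast
qed

text \<open>The element h nbar_y is nbar_x times the inverse of m a n, and M A N is a group: M
  commutes with A, and both normalise N.\<close>

lemma factorization_inverse:
  assumes gh: "h * g = 1" and f: "factorization (g * nbar_elt x) y m a n"
  shows "act_defined h y" "\<exists>m a n. factorization (h * nbar_elt y) x m a n"
proof -
  from f obtain t c where m: "m \<in> Spin_M" and e: "g * nbar_elt x = nbar_elt y * m * a_elt t * n_elt c"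
    by (rule factorizationE)
  obtain m' where m': "m' \<in> Spin_M" "m * m' = 1" "m' * m = 1" using Spin_M_inverse[OF m] by metis
  obtain w where w: "\<And>v. m * cl_vec v = cl_vec (w v) * m" using Spin_M_rotation[OF m] by metis
  have cancel: "u * (u' * z) = z" if "u * u' = 1" for u u' z :: "'a clifford"
    using that by (simp flip: mult.assoc)
  have "nbar_elt x = h * (g * nbar_elt x)"
    using gh by (simp flip: mult.assoc)
  then have "nbar_elt x * (n_elt (- c) * (a_elt (- t) * m')) =
      h * nbar_elt y * (m * (a_elt t * (n_elt c * (n_elt (- c) * (a_elt (- t) * m')))))"
    unfolding e by (simp add: mult.assoc)
  also have "\<dots> = h * nbar_elt y"
    by (simp add: cancel m' a_elt_inverse n_elt_inverse)
  finally have "h * nbar_elt y = nbar_elt x * (n_elt (- c) * (a_elt (- t) * m'))" ..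
  also have "n_elt (- c) * (a_elt (- t) * m') = m' * a_elt (- t) * n_elt (w (exp (2 * t) *\<^sub>R (- c)))"
  proof -
    let ?y = "exp (2 * t) *\<^sub>R (- c)"
    have "n_elt (- c) * a_elt (- t) = a_elt (- t) * n_elt ?y"
      by (simp add: a_n flip: exp_add)
    moreover have "n_elt ?y * m' = m' * n_elt (w ?y)"
    proof -
      have "m' * (m * n_elt ?y) * m' = m' * n_elt (w ?y) * (m * m')"
        unfolding Spin_M_nbar(2)[OF m w] by (simp only: mult.assoc)
      then show ?thesis by (simp add: m') (simp add: m' flip: mult.assoc)
    qed
    moreover have "n_elt (- c) * (a_elt (- t) * m') = (n_elt (- c) * a_elt (- t)) * m'"
      by (rule mult.assoc[symmetric])
    ultimately have "n_elt (- c) * (a_elt (- t) * m') = (a_elt (- t) * m') * n_elt (w ?y)"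
      by (simp only: mult.assoc)
    then show ?thesis by (simp only: Spin_M_commute(3)[OF m'(1)])
  qed
  finally show "\<exists>m a n. factorization (h * nbar_elt y) x m a n"
    unfolding factorization_def using m'(1) by (metis mult.assoc rangeI)
  then show "act_defined h y" by (auto simp: act_defined_def)
qed

subsection \<open>Smoothness on open sets\<close>

text \<open>Existence of derivatives up to order \<open>k\<close>, without continuity of the last ones: only functions
  that have derivatives of all orders will matter.\<close>

fun diff_on :: "nat \<Rightarrow> 'a::euclidean_space set \<Rightarrow> ('a \<Rightarrow> 'b::real_normed_vector) \<Rightarrow> bool" where
  "diff_on 0 U f \<longleftrightarrow> True"
| "diff_on (Suc k) U f \<longleftrightarrow> (\<forall>x\<in>U. f differentiable (at x)) \<and>
     (\<forall>v. diff_on k U (\<lambda>x. frechet_derivative f (at x) v))"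

definition smooth_on :: "'a::euclidean_space set \<Rightarrow> ('a \<Rightarrow> 'b::real_normed_vector) \<Rightarrow> bool" where
  "smooth_on U f \<longleftrightarrow> (\<forall>k. diff_on k U f)"

lemma smooth_imp_smooth_on:
  assumes "smooth f" shows "smooth_on U f"
proof -
  have "times_cont_diff k f \<Longrightarrow> diff_on k U f" for k and f :: "'a \<Rightarrow> 'b"
    by (induction k arbitrary: f) auto
  then show ?thesis using assms by (simp add: smooth_on_def smooth_def)
qed

lemma frechet_derivative_cong_open:
  assumes "open U" "x \<in> U" "\<And>y. y \<in> U \<Longrightarrow> f y = g y"
  shows "frechet_derivative f (at x) = frechet_derivative g (at x)"
proof -
  have "(f has_derivative f') (at x) \<longleftrightarrow> (g has_derivative f') (at x)" for f'
    using assms has_derivative_transform_within_open[of f f' x UNIV U g]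
      has_derivative_transform_within_open[of g f' x UNIV U f] by auto
  then show ?thesis by (simp add: frechet_derivative_def)
qed

lemma differentiable_cong_open:
  assumes "open U" "x \<in> U" "\<And>y. y \<in> U \<Longrightarrow> f y = g y" "f differentiable (at x)"
  shows "g differentiable (at x)"
  using assms has_derivative_transform_within_open[of f _ x UNIV U g]
  unfolding differentiable_def by metis

lemma diff_on_cong:
  assumes "open U" "\<And>x. x \<in> U \<Longrightarrow> f x = g x" "diff_on k U f"
  shows "diff_on k U g"
  using assms(2,3)
proof (induction k arbitrary: f g)
  case (Suc k)
  have "diff_on k U (\<lambda>x. frechet_derivative g (at x) v)" for v
    by (rule Suc.IH[of "\<lambda>x. frechet_derivative f (at x) v"])
      (use Suc.prems frechet_derivative_cong_open[OF assms(1), of _ f g] in auto)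
  then show ?case
    using Suc.prems differentiable_cong_open[OF assms(1), of _ f g] by auto
qed simp

lemma smooth_on_cong:
  "open U \<Longrightarrow> (\<And>x. x \<in> U \<Longrightarrow> f x = g x) \<Longrightarrow> smooth_on U f \<Longrightarrow> smooth_on U g"
  using diff_on_cong unfolding smooth_on_def by blast

lemma diff_on_Suc_imp: "diff_on (Suc k) U f \<Longrightarrow> diff_on k U f"
  by (induction k arbitrary: f) auto

lemma smooth_on_differentiable: "smooth_on U f \<Longrightarrow> x \<in> U \<Longrightarrow> f differentiable (at x)"
  unfolding smooth_on_def using diff_on.simps(2) by blast

lemma smooth_on_has_derivative:
  "smooth_on U f \<Longrightarrow> x \<in> U \<Longrightarrow> (f has_derivative frechet_derivative f (at x)) (at x)"
  using smooth_on_differentiable frechet_derivative_works by blast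

lemma smooth_on_frechet: "smooth_on U f \<Longrightarrow> smooth_on U (\<lambda>x. frechet_derivative f (at x) v)"
  unfolding smooth_on_def using diff_on.simps(2) by blast

lemma diff_on_SucI:
  assumes "open U" "\<And>x. x \<in> U \<Longrightarrow> (f has_derivative f' x) (at x)" "\<And>v. diff_on k U (\<lambda>x. f' x v)"
  shows "diff_on (Suc k) U f"
proof -
  have "frechet_derivative f (at x) = f' x" if "x \<in> U" for x
    using assms(2)[OF that] by (metis frechet_derivative_at)
  then have "diff_on k U (\<lambda>x. frechet_derivative f (at x) v)" for v
    by (intro diff_on_cong[OF assms(1) _ assms(3)]) auto
  then show ?thesis using differentiableI[OF assms(2)] by simp
qed

lemma diff_on_const: "open U \<Longrightarrow> diff_on k U (\<lambda>x. c)"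
proof (induction k arbitrary: c)
  case (Suc k)
  show ?case by (rule diff_on_SucI[where f' = "\<lambda>x v. 0"]) (use Suc in auto)
qed simp

lemma diff_on_add:
  "open U \<Longrightarrow> diff_on k U f \<Longrightarrow> diff_on k U g \<Longrightarrow> diff_on k U (\<lambda>x. f x + g x)"
proof (induction k arbitrary: f g)
  case (Suc k)
  show ?case
  proof (rule diff_on_SucI)
    show "((\<lambda>x. f x + g x) has_derivative
        (\<lambda>v. frechet_derivative f (at x) v + frechet_derivative g (at x) v)) (at x)" if "x \<in> U" for x
      using that Suc.prems by (intro has_derivative_add) (auto simp: frechet_derivative_works[symmetric])
    show "diff_on k U (\<lambda>x. frechet_derivative f (at x) v + frechet_derivative g (at x) v)" for v
      by (intro Suc.IH) (use Suc.prems in auto)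
  qed (use Suc.prems in simp)
qed simp

lemma diff_on_sum:
  assumes "open U" "\<And>i. i \<in> I \<Longrightarrow> diff_on k U (f i)"
  shows "diff_on k U (\<lambda>x. \<Sum>i\<in>I. f i x)"
  using assms(2) by (induction I rule: infinite_finite_induct) (auto intro: diff_on_const diff_on_add assms(1))

lemma diff_on_bounded_linear:
  assumes "open U" "bounded_linear h"
  shows "diff_on k U f \<Longrightarrow> diff_on k U (\<lambda>x. h (f x))"
proof (induction k arbitrary: f)
  case (Suc k)
  show ?case
  proof (rule diff_on_SucI)
    show "((\<lambda>x. h (f x)) has_derivative (\<lambda>v. h (frechet_derivative f (at x) v))) (at x)"
      if "x \<in> U" for x
      using that Suc.prems
      by (intro bounded_linear.has_derivative[OF assms(2)]) (auto simp: frechet_derivative_works[symmetric])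
    show "diff_on k U (\<lambda>x. h (frechet_derivative f (at x) v))" for v
      by (intro Suc.IH) (use Suc.prems in auto)
  qed (rule assms(1))
qed simp

lemma diff_on_bilinear:
  assumes "open U" "bounded_bilinear h"
  shows "diff_on k U f \<Longrightarrow> diff_on k U g \<Longrightarrow> diff_on k U (\<lambda>x. h (f x) (g x))"
proof (induction k arbitrary: f g)
  case (Suc k)
  show ?case
  proof (rule diff_on_SucI)
    show "((\<lambda>x. h (f x) (g x)) has_derivative
       (\<lambda>v. h (f x) (frechet_derivative g (at x) v) + h (frechet_derivative f (at x) v) (g x))) (at x)"
      if "x \<in> U" for x
      using that Suc.prems
      by (intro bounded_bilinear.FDERIV[OF assms(2)]) (auto simp: frechet_derivative_works[symmetric])
    show "diff_on k U (\<lambda>x. h (f x) (frechet_derivative g (at x) v) + h (frechet_derivative f (at x) v) (g x))" for v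
      by (intro diff_on_add assms(1) Suc.IH) (use Suc.prems diff_on_Suc_imp in auto)
  qed (rule assms(1))
qed simp

lemma diff_on_id:
  assumes "open U" shows "diff_on k U (\<lambda>x. x)"
proof (cases k)
  case (Suc j)
  then show ?thesis
    using diff_on_SucI[OF assms, of "\<lambda>x. x" "\<lambda>x v. v" j] diff_on_const[OF assms] by auto
qed simp

text \<open>The direction in which f is differentiated depends on x. Expanding it in a basis leaves
  partial derivatives of f, which are fixed functions composed with h, so that the induction
  hypothesis applies.\<close>

lemma diff_on_compose:
  fixes f :: "'b::euclidean_space \<Rightarrow> 'c::real_normed_vector" and h :: "'a::euclidean_space \<Rightarrow> 'b"
  assumes "open U" "h ` U \<subseteq> V"
  shows "diff_on k V f \<Longrightarrow> diff_on k U h \<Longrightarrow> diff_on k U (\<lambda>x. f (h x))"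
proof (induction k arbitrary: f)
  case (Suc k)
  have h: "diff_on k U h" using Suc.prems diff_on_Suc_imp by blast
  show ?case
  proof (rule diff_on_SucI)
    fix x assume x: "x \<in> U"
    have f': "(f has_derivative frechet_derivative f (at (h x))) (at (h x))"
      using Suc.prems x assms(2) by (auto simp: frechet_derivative_works[symmetric])
    have h': "(h has_derivative frechet_derivative h (at x)) (at x)"
      using Suc.prems x by (auto simp: frechet_derivative_works[symmetric])
    have D1: "((\<lambda>x. f (h x)) has_derivative (\<lambda>v. frechet_derivative f (at (h x)) (frechet_derivative h (at x) v))) (at x)"
      using diff_chain_at[OF h' f'] by (simp add: o_def)
    have D2: "frechet_derivative f (at (h x)) u = (\<Sum>i\<in>Basis. (u \<bullet> i) *\<^sub>R frechet_derivative f (at (h x)) i)" for u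
    proof -
      have "frechet_derivative f (at (h x)) u = frechet_derivative f (at (h x)) (\<Sum>i\<in>Basis. (u \<bullet> i) *\<^sub>R i)"
        by (simp add: euclidean_representation)
      then show ?thesis
        by (simp add: linear_sum[OF has_derivative_linear[OF f']] linear_scale[OF has_derivative_linear[OF f']])
    qed
    show "((\<lambda>x. f (h x)) has_derivative (\<lambda>v. \<Sum>i\<in>Basis.
        (frechet_derivative h (at x) v \<bullet> i) *\<^sub>R frechet_derivative f (at (h x)) i)) (at x)"
      by (rule has_derivative_eq_rhs[OF D1]) (rule ext, rule D2)
  next
    show "diff_on k U (\<lambda>x. \<Sum>i\<in>Basis. (frechet_derivative h (at x) v \<bullet> i) *\<^sub>R frechet_derivative f (at (h x)) i)" for v
    proof (intro diff_on_sum assms(1) diff_on_bilinear[OF assms(1) bounded_bilinear_scaleR])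
      fix i
      show "diff_on k U (\<lambda>x. frechet_derivative h (at x) v \<bullet> i)"
        using Suc.prems by (intro diff_on_bounded_linear[OF assms(1) bounded_linear_inner_left]) auto
      show "diff_on k U (\<lambda>x. frechet_derivative f (at (h x)) i)"
        using Suc.prems by (intro Suc.IH h) auto
    qed
  qed (rule assms(1))
qed simp

lemma smooth_on_const: "open U \<Longrightarrow> smooth_on U (\<lambda>x. c)"
  and smooth_on_id: "open U \<Longrightarrow> smooth_on U (\<lambda>x. x)"
  and smooth_on_add: "open U \<Longrightarrow> smooth_on U f \<Longrightarrow> smooth_on U g \<Longrightarrow> smooth_on U (\<lambda>x. f x + g x)"
  and smooth_on_sum: "open U \<Longrightarrow> (\<And>i. i \<in> I \<Longrightarrow> smooth_on U (F i)) \<Longrightarrow> smooth_on U (\<lambda>x. \<Sum>i\<in>I. F i x)"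
  and smooth_on_bounded_linear: "open U \<Longrightarrow> bounded_linear l \<Longrightarrow> smooth_on U f \<Longrightarrow> smooth_on U (\<lambda>x. l (f x))"
  and smooth_on_bilinear:
    "open U \<Longrightarrow> bounded_bilinear b \<Longrightarrow> smooth_on U f \<Longrightarrow> smooth_on U k \<Longrightarrow> smooth_on U (\<lambda>x. b (f x) (k x))"
  and smooth_on_compose:
    "open U \<Longrightarrow> smooth_on V e \<Longrightarrow> smooth_on U h \<Longrightarrow> h ` U \<subseteq> V \<Longrightarrow> smooth_on U (\<lambda>x. e (h x))"
  unfolding smooth_on_def
  by (simp_all add: diff_on_const diff_on_id diff_on_add diff_on_sum diff_on_bounded_linear
      diff_on_bilinear diff_on_compose[of U h V])

lemma smooth_on_diff:
  assumes "open U" "smooth_on U f" "smooth_on U g" shows "smooth_on U (\<lambda>x. f x - g x)"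
  using smooth_on_add[OF assms(1,2) smooth_on_bounded_linear[OF assms(1) bounded_linear_minus[OF bounded_linear_ident] assms(3)]]
  by simp

text \<open>The complex power r^\<alpha>. Its derivative \<alpha> r^(\<alpha> - 1) stays in the same
  family, so the induction runs over all exponents at once.\<close>

lemma smooth_on_exp_ln: "smooth_on {0<..} (\<lambda>r. exp (\<alpha> * of_real (ln r)) :: complex)"
proof -
  have "diff_on k {0<..} (\<lambda>r. exp (\<alpha> * of_real (ln r)) :: complex)" for k
  proof (induction k arbitrary: \<alpha>)
    case (Suc k)
    show ?case
    proof (rule diff_on_SucI)
      fix r :: real assume r: "r \<in> {0<..}"
      have "((\<lambda>r. exp (\<alpha> * of_real (ln r)) :: complex) has_vector_derivative
          (\<alpha> * of_real (inverse r)) * exp (\<alpha> * of_real (ln r))) (at r)"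
      proof -
        have "((\<lambda>r. of_real (ln r) :: complex) has_vector_derivative of_real (inverse r)) (at r)"
          using r by (intro has_vector_derivative_of_real DERIV_ln) simp
        moreover have "((\<lambda>z. exp (\<alpha> * z)) has_field_derivative \<alpha> * exp (\<alpha> * of_real (ln r))) (at (of_real (ln r)))"
          by (auto intro!: derivative_eq_intros)
        ultimately show ?thesis
          using field_vector_diff_chain_at by (fastforce simp: o_def mult_ac)
      qed
      moreover have "of_real (inverse r) * exp (\<alpha> * of_real (ln r)) = exp ((\<alpha> - 1) * of_real (ln r) :: complex)"
        using r by (simp add: left_diff_distrib exp_diff exp_of_real divide_inverse)
      ultimately show "((\<lambda>r. exp (\<alpha> * of_real (ln r)) :: complex) has_derivative
          (\<lambda>v. v *\<^sub>R (\<alpha> * exp ((\<alpha> - 1) * of_real (ln r))))) (at r)"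
        by (simp add: has_vector_derivative_def mult.assoc)
    next
      show "diff_on k {0<..} (\<lambda>r. v *\<^sub>R (\<alpha> * exp ((\<alpha> - 1) * of_real (ln r))))" for v
        by (intro diff_on_bounded_linear[OF _ bounded_linear_scaleR_right]
            diff_on_bounded_linear[OF _ bounded_linear_mult_right] Suc.IH) simp_all
    qed simp
  qed simp
  then show ?thesis by (simp add: smooth_on_def)
qed

lemma smooth_on_inverse: "smooth_on {0<..} (inverse :: real \<Rightarrow> real)"
proof (rule smooth_on_cong)
  show "smooth_on {0<..} (\<lambda>r. Re (exp ((- 1) * of_real (ln r))))"
    by (intro smooth_on_bounded_linear[OF _ bounded_linear_Re] smooth_on_exp_ln) simp
  show "Re (exp ((- 1) * of_real (ln r))) = inverse r" if "r \<in> {0<..}" for r :: real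
    using that by (simp add: exp_minus exp_of_real flip: of_real_inverse)
qed simp

subsection \<open>Jets in one variable\<close>

lemma bounded_bilinear_matrix_vector: "bounded_bilinear ((*v) :: complex ^ 'n::finite ^ 'm::finite \<Rightarrow> _)"
  unfolding bilinear_conv_bounded_bilinear[symmetric] bilinear_def
  by (auto intro!: linearI simp: matrix_vector_right_distrib matrix_vector_mult_add_rdistrib
      matrix_vector_mult_scaleR scaleR_matrix_vector_mult)

lemma bounded_bilinear_smult: "bounded_bilinear ((*s) :: complex \<Rightarrow> complex ^ 'n::finite \<Rightarrow> _)"
  unfolding bilinear_conv_bounded_bilinear[symmetric] bilinear_def
  by (auto intro!: linearI simp: vec_eq_iff algebra_simps)

lemma bounded_linear_matrix_vector: "bounded_linear ((*v) (A :: complex ^ 'n::finite ^ 'm::finite))"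
  by (rule bounded_bilinear.bounded_linear_right[OF bounded_bilinear_matrix_vector])

lemma bounded_linear_smult: "bounded_linear ((*s) (a :: complex) :: complex ^ 'n::finite \<Rightarrow> _)"
  by (rule bounded_bilinear.bounded_linear_right[OF bounded_bilinear_smult])

lemma scaleR_smult: "r *\<^sub>R u = of_real r *s u" for u :: "complex ^ 'n"
  by (simp add: vec_eq_iff scaleR_conv_of_real[where 'a = complex])

lemma matrix_vector_smult: "A *v (a *s u) = a *s (A *v u)" for A :: "complex ^ 'n::finite ^ 'm::finite"
  by (simp add: matrix_vector_mult_def vec_eq_iff sum_distrib_left mult_ac)

lemmas mv_rules = matrix_vector_right_distrib matrix_vector_mult_diff_distrib matrix_vector_smult
  matrix_vector_mult_scaleR

definition pd :: "'n \<Rightarrow> (real ^ 'n::finite \<Rightarrow> 'b::real_normed_vector) \<Rightarrow> real ^ 'n \<Rightarrow> 'b" where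
  "pd j f x = frechet_derivative f (at x) (axis j 1)"

definition lap :: "(real ^ 'n::finite \<Rightarrow> 'b::real_normed_vector) \<Rightarrow> real ^ 'n \<Rightarrow> 'b" where
  "lap f x = (\<Sum>j\<in>UNIV. pd j (pd j f) x)"

definition dirac :: "(real ^ 'n \<Rightarrow> complex ^ 't ^ 't) \<Rightarrow> (real ^ 'n::finite \<Rightarrow> complex ^ 't::finite) \<Rightarrow>
    real ^ 'n \<Rightarrow> complex ^ 't" where
  "dirac R f x = (\<Sum>j\<in>UNIV. R (axis j 1) *v pd j f x)"

definition lop :: "(real ^ 'n \<Rightarrow> complex ^ 't ^ 't) \<Rightarrow> complex \<Rightarrow> real ^ 'n \<Rightarrow>
    (real ^ 'n::finite \<Rightarrow> complex ^ 't::finite) \<Rightarrow> real ^ 'n \<Rightarrow> complex ^ 't" where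
  "lop R s v f x = s *s frechet_derivative f (at x) v - R v *v dirac R f x"

text \<open>Both \<open>rep_x \<rho>\<close> and \<open>rep_y \<rho>'\<close> are instances, so that
  the jets are computed once for both tensor factors.\<close>

definition clifford_map :: "(real ^ 'n::finite \<Rightarrow> complex ^ 't::finite ^ 't) \<Rightarrow> bool" where
  "clifford_map R \<longleftrightarrow> (\<forall>x y. R (x + y) = R x + R y) \<and> (\<forall>r x. R (r *\<^sub>R x) = r *\<^sub>R R x) \<and>
     (\<forall>x. R x ** R x = - (x \<bullet> x) *\<^sub>R mat 1)"

lemma smooth_on_pd: "smooth_on U f \<Longrightarrow> smooth_on U (pd j f)"
  unfolding pd_def[abs_def] by (rule smooth_on_frechet)

lemma frechet_derivative_vec:
  assumes "f differentiable (at x)"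
  shows "frechet_derivative f (at x) v = (\<Sum>i\<in>UNIV. v $ i *\<^sub>R pd i f x)"
proof -
  have l: "linear (frechet_derivative f (at x))" by (rule linear_frechet_derivative[OF assms])
  have "v = (\<Sum>i\<in>UNIV. v $ i *\<^sub>R axis i 1)"
    using basis_expansion[of v] by (simp add: scalar_mult_eq_scaleR)
  then have "frechet_derivative f (at x) v = frechet_derivative f (at x) (\<Sum>i\<in>UNIV. v $ i *\<^sub>R axis i 1)"
    by simp
  also have "\<dots> = (\<Sum>i\<in>UNIV. v $ i *\<^sub>R pd i f x)"
    by (simp add: linear_sum[OF l] linear_scale[OF l] pd_def)
  finally show ?thesis .
qed

lemma line_derivative:
  assumes "f differentiable (at (x + r *\<^sub>R e))"
  shows "((\<lambda>s. f (x + s *\<^sub>R e)) has_vector_derivative frechet_derivative f (at (x + r *\<^sub>R e)) e) (at r)"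
proof -
  have 1: "((\<lambda>s. x + s *\<^sub>R e) has_derivative (\<lambda>h. h *\<^sub>R e)) (at r)"
    by (auto intro!: derivative_eq_intros)
  have 2: "(f has_derivative frechet_derivative f (at (x + r *\<^sub>R e))) (at (x + r *\<^sub>R e))"
    using assms frechet_derivative_works by blast
  show ?thesis
    using diff_chain_at[OF 1 2] linear_scale[OF linear_frechet_derivative[OF assms]]
    by (simp add: has_vector_derivative_def o_def)
qed

text \<open>Reduces pure second partials to calculus in one real variable: a formula for the first
  derivative near 0 and its derivative at 0 suffice.\<close>

lemma second_partial_along_line:
  assumes U: "open U" "x \<in> U" and f: "smooth_on U f"
    and V: "open V" "0 \<in> V"
    and 1: "\<forall>r\<in>V. ((\<lambda>r. f (x + r *\<^sub>R axis j 1)) has_vector_derivative \<psi> r) (at r)"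
    and 2: "(\<psi> has_vector_derivative D) (at 0)"
  shows "pd j f x = \<psi> 0" "pd j (pd j f) x = D"
proof -
  note 1 = 1[rule_format]
  define W where "W = V \<inter> (\<lambda>r. x + r *\<^sub>R axis j 1) -` U"
  have "open W" unfolding W_def
    by (intro open_Int V open_vimage U continuous_intros)
  have "0 \<in> W" using V U by (simp add: W_def)
  have eq: "\<psi> r = pd j f (x + r *\<^sub>R axis j 1)" if "r \<in> W" for r
    using vector_derivative_unique_at[OF 1 line_derivative] that smooth_on_differentiable[OF f]
    by (auto simp: W_def pd_def)
  show "pd j f x = \<psi> 0" using eq[OF \<open>0 \<in> W\<close>] by simp
  have "((\<lambda>r. pd j f (x + r *\<^sub>R axis j 1)) has_vector_derivative pd j (pd j f) x) (at 0)"
    using line_derivative[of "pd j f" x 0 "axis j 1"] smooth_on_differentiable[OF smooth_on_pd[OF f] U(2)]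
    by (simp add: pd_def[of j "pd j f"])
  moreover have "((\<lambda>r. pd j f (x + r *\<^sub>R axis j 1)) has_vector_derivative D) (at 0)"
    using has_vector_derivative_transform_within_open[OF 2 \<open>open W\<close> \<open>0 \<in> W\<close> eq] .
  ultimately show "pd j (pd j f) x = D" by (rule vector_derivative_unique_at)
qed

text \<open>The velocity at 0 is a basis vector, so the Hessian of f contributes a pure second
  partial; the acceleration contributes a first derivative.\<close>

lemma second_derivative_compose_curve:
  fixes f :: "real ^ 'n::finite \<Rightarrow> 'b::real_normed_vector"
  assumes f: "smooth_on UNIV f"
    and 1: "\<forall>r\<in>V. (\<zeta> has_vector_derivative \<zeta>1 r) (at r)" and V: "0 \<in> V"
    and 2: "(\<zeta>1 has_vector_derivative z2) (at 0)" and e: "\<zeta>1 0 = axis j 1"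
  shows "\<forall>r\<in>V. ((\<lambda>r. f (\<zeta> r)) has_vector_derivative frechet_derivative f (at (\<zeta> r)) (\<zeta>1 r)) (at r)"
    and "((\<lambda>r. frechet_derivative f (at (\<zeta> r)) (\<zeta>1 r)) has_vector_derivative
      pd j (pd j f) (\<zeta> 0) + frechet_derivative f (at (\<zeta> 0)) z2) (at 0)"
proof -
  note 1 = 1[rule_format]
  have chain: "((\<lambda>r. g (\<zeta> r)) has_vector_derivative frechet_derivative g (at (\<zeta> r)) (\<zeta>1 r)) (at r)"
    if "smooth_on UNIV g" "r \<in> V" for g :: "real ^ 'n \<Rightarrow> 'b" and r
    using vector_derivative_diff_chain_within[OF 1[OF that(2)]
      has_derivative_at_withinI[OF smooth_on_has_derivative[OF that(1) UNIV_I]]]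
    by (simp add: o_def)
  show "\<forall>r\<in>V. ((\<lambda>r. f (\<zeta> r)) has_vector_derivative frechet_derivative f (at (\<zeta> r)) (\<zeta>1 r)) (at r)"
    using chain[OF f] by blast
  have exp: "frechet_derivative f (at y) v = (\<Sum>i\<in>UNIV. v $ i *\<^sub>R pd i f y)" for y v
    by (rule frechet_derivative_vec[OF smooth_on_differentiable[OF f]]) simp
  have comp: "((\<lambda>r. \<zeta>1 r $ i) has_real_derivative z2 $ i) (at 0)" for i
    unfolding has_real_derivative_iff_has_vector_derivative
    by (rule bounded_linear.has_vector_derivative[OF bounded_linear_vec_nth 2])
  have "((\<lambda>r. \<Sum>i\<in>UNIV. \<zeta>1 r $ i *\<^sub>R pd i f (\<zeta> r)) has_vector_derivative
    (\<Sum>i\<in>UNIV. \<zeta>1 0 $ i *\<^sub>R frechet_derivative (pd i f) (at (\<zeta> 0)) (\<zeta>1 0) + z2 $ i *\<^sub>R pd i f (\<zeta> 0))) (at 0)"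
    by (intro has_vector_derivative_sum has_vector_derivative_scaleR comp chain smooth_on_pd f V)
  also have "(\<Sum>i\<in>UNIV. \<zeta>1 0 $ i *\<^sub>R frechet_derivative (pd i f) (at (\<zeta> 0)) (\<zeta>1 0) + z2 $ i *\<^sub>R pd i f (\<zeta> 0))
    = pd j (pd j f) (\<zeta> 0) + frechet_derivative f (at (\<zeta> 0)) z2"
    unfolding e sum.distrib exp
    by (simp add: pd_def[of j "pd _ f"] axis_def if_distrib[of "\<lambda>x. x *\<^sub>R _"] cong: if_cong)
  finally show "((\<lambda>r. frechet_derivative f (at (\<zeta> r)) (\<zeta>1 r)) has_vector_derivative
      pd j (pd j f) (\<zeta> 0) + frechet_derivative f (at (\<zeta> 0)) z2) (at 0)"
    unfolding exp .
qed

lemma second_derivative_weighted: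
  fixes G :: "real \<Rightarrow> complex ^ 't::finite" and k :: "real \<Rightarrow> complex"
    and A :: "complex ^ 't ^ 't"
  assumes k: "\<forall>r\<in>V. (k has_vector_derivative k1 r) (at r)" "(k1 has_vector_derivative k2) (at 0)"
    and G: "\<forall>r\<in>V. (G has_vector_derivative G1 r) (at r)" "(G1 has_vector_derivative G2) (at 0)"
    and V: "0 \<in> V"
  defines "\<psi> \<equiv> \<lambda>r. k r *s (G1 r - (r *\<^sub>R (A *v G1 r) + 1 *\<^sub>R (A *v G r))) + k1 r *s (G r - r *\<^sub>R (A *v G r))"
  shows "\<forall>r\<in>V. ((\<lambda>r. k r *s (G r - r *\<^sub>R (A *v G r))) has_vector_derivative \<psi> r) (at r)"
    and "(\<psi> has_vector_derivative
      k 0 *s (G2 - 2 *s (A *v G1 0)) + (2 * k1 0) *s (G1 0 - A *v G 0) + k2 *s G 0) (at 0)"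
proof -
  note prod = bounded_bilinear.has_vector_derivative[OF bounded_bilinear_smult]
  note mv = bounded_linear.has_vector_derivative[OF bounded_linear_matrix_vector]
  note k = k(1)[rule_format] k(2) and G = G(1)[rule_format] G(2)
  show "\<forall>r\<in>V. ((\<lambda>r. k r *s (G r - r *\<^sub>R (A *v G r))) has_vector_derivative \<psi> r) (at r)"
    unfolding \<psi>_def
    by (intro ballI prod k has_vector_derivative_diff has_vector_derivative_scaleR mv G DERIV_ident)
  have "(\<psi> has_vector_derivative
     (k 0 *s (G2 - ((0 *\<^sub>R (A *v G2) + 1 *\<^sub>R (A *v G1 0)) + (1 *\<^sub>R (A *v G1 0) + 0 *\<^sub>R (A *v G 0)))) +
      k1 0 *s (G1 0 - (0 *\<^sub>R (A *v G1 0) + 1 *\<^sub>R (A *v G 0)))) +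
     (k1 0 *s (G1 0 - (0 *\<^sub>R (A *v G1 0) + 1 *\<^sub>R (A *v G 0))) + k2 *s (G 0 - 0 *\<^sub>R (A *v G 0)))) (at 0)"
    unfolding \<psi>_def
    by (intro has_vector_derivative_add prod k has_vector_derivative_diff has_vector_derivative_scaleR mv G
        DERIV_ident DERIV_const V)
  then show "(\<psi> has_vector_derivative
      k 0 *s (G2 - 2 *s (A *v G1 0)) + (2 * k1 0) *s (G1 0 - A *v G 0) + k2 *s G 0) (at 0)"
    by (rule has_vector_derivative_eq_rhs) (simp add: vec_eq_iff algebra_simps)
qed

lemma exp_ln_vector_derivative:
  assumes "(N has_real_derivative N1) (at r)" "N r > 0"
  shows "((\<lambda>r. exp (\<beta> * of_real (ln (N r))) :: complex) has_vector_derivative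
    \<beta> * of_real (N1 / N r) * exp (\<beta> * of_real (ln (N r)))) (at r)"
proof -
  have "((\<lambda>r. of_real (ln (N r)) :: complex) has_vector_derivative of_real (N1 / N r)) (at r)"
    using assms by (intro has_vector_derivative_of_real)
      (auto intro!: derivative_eq_intros simp: divide_inverse mult.commute)
  moreover have "((\<lambda>z. exp (\<beta> * z)) has_field_derivative \<beta> * exp (\<beta> * of_real (ln (N r)))) (at (of_real (ln (N r))))"
    by (auto intro!: derivative_eq_intros)
  ultimately show ?thesis
    using field_vector_diff_chain_at by (fastforce simp: o_def mult_ac)
qed

text \<open>Along z = r e_j the map has velocity e_j and acceleration 2 c - 4 c_j e_j at 0, and the
  weight N^(- \<alpha> / 2) has derivatives - \<alpha> c_j and \<alpha> (\<alpha> + 2) c_j^2 -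
  \<alpha> |c|^2. In the application A is the product e_j c.\<close>

lemma special_conformal_partials:
  fixes f :: "real ^ 'n::finite \<Rightarrow> complex ^ 't::finite" and c :: "real ^ 'n"
  assumes f: "smooth_on UNIV f"
    and \<phi>: "\<And>r. \<phi> (x + r *\<^sub>R axis j 1) = exp (- (\<alpha> / 2) * of_real (ln (sc_norm c (r *\<^sub>R axis j 1)))) *s
      (f (sc_map c (r *\<^sub>R axis j 1)) - r *\<^sub>R (A *v f (sc_map c (r *\<^sub>R axis j 1))))"
    and U: "open U" "x \<in> U" "smooth_on U \<phi>"
  shows "pd j \<phi> x = pd j f 0 - A *v f 0 - (\<alpha> * of_real (c $ j)) *s f 0"
    and "pd j (pd j \<phi>) x = pd j (pd j f) 0 + 2 *s frechet_derivative f (at 0) c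
      - (4 * of_real (c $ j)) *s pd j f 0 - 2 *s (A *v pd j f 0)
      - (2 * \<alpha> * of_real (c $ j)) *s (pd j f 0 - A *v f 0)
      + (\<alpha> * (\<alpha> + 2) * of_real ((c $ j)\<^sup>2) - \<alpha> * of_real (c \<bullet> c)) *s f 0"
proof -
  let ?e = "axis j 1 :: real ^ 'n"
  define N where "N r = 1 + 2 * (c $ j) * r + (c \<bullet> c) * r\<^sup>2" for r :: real
  define N1 where "N1 r = 2 * (c $ j) + 2 * (c \<bullet> c) * r" for r :: real
  define V where "V = {r. N r > 0}"
  define \<zeta> where "\<zeta> r = inverse (N r) *\<^sub>R (r *\<^sub>R ?e + r\<^sup>2 *\<^sub>R c)" for r
  define \<zeta>1 where "\<zeta>1 r = inverse (N r) *\<^sub>R (?e + (2 * r) *\<^sub>R c) +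
    (- (inverse (N r) * N1 r * inverse (N r))) *\<^sub>R (r *\<^sub>R ?e + r\<^sup>2 *\<^sub>R c)" for r
  define k where "k r = exp (- (\<alpha> / 2) * of_real (ln (N r)))" for r
  define k1 where "k1 r = - (\<alpha> / 2) * of_real (N1 r / N r) * k r" for r
  have sc: "sc_norm c (r *\<^sub>R ?e) = N r" "sc_map c (r *\<^sub>R ?e) = \<zeta> r" for r
    by (simp_all add: sc_norm_def N_def sc_map_def \<zeta>_def inner_axis power2_eq_square mult_ac)
  have "open V" unfolding V_def N_def
    by (intro open_Collect_less continuous_intros)
  have "0 \<in> V" by (simp add: V_def N_def)
  have N: "(N has_real_derivative N1 r) (at r)" for r
    unfolding N_def N1_def by (auto intro!: derivative_eq_intros)
  have N1: "(N1 has_real_derivative 2 * (c \<bullet> c)) (at r)" for r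
    unfolding N1_def by (auto intro!: derivative_eq_intros)
  have k: "(k has_vector_derivative k1 r) (at r)" if "r \<in> V" for r
    unfolding k_def k1_def using that by (intro exp_ln_vector_derivative N) (simp add: V_def)
  have k2: "(k1 has_vector_derivative (\<alpha> * (\<alpha> + 2) * of_real ((c $ j)\<^sup>2) - \<alpha> * of_real (c \<bullet> c))) (at 0)"
  proof -
    have "((\<lambda>r. N1 r / N r) has_real_derivative 2 * (c \<bullet> c) - 4 * (c $ j)\<^sup>2) (at 0)"
      using DERIV_divide[OF N1[of 0] N[of 0]] by (simp add: N_def N1_def power2_eq_square)
    then have "((\<lambda>r. - (\<alpha> / 2) * of_real (N1 r / N r) * k r) has_vector_derivative
      - (\<alpha> / 2) * of_real (N1 0 / N 0) * k1 0 + - (\<alpha> / 2) * of_real (2 * (c \<bullet> c) - 4 * (c $ j)\<^sup>2) * k 0) (at 0)"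
      by (intro has_vector_derivative_mult k \<open>0 \<in> V\<close> has_vector_derivative_mult_right has_vector_derivative_of_real)
    then show ?thesis unfolding k1_def[abs_def]
      by (rule has_vector_derivative_eq_rhs) (simp add: k_def N_def N1_def field_simps power2_eq_square)
  qed
  have \<zeta>: "(\<zeta> has_vector_derivative \<zeta>1 r) (at r)" if "r \<in> V" for r
  proof -
    have "N r \<noteq> 0" using that by (simp add: V_def)
    then show ?thesis unfolding \<zeta>_def[abs_def] \<zeta>1_def
      by (auto intro!: has_vector_derivative_scaleR DERIV_inverse' N derivative_eq_intros)
  qed
  have \<zeta>2: "(\<zeta>1 has_vector_derivative 2 *\<^sub>R c - (4 * (c $ j)) *\<^sub>R ?e) (at 0)"
  proof -
    have "((\<lambda>r. r *\<^sub>R ?e + r\<^sup>2 *\<^sub>R c) has_vector_derivative ?e) (at 0)"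
      "((\<lambda>r. ?e + (2 * r) *\<^sub>R c) has_vector_derivative 2 *\<^sub>R c) (at 0)"
      by (auto intro!: derivative_eq_intros)
    moreover have i: "((\<lambda>r. inverse (N r)) has_real_derivative - (inverse (N 0) * N1 0 * inverse (N 0))) (at 0)"
      by (rule DERIV_inverse'[OF N]) (simp add: N_def)
    \<comment> \<open>The value of d is immaterial: its factor vanishes at r = 0.\<close>
    moreover obtain d where "((\<lambda>r. - (inverse (N r) * N1 r * inverse (N r))) has_real_derivative d) (at 0)"
      using DERIV_minus[OF DERIV_mult[OF DERIV_mult[OF i N1[of 0]] i]] by blast
    ultimately have "(\<zeta>1 has_vector_derivative
       (inverse (N 0) *\<^sub>R 2 *\<^sub>R c + (- (inverse (N 0) * N1 0 * inverse (N 0))) *\<^sub>R (?e + (2 * 0) *\<^sub>R c)) +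
       ((- (inverse (N 0) * N1 0 * inverse (N 0))) *\<^sub>R ?e + d *\<^sub>R (0 *\<^sub>R ?e + 0\<^sup>2 *\<^sub>R c))) (at 0)"
      unfolding \<zeta>1_def by (intro has_vector_derivative_add has_vector_derivative_scaleR)
    then show ?thesis
      by (rule has_vector_derivative_eq_rhs) (simp add: N_def N1_def vec_eq_iff)
  qed
  have \<zeta>0: "\<zeta> 0 = 0" and \<zeta>10: "\<zeta>1 0 = ?e" by (simp_all add: \<zeta>_def \<zeta>1_def N_def)
  have V: "\<forall>r\<in>V. (k has_vector_derivative k1 r) (at r)" "\<forall>r\<in>V. (\<zeta> has_vector_derivative \<zeta>1 r) (at r)"
    using k \<zeta> by auto
  note G = second_derivative_compose_curve[OF f V(2) \<open>0 \<in> V\<close> \<zeta>2 \<zeta>10]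
  note W = second_derivative_weighted[OF V(1) k2 G(1) G(2) \<open>0 \<in> V\<close>, where A = A]
  note P = second_partial_along_line[OF U(1,2,3) \<open>open V\<close> \<open>0 \<in> V\<close> W(1)[folded \<phi>[unfolded sc, folded k_def]] W(2)]
  have l: "linear (frechet_derivative f (at 0))"
    by (rule linear_frechet_derivative[OF smooth_on_differentiable[OF f UNIV_I]])
  have k0: "k 0 = 1" "k1 0 = - \<alpha> * of_real (c $ j)" by (simp_all add: k_def k1_def N_def N1_def)
  show "pd j \<phi> x = pd j f 0 - A *v f 0 - (\<alpha> * of_real (c $ j)) *s f 0"
    unfolding P(1) by (simp add: k0 \<zeta>0 \<zeta>10 pd_def)
  show "pd j (pd j \<phi>) x = pd j (pd j f) 0 + 2 *s frechet_derivative f (at 0) c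
      - (4 * of_real (c $ j)) *s pd j f 0 - 2 *s (A *v pd j f 0)
      - (2 * \<alpha> * of_real (c $ j)) *s (pd j f 0 - A *v f 0)
      + (\<alpha> * (\<alpha> + 2) * of_real ((c $ j)\<^sup>2) - \<alpha> * of_real (c \<bullet> c)) *s f 0"
    unfolding P(2) k0 \<zeta>0 \<zeta>10 linear_diff[OF l] linear_scale[OF l]
    by (simp add: vec_eq_iff scaleR_conv_of_real[where 'a = complex] algebra_simps flip: pd_def)
qed

section \<open>The Laplacian and the Dirac operator under conformal maps\<close>

context
  fixes R :: "real ^ 'n::finite \<Rightarrow> complex ^ 't::finite ^ 't"
  assumes R: "clifford_map R"
begin

lemma clifford_map_linear: "linear R"
  using R by (auto simp: clifford_map_def intro: linearI)

lemma clifford_map_square: "R x *v (R x *v u) = - (of_real (x \<bullet> x) *s u)"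
  using R by (simp add: clifford_map_def matrix_vector_mul_assoc scaleR_matrix_vector_mult scaleR_smult
      flip: scaleR_minus_left)

lemma clifford_map_swap: "R x *v (R y *v u) = - (R y *v (R x *v u)) - (2 * of_real (x \<bullet> y)) *s u"
proof -
  have "R (x + y) *v (R (x + y) *v u) =
      R x *v (R x *v u) + R x *v (R y *v u) + R y *v (R x *v u) + R y *v (R y *v u)"
    by (simp add: linear_add[OF clifford_map_linear] matrix_vector_right_distrib matrix_vector_mult_add_rdistrib)
  then have "R x *v (R y *v u) + R y *v (R x *v u) = - (2 * of_real (x \<bullet> y)) *s u"
    unfolding clifford_map_square
    by (simp add: vec_eq_iff inner_add_left inner_add_right inner_commute algebra_simps)
  moreover have "R x *v (R y *v u) = R x *v (R y *v u) + R y *v (R x *v u) - R y *v (R x *v u)" by simp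
  ultimately show ?thesis by (simp only:) (simp add: vec_eq_iff)
qed

lemma sum_basis_clifford_map: "(\<Sum>j\<in>UNIV. of_real (c $ j) *s (R (axis j 1) *v u)) = R c *v u"
proof -
  have "c = (\<Sum>i\<in>UNIV. c $ i *\<^sub>R axis i 1)"
    using basis_expansion[of c] by (simp add: scalar_mult_eq_scaleR)
  then have "R c = (\<Sum>i\<in>UNIV. c $ i *\<^sub>R R (axis i 1))"
    by (metis (no_types, lifting) linear_sum[OF clifford_map_linear] linear_scale[OF clifford_map_linear] sum.cong)
  moreover have "(\<Sum>i\<in>I. c $ i *\<^sub>R R (axis i 1)) *v u = (\<Sum>j\<in>I. of_real (c $ j) *s (R (axis j 1) *v u))" for I
    by (induction I rule: infinite_finite_induct)
      (simp_all add: matrix_vector_mult_add_rdistrib scaleR_matrix_vector_mult scaleR_smult)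
  ultimately show ?thesis by simp
qed

end

lemma sum_smult: "(\<Sum>i\<in>I. a *s X i) = (a :: complex) *s (\<Sum>i\<in>I. X i)"
  by (induction I rule: infinite_finite_induct) (simp_all add: vec_eq_iff algebra_simps)

lemma sum_matrix_vector: "(\<Sum>i\<in>I. A *v X i) = A *v (\<Sum>i\<in>I. X i)"
  for A :: "complex ^ 'n::finite ^ 'm::finite"
  by (rule linear_sum[OF bounded_linear.linear[OF bounded_linear_matrix_vector], symmetric])

lemma sum_inner_components: "(\<Sum>j\<in>UNIV. complex_of_real ((c $ j)\<^sup>2)) = of_real (c \<bullet> c)"
  by (simp add: inner_vec_def power2_eq_square)

lemma sum_components_pd:
  fixes f :: "real ^ 'n::finite \<Rightarrow> complex ^ 't::finite"
  assumes "f differentiable (at x)"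
  shows "(\<Sum>j\<in>UNIV. of_real (v $ j) *s pd j f x) = frechet_derivative f (at x) v"
  by (simp add: frechet_derivative_vec[OF assms] scaleR_smult)

text \<open>The constants of E originate here, with \<alpha> = 2 lam + 1 = s + n. In L_v the terms v
  c f cancel and leave - s \<alpha> (c . v) f, whence \<kappa> = s \<alpha>. In the Laplacian the
  first order terms gather into - 2 L_c.\<close>

lemma special_conformal_jets:
  fixes R :: "real ^ 'n::finite \<Rightarrow> complex ^ 't::finite ^ 't" and lam :: complex
  assumes R: "clifford_map R" and f: "smooth_on UNIV f" and U: "open U" "x \<in> U" "smooth_on U \<phi>"
    and \<phi>: "\<And>z. \<phi> (x + z) = exp (- ((2 * lam + 1) / 2) * of_real (ln (sc_norm c z))) *s
      (f (sc_map c z) - R z *v (R c *v f (sc_map c z)))"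
  defines "s \<equiv> 2 * lam - of_nat CARD('n) + 1"
  defines "\<kappa> \<equiv> s * (s + of_nat CARD('n))"
  shows "\<phi> x = f 0"
    and "lop R s v \<phi> x = lop R s v f 0 - (\<kappa> * of_real (c \<bullet> v)) *s f 0"
    and "lap \<phi> x = lap f 0 - 2 *s lop R s c f 0 + (\<kappa> * of_real (c \<bullet> c)) *s f 0"
proof -
  define \<alpha> where "\<alpha> = 2 * lam + 1"
  define A where "A j = R (axis j 1) ** R c" for j
  have A: "A j *v u = R (axis j 1) *v (R c *v u)" for j u
    by (simp add: A_def matrix_vector_mul_assoc)
  have \<alpha>: "\<alpha> = s + of_nat CARD('n)" by (simp add: \<alpha>_def s_def)
  show "\<phi> x = f 0"
    using \<phi>[of 0] by (simp add: sc_norm_def sc_map_def linear_0[OF clifford_map_linear[OF R]])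
  have line: "\<phi> (x + r *\<^sub>R axis j 1) = exp (- (\<alpha> / 2) * of_real (ln (sc_norm c (r *\<^sub>R axis j 1)))) *s
      (f (sc_map c (r *\<^sub>R axis j 1)) - r *\<^sub>R (A j *v f (sc_map c (r *\<^sub>R axis j 1))))" for r j
    unfolding \<phi> \<alpha>_def A by (simp add: linear_scale[OF clifford_map_linear[OF R]] scaleR_matrix_vector_mult)
  note P = special_conformal_partials[OF f line U, unfolded A]
  note df = sum_components_pd[OF smooth_on_differentiable[OF f UNIV_I]]
  have sq: "R (axis j 1) *v (R (axis j 1) *v u) = - u" for j u
    by (simp add: clifford_map_square[OF R])
  have "frechet_derivative \<phi> (at x) v = (\<Sum>j\<in>UNIV. of_real (v $ j) *s pd j \<phi> x)" for v
    by (rule sum_components_pd[OF smooth_on_differentiable[OF U(3,2)], symmetric])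
  also have "\<dots> v = frechet_derivative f (at 0) v - R v *v (R c *v f 0) - (\<alpha> * of_real (c \<bullet> v)) *s f 0" for v
  proof -
    have "(\<Sum>j\<in>UNIV. of_real (v $ j) *s pd j \<phi> x) = (\<Sum>j\<in>UNIV. of_real (v $ j) *s pd j f 0)
       - (\<Sum>j\<in>UNIV. of_real (v $ j) *s (R (axis j 1) *v (R c *v f 0)))
       - (\<Sum>j\<in>UNIV. of_real (v $ j) * (\<alpha> * of_real (c $ j))) *s f 0"
      unfolding P by (simp add: vec_eq_iff algebra_simps sum.distrib sum_subtractf sum_distrib_left sum_distrib_right)
    also have "(\<Sum>j\<in>UNIV. of_real (v $ j) * (\<alpha> * of_real (c $ j))) = \<alpha> * of_real (c \<bullet> v)"
      by (simp add: inner_vec_def sum_distrib_left mult_ac)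
    finally show ?thesis unfolding df sum_basis_clifford_map[OF R] .
  qed
  finally have d\<phi>: "frechet_derivative \<phi> (at x) v =
      frechet_derivative f (at 0) v - R v *v (R c *v f 0) - (\<alpha> * of_real (c \<bullet> v)) *s f 0" for v .
  \<comment> \<open>Since e_j e_j = - 1, the sum over j contributes n c f against - \<alpha> c f;
    the balance is - s c f.\<close>
  have dirac: "dirac R \<phi> x = dirac R f 0 - s *s (R c *v f 0)"
  proof -
    have "dirac R \<phi> x = dirac R f 0 + of_nat CARD('n) *s (R c *v f 0)
       - \<alpha> *s (\<Sum>j\<in>UNIV. of_real (c $ j) *s (R (axis j 1) *v f 0))"
      unfolding dirac_def P mv_rules sq
      by (simp add: vec_eq_iff algebra_simps sum.distrib sum_subtractf sum_distrib_left del: sum_constant) simp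
    then show ?thesis
      unfolding sum_basis_clifford_map[OF R] by (simp add: \<alpha> vec_eq_iff algebra_simps)
  qed
  show "lop R s v \<phi> x = lop R s v f 0 - (\<kappa> * of_real (c \<bullet> v)) *s f 0"
    unfolding lop_def d\<phi> dirac mv_rules \<kappa>_def \<alpha> by (simp add: vec_eq_iff algebra_simps)
  \<comment> \<open>Anticommuting c to the front creates the Dirac operator, and the scalar
    correction cancels the coefficient - 4 that stems from the acceleration of the curve.\<close>
  have S2: "(\<Sum>j\<in>UNIV. R (axis j 1) *v (R c *v pd j f 0)) =
      - (R c *v dirac R f 0) - 2 *s frechet_derivative f (at 0) c"
  proof -
    have "R (axis j 1) *v (R c *v pd j f 0) = - (R c *v (R (axis j 1) *v pd j f 0)) - 2 *s (of_real (c $ j) *s pd j f 0)" for j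
      unfolding clifford_map_swap[OF R, of "axis j 1" c] by (simp add: inner_axis' vec_eq_iff)
    then show ?thesis
      by (simp only: sum_subtractf sum_negf sum_smult sum_matrix_vector df dirac_def)
  qed
  \<comment> \<open>The derivative along c receives 2 n - 4 + 4 - 2 \<alpha> = - 2 s, and |c|^2 f
    receives - 2 \<alpha> + \<alpha> (\<alpha> + 2) - n \<alpha> = \<kappa>.\<close>
  have "lap \<phi> x = lap f 0 + of_nat CARD('n) *s (2 *s frechet_derivative f (at 0) c)
      - 4 *s (\<Sum>j\<in>UNIV. of_real (c $ j) *s pd j f 0) - 2 *s (\<Sum>j\<in>UNIV. R (axis j 1) *v (R c *v pd j f 0))
      - (2 * \<alpha>) *s ((\<Sum>j\<in>UNIV. of_real (c $ j) *s pd j f 0) - (\<Sum>j\<in>UNIV. of_real (c $ j) *s (R (axis j 1) *v (R c *v f 0))))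
      + (\<alpha> * (\<alpha> + 2) * (\<Sum>j\<in>UNIV. of_real ((c $ j)\<^sup>2)) - of_nat CARD('n) * \<alpha> * of_real (c \<bullet> c)) *s f 0"
    unfolding lap_def P(2)
    by (simp add: vec_eq_iff sum.distrib sum_subtractf del: sum_constant)
      (simp add: algebra_simps sum.distrib sum_subtractf sum_distrib_left)
  then show "lap \<phi> x = lap f 0 - 2 *s lop R s c f 0 + (\<kappa> * of_real (c \<bullet> c)) *s f 0"
    unfolding S2 df sum_basis_clifford_map[OF R] clifford_map_square[OF R] sum_inner_components lop_def \<kappa>_def \<alpha>
    by (simp add: vec_eq_iff algebra_simps)
qed

text \<open>The inverse of w is its transpose, so the rows of w are orthonormal along with its
  columns. This serves the Laplacian, the Dirac operator and the sum over the tangent vectors of a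
  frame.\<close>

lemma orthogonal_transformation_trace:
  fixes B :: "real ^ 'n::finite \<Rightarrow> real ^ 'n \<Rightarrow> 'b::real_vector" and w :: "real ^ 'n \<Rightarrow> real ^ 'n"
  assumes w: "orthogonal_transformation w" and B: "bilinear B"
  shows "(\<Sum>j\<in>UNIV. B (w (axis j 1)) (w (axis j 1))) = (\<Sum>j\<in>UNIV. B (axis j 1) (axis j 1))"
proof -
  have exp: "B u v = (\<Sum>i\<in>UNIV. \<Sum>k\<in>UNIV. (u $ i * v $ k) *\<^sub>R B (axis i 1) (axis k 1))" for u v
  proof -
    have e: "u = (\<Sum>i\<in>UNIV. u $ i *\<^sub>R axis i 1)" for u :: "real ^ 'n"
      using basis_expansion[of u] by (simp add: scalar_mult_eq_scaleR)
    have "B u v = B (\<Sum>i\<in>UNIV. u $ i *\<^sub>R axis i 1) (\<Sum>k\<in>UNIV. v $ k *\<^sub>R axis k 1)"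
      using e[of u] e[of v] by simp
    also have "\<dots> = (\<Sum>(i, k)\<in>UNIV \<times> UNIV. B (u $ i *\<^sub>R axis i 1) (v $ k *\<^sub>R axis k 1))"
      by (rule bilinear_sum[OF B]) 
    finally show ?thesis
      by (simp add: sum.cartesian_product bilinear_lmul[OF B] bilinear_rmul[OF B] mult.commute)
  qed
  have orth: "(\<Sum>j\<in>UNIV. w (axis j 1) $ i * w (axis j 1) $ k) = (if i = k then 1 else 0)" for i k
  proof -
    define w' where "w' = inv w"
    have ww': "w (w' u) = u" for u
      using orthogonal_transformation_surj[OF w] by (simp add: w'_def surj_f_inv_f)
    have w': "w' u \<bullet> w' v = u \<bullet> v" for u v
      using w ww' by (metis orthogonal_transformation_def)
    have "w (axis j 1) $ i = w' (axis i 1) $ j" for i j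
    proof -
      have "w (axis j 1) $ i = w (axis j 1) \<bullet> w (w' (axis i 1))"
        by (simp add: ww' inner_axis)
      also have "\<dots> = axis j 1 \<bullet> w' (axis i 1)"
        using w by (simp add: orthogonal_transformation_def)
      finally show ?thesis by (simp add: inner_axis')
    qed
    then have "(\<Sum>j\<in>UNIV. w (axis j 1) $ i * w (axis j 1) $ k) = w' (axis i 1) \<bullet> w' (axis k 1)"
      by (simp add: inner_vec_def)
    also have "\<dots> = axis i 1 \<bullet> axis k (1 :: real)"
      by (rule w')
    finally show ?thesis by (simp add: inner_axis_axis)
  qed
  have "(\<Sum>j\<in>UNIV. B (w (axis j 1)) (w (axis j 1))) =
      (\<Sum>i\<in>UNIV. \<Sum>k\<in>UNIV. \<Sum>j\<in>UNIV. (w (axis j 1) $ i * w (axis j 1) $ k) *\<^sub>R B (axis i 1) (axis k 1))"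
    unfolding exp[of "w _"] by (subst sum.swap, rule sum.cong[OF HOL.refl], rule sum.swap)
  also have "\<dots> = (\<Sum>i\<in>UNIV. B (axis i 1) (axis i 1))"
    by (simp add: orth flip: scaleR_sum_left) (simp add: if_distrib[of "\<lambda>x. x *\<^sub>R _"] cong: if_cong)
  finally show ?thesis .
qed

section \<open>The local form of the action and its effect on jets\<close>

lemma smooth_on_linear:
  fixes l :: "'a::euclidean_space \<Rightarrow> 'b::real_normed_vector"
  shows "open U \<Longrightarrow> linear l \<Longrightarrow> smooth_on U f \<Longrightarrow> smooth_on U (\<lambda>x. l (f x))"
  by (simp add: smooth_on_bounded_linear linear_conv_bounded_linear[symmetric])

lemma smooth_on_sc_norm:
  assumes "open U" "smooth_on U \<zeta>" shows "smooth_on U (\<lambda>p. sc_norm c (\<zeta> p))"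
  unfolding sc_norm_def
  by (intro smooth_on_add smooth_on_const smooth_on_bilinear[OF _ bounded_bilinear_mult]
      smooth_on_bilinear[OF _ bounded_bilinear_inner] assms)

lemma smooth_on_sc_map:
  assumes "open U" "smooth_on U \<zeta>" "\<And>p. p \<in> U \<Longrightarrow> sc_norm c (\<zeta> p) > 0"
  shows "smooth_on U (\<lambda>p. sc_map c (\<zeta> p))"
  unfolding sc_map_def
  by (intro smooth_on_add smooth_on_const smooth_on_bilinear[OF _ bounded_bilinear_scaleR]
      smooth_on_bilinear[OF _ bounded_bilinear_inner] assms
      smooth_on_compose[OF _ smooth_on_inverse smooth_on_sc_norm]) (use assms in auto)

text \<open>The multiplier at x + z of the action in one variable, where M is its value at z = 0.
  The exponent is lam from the character plus 1/2 from normalising 1 - z c.\<close>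

definition twist :: "(real ^ 'n \<Rightarrow> complex ^ 't ^ 't) \<Rightarrow> complex ^ 't ^ 't \<Rightarrow> complex \<Rightarrow> real ^ 'n \<Rightarrow>
    real ^ 'n::finite \<Rightarrow> complex ^ 't \<Rightarrow> complex ^ 't::finite" where
  "twist R M lam c z u =
     exp (- ((2 * lam + 1) / 2) * of_real (ln (sc_norm c z))) *s (M *v u - R z *v (R c *v (M *v u)))"

lemma smooth_on_twist:
  assumes "clifford_map R" "open U" "smooth_on U \<zeta>" "smooth_on U u" "\<And>p. p \<in> U \<Longrightarrow> sc_norm c (\<zeta> p) > 0"
  shows "smooth_on U (\<lambda>p. twist R M lam c (\<zeta> p) (u p))"
  unfolding twist_def
proof (intro smooth_on_bilinear[OF _ bounded_bilinear_smult] smooth_on_diff)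
  note mv = smooth_on_bounded_linear[OF assms(2) bounded_linear_matrix_vector]
  show "smooth_on U (\<lambda>p. exp (- ((2 * lam + 1) / 2) * of_real (ln (sc_norm c (\<zeta> p)))))"
    by (intro smooth_on_compose[OF assms(2) smooth_on_exp_ln smooth_on_sc_norm] assms) (use assms in auto)
  show "smooth_on U (\<lambda>p. M *v u p)" by (intro mv assms)
  show "smooth_on U (\<lambda>p. R (\<zeta> p) *v (R c *v (M *v u p)))"
    by (intro smooth_on_bilinear[OF assms(2) bounded_bilinear_matrix_vector] mv
        smooth_on_linear[OF assms(2) clifford_map_linear[OF assms(1)]] assms)
qed (use assms in auto)

lemma frechet_derivative_affine:
  fixes g :: "real ^ 'n::finite \<Rightarrow> complex ^ 't::finite" and w :: "real ^ 'n \<Rightarrow> real ^ 'n"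
  assumes g: "smooth_on UNIV g" and w: "linear w"
  shows "frechet_derivative (\<lambda>z. M *v g (b + r *\<^sub>R w z)) (at z) v =
    r *\<^sub>R (M *v frechet_derivative g (at (b + r *\<^sub>R w z)) (w v))"
proof -
  have 1: "((\<lambda>z. b + r *\<^sub>R w z) has_derivative (\<lambda>v. r *\<^sub>R w v)) (at z)"
    by (rule derivative_eq_intros linear_imp_has_derivative[OF w] | simp)+
  have 2: "((\<lambda>y. M *v g y) has_derivative (\<lambda>v. M *v frechet_derivative g (at y) v)) (at y)" for y
    by (intro bounded_linear.has_derivative[OF bounded_linear_matrix_vector]
        smooth_on_has_derivative[OF g UNIV_I])
  have "frechet_derivative (\<lambda>z. M *v g (b + r *\<^sub>R w z)) (at z) =
      (\<lambda>v. M *v frechet_derivative g (at (b + r *\<^sub>R w z)) (r *\<^sub>R w v))"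
    using diff_chain_at[OF 1 2] frechet_derivative_at by (metis (no_types, lifting) o_def ext)
  then show ?thesis
    by (simp add: linear_scale[OF linear_frechet_derivative[OF smooth_on_differentiable[OF g UNIV_I]]]
        matrix_vector_mult_scaleR)
qed

text \<open>This handles the similarity that follows the special conformal map. The relation for M
  compensates the rotation of the Clifford action, so the Dirac operator is only rescaled.\<close>

lemma affine_jets:
  fixes f :: "real ^ 'n::finite \<Rightarrow> complex ^ 't::finite" and w :: "real ^ 'n \<Rightarrow> real ^ 'n"
    and r :: real and b :: "real ^ 'n"
  assumes R: "clifford_map R" and f: "smooth_on UNIV f" and w: "orthogonal_transformation w"
    and M: "\<And>v. R v ** M = M ** R (w v)"
  defines "g \<equiv> \<lambda>z. M *v f (b + r *\<^sub>R w z)"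
  shows "smooth_on UNIV g" "g 0 = M *v f b"
    and "lop R s v g 0 = M *v lop R s (r *\<^sub>R w v) f b"
    and "lap g 0 = M *v (r\<^sup>2 *\<^sub>R lap f b)"
proof -
  have lw: "linear w" by (rule orthogonal_transformation_linear[OF w])
  have w0: "b + r *\<^sub>R w 0 = b" by (simp add: linear_0[OF lw])
  have M': "R v *v (M *v u) = M *v (R (w v) *v u)" for u v
    by (simp add: matrix_vector_mul_assoc M)
  have df: "linear (frechet_derivative f (at y))" for y
    by (rule linear_frechet_derivative[OF smooth_on_differentiable[OF f UNIV_I]])
  show "smooth_on UNIV g" unfolding g_def
    by (intro smooth_on_bounded_linear[OF _ bounded_linear_matrix_vector] smooth_on_compose[OF _ f]
        smooth_on_add smooth_on_const smooth_on_bounded_linear[OF _ bounded_linear_scaleR_right]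
        smooth_on_linear[OF _ lw] smooth_on_id) auto
  show "g 0 = M *v f b" by (simp add: g_def w0)
  have dg: "frechet_derivative g (at z) v = M *v (r *\<^sub>R frechet_derivative f (at (b + r *\<^sub>R w z)) (w v))" for z v
    unfolding g_def frechet_derivative_affine[OF f lw] by (simp add: matrix_vector_mult_scaleR)
  have "dirac R g 0 = r *\<^sub>R (M *v (\<Sum>j\<in>UNIV. R (w (axis j 1)) *v frechet_derivative f (at b) (w (axis j 1))))"
    unfolding dirac_def pd_def dg w0 M' by (simp add: matrix_vector_mult_scaleR scaleR_sum_right flip: sum_matrix_vector)
  also have "(\<Sum>j\<in>UNIV. R (w (axis j 1)) *v frechet_derivative f (at b) (w (axis j 1))) = dirac R f b"
    unfolding dirac_def pd_def
    by (rule orthogonal_transformation_trace[OF w]) (auto simp: bilinear_def intro!: linearI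
        simp: linear_add[OF df] linear_scale[OF df] mv_rules linear_add[OF clifford_map_linear[OF R]]
        linear_scale[OF clifford_map_linear[OF R]] matrix_vector_mult_add_rdistrib scaleR_matrix_vector_mult)
  finally have "dirac R g 0 = r *\<^sub>R (M *v dirac R f b)" .
  then show "lop R s v g 0 = M *v lop R s (r *\<^sub>R w v) f b"
    unfolding lop_def dg w0 linear_scale[OF df] linear_scale[OF clifford_map_linear[OF R]]
    by (simp add: mv_rules M' scaleR_matrix_vector_mult)
  define B where "B u v = (\<Sum>i\<in>UNIV. u $ i *\<^sub>R frechet_derivative (pd i f) (at b) v)" for u v
  have dp: "linear (frechet_derivative (pd i f) (at y))" for i y
    by (rule linear_frechet_derivative[OF smooth_on_differentiable[OF smooth_on_pd[OF f] UNIV_I]])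
  have B: "bilinear B"
    by (auto simp: bilinear_def B_def intro!: linearI
        simp: linear_add[OF dp] linear_scale[OF dp] scaleR_add_left scaleR_add_right sum.distrib
        scaleR_sum_right mult.commute)
  have "frechet_derivative (\<lambda>y. frechet_derivative f (at y) u) (at b) v = B u v" for u v
  proof -
    have "((\<lambda>y. \<Sum>i\<in>UNIV. u $ i *\<^sub>R pd i f y) has_derivative B u) (at b)"
      unfolding B_def
      by (intro has_derivative_sum has_derivative_scaleR_right smooth_on_has_derivative[OF smooth_on_pd[OF f]]) simp
    then have "((\<lambda>y. frechet_derivative f (at y) u) has_derivative B u) (at b)"
      by (simp add: frechet_derivative_vec[OF smooth_on_differentiable[OF f UNIV_I], abs_def])
    then show ?thesis by (simp add: frechet_derivative_at[symmetric])
  qed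
  moreover have "pd j (pd j g) 0 = r *\<^sub>R ((r *\<^sub>R M) *v
      frechet_derivative (\<lambda>y. frechet_derivative f (at y) (w (axis j 1))) (at b) (w (axis j 1)))" for j
  proof -
    have "pd j g = (\<lambda>z. (r *\<^sub>R M) *v frechet_derivative f (at (b + r *\<^sub>R w z)) (w (axis j 1)))"
      by (simp add: fun_eq_iff pd_def dg matrix_vector_mult_scaleR scaleR_matrix_vector_mult)
    then show ?thesis
      by (simp only: pd_def[of j "\<lambda>z. _ z"] frechet_derivative_affine[OF smooth_on_frechet[OF f] lw] w0)
  qed
  ultimately have "lap g 0 = r\<^sup>2 *\<^sub>R (M *v (\<Sum>j\<in>UNIV. B (w (axis j 1)) (w (axis j 1))))"
    unfolding lap_def by (simp add: power2_eq_square scaleR_matrix_vector_mult scaleR_sum_right flip: sum_matrix_vector)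
  also have "(\<Sum>j\<in>UNIV. B (w (axis j 1)) (w (axis j 1))) = lap f b"
    unfolding orthogonal_transformation_trace[OF w B]
    unfolding lap_def B_def by (simp add: axis_def if_distrib[of "\<lambda>x. x *\<^sub>R _"] pd_def cong: if_cong)
  finally show "lap g 0 = M *v (r\<^sup>2 *\<^sub>R lap f b)" by (simp add: matrix_vector_mult_scaleR)
qed

text \<open>A triple \<open>(p, v, q)\<close> encodes the operator \<open>p \<Delta> + L\<^sub>v + q \<kappa>\<close> with \<open>\<kappa> = s (s + n)\<close>.\<close>

definition conf_op :: "(real ^ 'n \<Rightarrow> complex ^ 't ^ 't) \<Rightarrow> complex \<Rightarrow> real ^ 'n \<Rightarrow> 'n minkowski \<Rightarrow>
    (real ^ 'n::finite \<Rightarrow> complex ^ 't::finite) \<Rightarrow> complex ^ 't" where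
  "conf_op R s x p f = fst p *\<^sub>R lap f x + lop R s (fst (snd p)) f x
     + snd (snd p) *\<^sub>R ((s * (s + of_nat CARD('n))) *s f x)"

lemma lop_linear:
  assumes "clifford_map R" "f differentiable (at x)"
  shows "linear (\<lambda>v. lop R s v f x)"
  by (rule linearI) (simp_all add: lop_def linear_add[OF linear_frechet_derivative[OF assms(2)]]
      linear_scale[OF linear_frechet_derivative[OF assms(2)]] linear_add[OF clifford_map_linear[OF assms(1)]]
      linear_scale[OF clifford_map_linear[OF assms(1)]] matrix_vector_mult_add_rdistrib scaleR_matrix_vector_mult
      vec_eq_iff algebra_simps)

text \<open>Up to the factor \<open>r\<close>, which makes up for the shift of \<open>\<lambda>\<close> by one, this is the contragredient of the
  conjugation by \<open>m a n\<close> on Minkowski space.\<close>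

definition jet_map :: "(real ^ 'n \<Rightarrow> real ^ 'n) \<Rightarrow> real ^ 'n::finite \<Rightarrow> real \<Rightarrow> 'n minkowski \<Rightarrow> 'n minkowski" where
  "jet_map w c r p = (r\<^sup>2 * fst p, r *\<^sub>R w (fst (snd p)) - (2 * r * fst p) *\<^sub>R w c,
     snd (snd p) - c \<bullet> fst (snd p) + (c \<bullet> c) * fst p)"

text \<open>\<open>affine_jets\<close> is substituted into \<open>special_conformal_jets\<close>:
  after the shifts by c, the Laplacian picks up r^2, L_v becomes r L_(w v), and kappa stays.
  \<open>jet_map\<close> records the composite.\<close>

lemma twist_jets:
  fixes R :: "real ^ 'n::finite \<Rightarrow> complex ^ 't::finite ^ 't" and w :: "real ^ 'n \<Rightarrow> real ^ 'n"
  assumes R: "clifford_map R" and f: "smooth_on UNIV f" and w: "orthogonal_transformation w"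
    and M: "\<And>v. R v ** M = M ** R (w v)"
    and \<phi>: "\<And>z. \<phi> (x + z) = twist R M lam c z (f (b + r *\<^sub>R w (sc_map c z)))"
    and s: "s = 2 * lam - of_nat CARD('n) + 1"
  shows "\<phi> x = M *v f b" "conf_op R s x p \<phi> = M *v conf_op R s b (jet_map w c r p) f"
proof -
  let ?g = "\<lambda>z. M *v f (b + r *\<^sub>R w z)"
  note g = affine_jets[OF R f w M, where b = b and r = r]
  define U where "U = {y. sc_norm c (y - x) > 0}"
  have U: "open U" "x \<in> U"
    unfolding U_def sc_norm_def by (auto intro!: open_Collect_less continuous_intros)
  have \<phi>': "\<phi> = (\<lambda>y. twist R M lam c (y - x) (f (b + r *\<^sub>R w (sc_map c (y - x)))))"
  proof
    show "\<phi> y = twist R M lam c (y - x) (f (b + r *\<^sub>R w (sc_map c (y - x))))" for y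
      using \<phi>[of "y - x"] by simp
  qed
  have smooth: "smooth_on U \<phi>" unfolding \<phi>'
    by (intro smooth_on_twist[OF R] smooth_on_compose[OF _ f] smooth_on_add smooth_on_const
        smooth_on_bounded_linear[OF _ bounded_linear_scaleR_right] smooth_on_linear[OF _ orthogonal_transformation_linear[OF w]]
        smooth_on_sc_map smooth_on_diff smooth_on_id U) (auto simp: U_def)
  have "\<phi> (x + z) = exp (- ((2 * lam + 1) / 2) * of_real (ln (sc_norm c z))) *s
      (?g (sc_map c z) - R z *v (R c *v ?g (sc_map c z)))" for z
    unfolding \<phi> twist_def ..
  note J = special_conformal_jets[OF R g(1) U smooth this, folded s, unfolded g]
  have l: "linear (\<lambda>v. lop R s v f b)"
    by (rule lop_linear[OF R smooth_on_differentiable[OF f UNIV_I]])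
  show "\<phi> x = M *v f b" by (rule J(1))
  show "conf_op R s x p \<phi> = M *v conf_op R s b (jet_map w c r p) f"
    unfolding conf_op_def J jet_map_def
    by (simp add: linear_diff[OF l] linear_scale[OF l] mv_rules scaleR_smult vec_eq_iff algebra_simps)
qed

subsection \<open>Contraction of conformal vectors\<close>

lemma bilinear_mink_form: "bilinear (mink_form :: 'n::finite minkowski \<Rightarrow> _)"
  by (auto simp: bilinear_def mink_form_def algebra_simps inner_add_left inner_add_right intro!: linearI
      split: prod.splits)

lemma linear_tangent: "linear (tangent x)"
  by (rule linearI) (simp_all add: tangent_def inner_add_right)

text \<open>Omega in the form a Delta + sum V(e_j) L_j + b kappa / 2: Z pairs its vectors with the
  triples of its operators, after P has acted on the triples. Because \<open>cone_point x\<close>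
  and \<open>null_eps\<close> pair to 1, the weight 1/2 gives Delta with kappa the coefficient 1 in
  twice the contraction.\<close>

definition frame_trace :: "('n::finite minkowski \<Rightarrow> 'n minkowski \<Rightarrow> 'b::real_vector) \<Rightarrow> 'n minkowski \<Rightarrow>
    (real ^ 'n \<Rightarrow> 'n minkowski) \<Rightarrow> 'n minkowski \<Rightarrow> ('n minkowski \<Rightarrow> 'n minkowski) \<Rightarrow> 'b" where
  "frame_trace Z a V b P = Z a (P (1, 0, 0)) + (\<Sum>j\<in>UNIV. Z (V (axis j 1)) (P (0, axis j 1, 0)))
     + (1 / 2) *\<^sub>R Z b (P (0, 0, 1))"

text \<open>The vectors move by conjugation and the triples contragrediently, so all terms in c
  cancel and only the factor r survives.\<close>

lemma frame_trace_jet_map: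
  fixes w :: "real ^ 'n::finite \<Rightarrow> real ^ 'n"
  assumes Z: "bilinear Z" and V: "linear V" and w: "orthogonal_transformation w" and r: "r > 0"
  shows "frame_trace Z (inverse r *\<^sub>R a) (\<lambda>v. V (w v) + (2 * inverse r * (c \<bullet> v)) *\<^sub>R a)
      (r *\<^sub>R b + 2 *\<^sub>R V (w c) + (2 * inverse r * (c \<bullet> c)) *\<^sub>R a) (jet_map w c r)
    = r *\<^sub>R frame_trace Z a V b id"
proof -
  note Zr = bilinear_ladd[OF Z] bilinear_radd[OF Z] bilinear_lmul[OF Z] bilinear_rmul[OF Z]
    bilinear_lsub[OF Z] bilinear_rsub[OF Z]
  define T where "T v = (0 :: real, v, 0 :: real)" for v :: "real ^ 'n"
  have lT: "linear T" by (rule linearI) (simp_all add: T_def)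
  have lw: "linear w" by (rule orthogonal_transformation_linear[OF w])
  define I where "I = (0 :: real, 0 :: real ^ 'n, 1 :: real)"
  define E where "E = (1 :: real, 0 :: real ^ 'n, 0 :: real)"
  have jet: "jet_map w c r E = r\<^sup>2 *\<^sub>R E + (- 2 * r) *\<^sub>R T (w c) + (c \<bullet> c) *\<^sub>R I"
    "jet_map w c r (0, v, 0) = r *\<^sub>R T (w v) + (- (c \<bullet> v)) *\<^sub>R I" "jet_map w c r I = I" for v
    by (simp_all add: jet_map_def T_def I_def E_def linear_0[OF lw])
  have c: "(\<Sum>j\<in>UNIV. c $ j *\<^sub>R g (axis j 1)) = g c" if "linear g" for g :: "real ^ 'n \<Rightarrow> 'c::real_vector"
  proof -
    have "c = (\<Sum>i\<in>UNIV. c $ i *\<^sub>R axis i 1)"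
      using basis_expansion[of c] by (simp add: scalar_mult_eq_scaleR)
    then have "g c = g (\<Sum>i\<in>UNIV. c $ i *\<^sub>R axis i 1)" by simp
    then show ?thesis by (simp add: linear_sum[OF that] linear_scale[OF that])
  qed
  have lZ: "linear (\<lambda>v. Z a (T (w v)))" "linear (\<lambda>v. Z (V (w v)) I)"
    by (auto intro!: linearI simp: linear_add[OF lT] linear_scale[OF lT] linear_add[OF lw] linear_scale[OF lw]
        linear_add[OF V] linear_scale[OF V] Zr)
  have tr: "(\<Sum>j\<in>UNIV. Z (V (w (axis j 1))) (T (w (axis j 1)))) = (\<Sum>j\<in>UNIV. Z (V (axis j 1)) (T (axis j 1)))"
    by (rule orthogonal_transformation_trace[OF w, of "\<lambda>u v. Z (V u) (T v)"])
      (auto simp: bilinear_def intro!: linearI simp: linear_add[OF lT] linear_scale[OF lT]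
        linear_add[OF V] linear_scale[OF V] Zr)
  have rr: "r * (inverse r * k) = k" "inverse r * (r * k) = k" "r * inverse r = 1" "inverse r * r = 1" for k
    using r by simp_all
  have cc: "(\<Sum>j\<in>UNIV. c $ j * c $ j) = c \<bullet> c" by (simp add: inner_vec_def)
  have S: "(\<Sum>j\<in>UNIV. Z (V (w (axis j 1)) + (2 * inverse r * (c \<bullet> axis j 1)) *\<^sub>R a) (jet_map w c r (0, axis j 1, 0))) =
      r *\<^sub>R (\<Sum>j\<in>UNIV. Z (V (w (axis j 1))) (T (w (axis j 1))))
      - (\<Sum>j\<in>UNIV. c $ j *\<^sub>R Z (V (w (axis j 1))) I)
      + 2 *\<^sub>R (\<Sum>j\<in>UNIV. c $ j *\<^sub>R Z a (T (w (axis j 1))))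
      - (2 * inverse r * (\<Sum>j\<in>UNIV. c $ j * c $ j)) *\<^sub>R Z a I"
    unfolding jet inner_axis
    by (simp add: rr Zr scaleR_sum_right scaleR_sum_left sum_distrib_left sum.distrib sum_subtractf algebra_simps)
  show ?thesis
    unfolding frame_trace_def S
    unfolding I_def[symmetric] E_def[symmetric] tr c[OF lZ(1)] c[OF lZ(2)] cc jet
    by (simp add: Zr T_def[symmetric] power2_eq_square algebra_simps rr) (simp flip: scaleR_add_left)
qed

text \<open>The shape of E: the triples (1, 0, 0), (0, e_j, 0), (0, 0, 1) select Delta, L_j and
  kappa in each variable, and d is x - y.\<close>

definition contraction :: "('n::finite minkowski \<Rightarrow> 'n minkowski \<Rightarrow> 'b::real_vector) \<Rightarrow> real ^ 'n \<Rightarrow> 'b" where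
  "contraction T d = (norm d)\<^sup>2 *\<^sub>R T (1, 0, 0) (1, 0, 0)
     + 2 *\<^sub>R (\<Sum>j\<in>UNIV. d $ j *\<^sub>R T (0, axis j 1, 0) (1, 0, 0))
     - 2 *\<^sub>R (\<Sum>j\<in>UNIV. d $ j *\<^sub>R T (1, 0, 0) (0, axis j 1, 0))
     + T (1, 0, 0) (0, 0, 1) + T (0, 0, 1) (1, 0, 0)
     - 2 *\<^sub>R (\<Sum>j\<in>UNIV. T (0, axis j 1, 0) (0, axis j 1, 0))"

text \<open>The coefficients come from \<open>mink_form_frame\<close>. P and P' stay free, so that
  the identity serves for transformed and for untransformed triples.\<close>

lemma contraction_frame_trace:
  fixes T :: "'n::finite minkowski \<Rightarrow> 'n minkowski \<Rightarrow> 'b::real_vector"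
  shows "contraction (\<lambda>p q. T (P p) (P' q)) (x - y) = 2 *\<^sub>R frame_trace
     (\<lambda>u p. frame_trace (\<lambda>u' q. mink_form u u' *\<^sub>R T p q) (cone_point y) (tangent y) null_eps P')
     (cone_point x) (tangent x) null_eps P"
proof -
  have "(\<Sum>j\<in>UNIV. (axis i 1 \<bullet> axis j (1 :: real)) *\<^sub>R g j) = (g i :: 'b)" for i :: 'n and g
    by (simp add: inner_axis_axis if_distrib[of "\<lambda>x. x *\<^sub>R _"] cong: if_cong)
  then show ?thesis
    unfolding contraction_def frame_trace_def mink_form_frame inner_axis
    by (simp add: scaleR_sum_right sum.distrib sum_negf sum_subtractf algebra_simps)
qed

text \<open>The same h conjugates both frames, so all nine pairings survive when the frames at x and
  y are replaced by their images, written in the frames at b and b'. Then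
  \<open>frame_trace_jet_map\<close> removes the jet maps, one variable at a time.\<close>

lemma contraction_invariant:
  fixes h :: "'n::finite clifford"
  assumes ne: "(1 :: 'n clifford) \<noteq> 0" and h: "h * h' = 1" and T: "bilinear T"
    and fx: "factorization (h * nbar_elt x) b m (a_elt t) (n_elt c)" "\<And>v. m * cl_vec v = cl_vec (w v) * m"
      "orthogonal_transformation w" "r = exp (- 2 * t)"
    and fy: "factorization (h * nbar_elt y) b' m' (a_elt t') (n_elt c')" "\<And>v. m' * cl_vec v = cl_vec (w' v) * m'"
      "orthogonal_transformation w'" "r' = exp (- 2 * t')"
  shows "contraction (\<lambda>p q. T (jet_map w c r p) (jet_map w' c' r' q)) (x - y) = (r * r') *\<^sub>R contraction T (b - b')"
proof -
  have e: "exp (2 * t) = inverse r" "exp (2 * t') = inverse r'" "r > 0" "r' > 0"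
    by (simp_all add: fx(4) fy(4) flip: exp_minus)
  note X = intertwines_factorization[OF fx(1,2), folded fx(4), unfolded e]
    and Y = intertwines_factorization[OF fy(1,2), folded fy(4), unfolded e]
  note form = intertwines_form[OF ne h]
  note I = form[OF X(1) Y(1)] form[OF X(1) Y(2)] form[OF X(1) Y(3)] form[OF X(2) Y(1)] form[OF X(2) Y(2)]
    form[OF X(2) Y(3)] form[OF X(3) Y(1)] form[OF X(3) Y(2)] form[OF X(3) Y(3)]
  note Tr = bilinear_ladd[OF T] bilinear_radd[OF T] bilinear_lmul[OF T] bilinear_rmul[OF T]
  note Qr = bilinear_ladd[OF bilinear_mink_form] bilinear_radd[OF bilinear_mink_form]
    bilinear_lmul[OF bilinear_mink_form] bilinear_rmul[OF bilinear_mink_form]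
  have Z: "bilinear (\<lambda>u' q. mink_form u u' *\<^sub>R T p q)" for u p
    unfolding bilinear_def by (intro conjI allI linearI; simp add: Tr Qr algebra_simps)
  have Z': "bilinear (\<lambda>u p. frame_trace (\<lambda>u' q. mink_form u u' *\<^sub>R T p q) a V b id)" for a V b
    unfolding frame_trace_def bilinear_def
    by (intro conjI allI linearI; simp add: Tr Qr algebra_simps sum.distrib scaleR_sum_right)
  have "contraction (\<lambda>p q. T (jet_map w c r p) (jet_map w' c' r' q)) (x - y) = 2 *\<^sub>R frame_trace
     (\<lambda>u p. frame_trace (\<lambda>u' q. mink_form u u' *\<^sub>R T p q) (inverse r' *\<^sub>R cone_point b')
         (\<lambda>v. tangent b' (w' v) + (2 * inverse r' * (c' \<bullet> v)) *\<^sub>R cone_point b')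
         (r' *\<^sub>R null_eps + 2 *\<^sub>R tangent b' (w' c') + (2 * inverse r' * (c' \<bullet> c')) *\<^sub>R cone_point b') (jet_map w' c' r'))
     (inverse r *\<^sub>R cone_point b)
         (\<lambda>v. tangent b (w v) + (2 * inverse r * (c \<bullet> v)) *\<^sub>R cone_point b)
         (r *\<^sub>R null_eps + 2 *\<^sub>R tangent b (w c) + (2 * inverse r * (c \<bullet> c)) *\<^sub>R cone_point b) (jet_map w c r)"
    unfolding contraction_frame_trace[where P = "jet_map w c r" and P' = "jet_map w' c' r'"]
    unfolding frame_trace_def by (simp only: I)
  also have "\<dots> = 2 *\<^sub>R (r *\<^sub>R (frame_trace
     (\<lambda>u p. r' *\<^sub>R frame_trace (\<lambda>u' q. mink_form u u' *\<^sub>R T p q) (cone_point b') (tangent b') null_eps id)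
       (cone_point b) (tangent b) null_eps id))"
  proof -
    have Z'': "bilinear (\<lambda>u p. r' *\<^sub>R frame_trace (\<lambda>u' q. mink_form u u' *\<^sub>R T p q) a V b id)" for a V b
      using Z'[of a V b] by (auto simp: bilinear_def intro!: linear_compose_scale_right)
    show ?thesis
      unfolding frame_trace_jet_map[OF Z linear_tangent fy(3) e(4)] frame_trace_jet_map[OF Z'' linear_tangent fx(3) e(3)] ..
  qed
  also have "\<dots> = (r * r') *\<^sub>R contraction T (b - b')"
    using contraction_frame_trace[of T id id b b']
    by (simp add: frame_trace_def scaleR_sum_right algebra_simps)
  finally show ?thesis .
qed

subsection \<open>The operator in terms of one-variable operators\<close>

lemma kron_mult: "(A \<otimes>\<^sub>K B) ** (C \<otimes>\<^sub>K D) = (A ** C) \<otimes>\<^sub>K (B ** D)"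
  by (simp add: kron_def matrix_matrix_mult_def vec_eq_iff sum_product sum.cartesian_product mult_ac
      flip: UNIV_Times_UNIV) (auto intro!: sum.cong)

lemma kron_mat: "mat 1 \<otimes>\<^sub>K mat 1 = mat 1"
  by (auto simp: kron_def mat_def vec_eq_iff)

lemma kron_add: "(A + B) \<otimes>\<^sub>K C = A \<otimes>\<^sub>K C + B \<otimes>\<^sub>K C" "C \<otimes>\<^sub>K (A + B) = C \<otimes>\<^sub>K A + C \<otimes>\<^sub>K B"
  by (simp_all add: kron_def vec_eq_iff algebra_simps)

lemma kron_diff: "(A - B) \<otimes>\<^sub>K C = A \<otimes>\<^sub>K C - B \<otimes>\<^sub>K C" "C \<otimes>\<^sub>K (A - B) = C \<otimes>\<^sub>K A - C \<otimes>\<^sub>K B"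
  by (simp_all add: kron_def vec_eq_iff algebra_simps)

lemma kron_scaleR: "(r *\<^sub>R A) \<otimes>\<^sub>K C = r *\<^sub>R (A \<otimes>\<^sub>K C)" "C \<otimes>\<^sub>K (r *\<^sub>R A) = r *\<^sub>R (C \<otimes>\<^sub>K A)"
  by (simp_all add: kron_def vec_eq_iff)

definition rep_x :: "('n::finite complex_clifford \<Rightarrow> complex ^ 's::finite ^ 's) \<Rightarrow> real ^ 'n \<Rightarrow>
    complex ^ ('s \<times> 's) ^ ('s \<times> 's)" where
  "rep_x \<rho> v = \<rho> (cc_of (cl_vec v)) \<otimes>\<^sub>K mat 1"

definition rep_y :: "('n::finite complex_clifford \<Rightarrow> complex ^ 's::finite ^ 's) \<Rightarrow> real ^ 'n \<Rightarrow>
    complex ^ ('s \<times> 's) ^ ('s \<times> 's)" where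
  "rep_y \<rho> v = mat 1 \<otimes>\<^sub>K \<rho> (cc_of (cl_vec v))"

lemma clifford_map_rep:
  assumes "clifford_module \<rho>" shows "clifford_map (rep_x \<rho>)" "clifford_map (rep_y \<rho>)"
  unfolding clifford_map_def rep_x_def rep_y_def kron_mult module_vec_square[OF assms]
  by (simp_all add: module_vec_add[OF assms] module_vec_scaleR[OF assms] kron_add kron_scaleR kron_mat
      flip: scaleR_minus_left)

lemma kron_split: "A \<otimes>\<^sub>K B = (A \<otimes>\<^sub>K mat 1) ** (mat 1 \<otimes>\<^sub>K B)"
  by (simp add: kron_mult)

lemma kron_commute: "(mat 1 \<otimes>\<^sub>K B) *v ((A \<otimes>\<^sub>K mat 1) *v u) = (A \<otimes>\<^sub>K mat 1) *v ((mat 1 \<otimes>\<^sub>K B) *v u)"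
  by (simp add: matrix_vector_mul_assoc kron_mult)

lemma smooth_on_dxy:
  assumes "smooth_on W G" shows "smooth_on W (dx j G)" "smooth_on W (dy j G)"
  unfolding dx_def[abs_def] dy_def[abs_def] by (rule smooth_on_frechet[OF assms])+

lemma smooth_on_laplace:
  assumes "open W" "smooth_on W G" shows "smooth_on W (laplace_x G)" "smooth_on W (laplace_y G)"
  unfolding laplace_x_def[abs_def] laplace_y_def[abs_def]
  by (intro smooth_on_sum smooth_on_dxy assms)+

lemma smooth_on_dirac:
  assumes "open W" "smooth_on W G" shows "smooth_on W (dirac_x \<rho> G)" "smooth_on W (dirac_y \<rho> G)"
  unfolding dirac_x_def[abs_def] dirac_y_def[abs_def]
  by (intro smooth_on_sum smooth_on_bounded_linear[OF _ bounded_linear_matrix_vector] smooth_on_dxy assms)+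

text \<open>The shape a H - A K is that of L_j; with A = 0 or A = - 1 it also covers multiples and
  sums.\<close>

lemma frechet_derivative_combination:
  fixes H K :: "'a::euclidean_space \<Rightarrow> complex ^ 't::finite"
  assumes "H differentiable (at p)" "K differentiable (at p)"
  shows "frechet_derivative (\<lambda>p. a *s H p - A *v K p) (at p) v =
    a *s frechet_derivative H (at p) v - A *v frechet_derivative K (at p) v"
proof -
  have "((\<lambda>p. a *s H p - A *v K p) has_derivative
    (\<lambda>v. a *s frechet_derivative H (at p) v - A *v frechet_derivative K (at p) v)) (at p)"
    using assms by (intro has_derivative_diff bounded_linear.has_derivative[OF bounded_linear_matrix_vector]
        bounded_linear.has_derivative[OF bounded_linear_smult]) (simp_all add: frechet_derivative_works)
  then show ?thesis by (simp add: frechet_derivative_at[symmetric])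
qed

lemma dx_cong:
  assumes "open W" "p \<in> W" "\<And>q. q \<in> W \<Longrightarrow> F q = G q"
  shows "dx j F p = dx j G p" "dy j F p = dy j G p"
  unfolding dx_def dy_def using frechet_derivative_cong_open[OF assms] by auto

lemma dx_combination:
  assumes W: "open W" "p \<in> W" and H: "smooth_on W H" and K: "smooth_on W K"
  shows "dx j (\<lambda>p. a *s H p - A *v K p) p = a *s dx j H p - A *v dx j K p"
    and "laplace_x (\<lambda>p. a *s H p - A *v K p) p = a *s laplace_x H p - A *v laplace_x K p"
    and "(\<And>v. A ** rep_x \<rho> v = rep_x \<rho> v ** A) \<Longrightarrow>
      dirac_x \<rho> (\<lambda>p. a *s H p - A *v K p) p = a *s dirac_x \<rho> H p - A *v dirac_x \<rho> K p"
proof -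
  have *: "dx j (\<lambda>p. a *s H p - A *v K p) p = a *s dx j H p - A *v dx j K p"
    if "p \<in> W" "smooth_on W H" "smooth_on W K" for p j and H K :: "('a, 'b) spinor_field"
    unfolding dx_def
    by (rule frechet_derivative_combination[OF smooth_on_differentiable[OF that(2,1)] smooth_on_differentiable[OF that(3,1)]])
  show "dx j (\<lambda>p. a *s H p - A *v K p) p = a *s dx j H p - A *v dx j K p" for j
    by (rule *[OF W(2) H K])
  have "dx j (dx j (\<lambda>p. a *s H p - A *v K p)) p = dx j (\<lambda>p. a *s dx j H p - A *v dx j K p) p" for j
    by (rule dx_cong[OF W]) (rule *[OF _ H K])
  then show "laplace_x (\<lambda>p. a *s H p - A *v K p) p = a *s laplace_x H p - A *v laplace_x K p"
    unfolding laplace_x_def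
    by (simp add: *[OF W(2) smooth_on_dxy(1)[OF H] smooth_on_dxy(1)[OF K]] sum_subtractf sum_smult sum_matrix_vector)
  assume "\<And>v. A ** rep_x \<rho> v = rep_x \<rho> v ** A"
  then have "rep_x \<rho> v *v (A *v u) = A *v (rep_x \<rho> v *v u)" for v u
    by (simp add: matrix_vector_mul_assoc)
  then show "dirac_x \<rho> (\<lambda>p. a *s H p - A *v K p) p = a *s dirac_x \<rho> H p - A *v dirac_x \<rho> K p"
    unfolding dirac_x_def rep_x_def[symmetric] *[OF W(2) H K]
    by (simp add: mv_rules sum_subtractf sum_smult sum_matrix_vector)
qed

text \<open>\<open>conf_op\<close> in the first variable, expressed by the partial operators of
  \<open>E_op\<close>, so that it can be composed with \<open>conf_y\<close>.\<close>

definition conf_x :: "('n::finite complex_clifford \<Rightarrow> complex ^ 's::finite ^ 's) \<Rightarrow> complex \<Rightarrow> 'n minkowski \<Rightarrow>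
    ('n, 's) spinor_field \<Rightarrow> ('n, 's) spinor_field" where
  "conf_x \<rho> s q G = (\<lambda>p. fst q *\<^sub>R laplace_x G p
     + (s *s (\<Sum>j\<in>UNIV. fst (snd q) $ j *\<^sub>R dx j G p) - rep_x \<rho> (fst (snd q)) *v dirac_x \<rho> G p)
     + snd (snd q) *\<^sub>R ((s * (s + of_nat CARD('n))) *s G p))"

definition conf_y :: "('n::finite complex_clifford \<Rightarrow> complex ^ 's::finite ^ 's) \<Rightarrow> complex \<Rightarrow> 'n minkowski \<Rightarrow>
    ('n, 's) spinor_field \<Rightarrow> ('n, 's) spinor_field" where
  "conf_y \<rho> s q G = (\<lambda>p. fst q *\<^sub>R laplace_y G p
     + (s *s (\<Sum>j\<in>UNIV. fst (snd q) $ j *\<^sub>R dy j G p) - rep_y \<rho> (fst (snd q)) *v dirac_y \<rho> G p)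
     + snd (snd q) *\<^sub>R ((s * (s + of_nat CARD('n))) *s G p))"

lemma pair_derivative:
  "((\<lambda>x. (x, y)) has_derivative (\<lambda>v. (v, 0))) (at x)" "((\<lambda>y. (x, y)) has_derivative (\<lambda>v. (0, v))) (at y)"
  by (auto intro!: derivative_eq_intros)

lemma smooth_on_slice:
  fixes G :: "'a::euclidean_space \<times> 'b::euclidean_space \<Rightarrow> 'c::real_normed_vector"
  assumes "open W" "smooth_on W G"
  shows "smooth_on {x. (x, y) \<in> W} (\<lambda>x. G (x, y))" "smooth_on {y. (x, y) \<in> W} (\<lambda>y. G (x, y))"
    and "open {x. (x, y) \<in> W}" "open {y. (x, y) \<in> W}"
proof -
  have vimage: "{x. (x, y) \<in> W} = (\<lambda>x. (x, y)) -` W" "{y. (x, y) \<in> W} = (\<lambda>y. (x, y)) -` W" by auto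
  show o: "open {x. (x, y) \<in> W}" "open {y. (x, y) \<in> W}"
    unfolding vimage by (intro open_vimage assms continuous_intros)+
  have "smooth_on U (\<lambda>x. (x, 0) + (0, y))" if "open U" for U :: "'a set"
    using that by (intro smooth_on_add smooth_on_const smooth_on_id
        smooth_on_linear[of U "\<lambda>x :: 'a. (x, 0 :: 'b)" "\<lambda>x. x"]) (auto intro: linearI)
  then have "smooth_on U (\<lambda>x. (x, y))" if "open U" for U :: "'a set"
    using that by simp
  then show "smooth_on {x. (x, y) \<in> W} (\<lambda>x. G (x, y))"
    using o by (intro smooth_on_compose[OF _ assms(2)]) auto
  have "smooth_on U (\<lambda>y. (x, 0) + (0, y))" if "open U" for U :: "'b set"
    using that by (intro smooth_on_add smooth_on_const smooth_on_id
        smooth_on_linear[of U "\<lambda>y :: 'b. (0 :: 'a, y)" "\<lambda>y. y"]) (auto intro: linearI)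
  then have "smooth_on U (\<lambda>y. (x, y))" if "open U" for U :: "'b set"
    using that by simp
  then show "smooth_on {y. (x, y) \<in> W} (\<lambda>y. G (x, y))"
    using o by (intro smooth_on_compose[OF _ assms(2)]) auto
qed

lemma dx_slice:
  assumes "smooth_on W G" "(x, y) \<in> W"
  shows "dx j G (x, y) = pd j (\<lambda>x. G (x, y)) x" "dy j G (x, y) = pd j (\<lambda>y. G (x, y)) y"
  using diff_chain_at[OF pair_derivative(1) smooth_on_has_derivative[OF assms]]
    diff_chain_at[OF pair_derivative(2) smooth_on_has_derivative[OF assms]]
  by (simp_all add: dx_def dy_def pd_def o_def frechet_derivative_at[symmetric])

lemma laplace_slice:
  assumes "open W" "smooth_on W G" "(x, y) \<in> W"
  shows "laplace_x G (x, y) = lap (\<lambda>x. G (x, y)) x" "laplace_y G (x, y) = lap (\<lambda>y. G (x, y)) y"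
proof -
  note s = smooth_on_slice(3,4)[OF assms(1,2)]
  have "pd j (\<lambda>x. dx j G (x, y)) x = pd j (pd j (\<lambda>x. G (x, y))) x" for j
    unfolding pd_def[of j "\<lambda>x. dx j G (x, y)"] pd_def[of j "pd _ _"]
    by (rule fun_cong[OF frechet_derivative_cong_open[OF s(1)]]) (use assms dx_slice[OF assms(2)] in auto)
  then show "laplace_x G (x, y) = lap (\<lambda>x. G (x, y)) x"
    by (simp add: laplace_x_def lap_def dx_slice(1)[OF smooth_on_dxy(1)[OF assms(2)] assms(3)])
  have "pd j (\<lambda>y. dy j G (x, y)) y = pd j (pd j (\<lambda>y. G (x, y))) y" for j
    unfolding pd_def[of j "\<lambda>y. dy j G (x, y)"] pd_def[of j "pd _ _"]
    by (rule fun_cong[OF frechet_derivative_cong_open[OF s(2)]]) (use assms dx_slice[OF assms(2)] in auto)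
  then show "laplace_y G (x, y) = lap (\<lambda>y. G (x, y)) y"
    by (simp add: laplace_y_def lap_def dx_slice(2)[OF smooth_on_dxy(2)[OF assms(2)] assms(3)])
qed

lemma conf_slice:
  assumes "open W" "smooth_on W G" "(x, y) \<in> W"
  shows "conf_x \<rho> s q G (x, y) = conf_op (rep_x \<rho>) s x q (\<lambda>x. G (x, y))"
    and "conf_y \<rho> s q G (x, y) = conf_op (rep_y \<rho>) s y q (\<lambda>y. G (x, y))"
proof -
  have d: "(\<lambda>x. G (x, y)) differentiable (at x)" "(\<lambda>y. G (x, y)) differentiable (at y)"
    using smooth_on_slice(1,2)[OF assms(1,2)] assms(3) by (auto intro: smooth_on_differentiable)
  show "conf_x \<rho> s q G (x, y) = conf_op (rep_x \<rho>) s x q (\<lambda>x. G (x, y))"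
    by (simp add: conf_x_def conf_op_def lop_def laplace_slice[OF assms] frechet_derivative_vec[OF d(1)]
        dirac_x_def dirac_def dx_slice[OF assms(2,3)] flip: rep_x_def)
  show "conf_y \<rho> s q G (x, y) = conf_op (rep_y \<rho>) s y q (\<lambda>y. G (x, y))"
    by (simp add: conf_y_def conf_op_def lop_def laplace_slice[OF assms] frechet_derivative_vec[OF d(2)]
        dirac_y_def dirac_def dx_slice[OF assms(2,3)] flip: rep_y_def)
qed

lemma smooth_on_conf_y:
  assumes "open W" "smooth_on W G" shows "smooth_on W (conf_y \<rho> s q G)"
  unfolding conf_y_def
  by (intro smooth_on_add smooth_on_diff smooth_on_bounded_linear[OF _ bounded_linear_scaleR_right]
      smooth_on_bounded_linear[OF _ bounded_linear_matrix_vector] smooth_on_bounded_linear[OF _ bounded_linear_smult]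
      smooth_on_sum smooth_on_dxy smooth_on_laplace smooth_on_dirac assms)

lemma conf_op_cong:
  assumes "open U" "x \<in> U" "\<And>y. y \<in> U \<Longrightarrow> f y = g y"
  shows "conf_op R s x q f = conf_op R s x q g"
proof -
  have *: "frechet_derivative f (at y) = frechet_derivative g (at y)" if "y \<in> U" for y
    by (rule frechet_derivative_cong_open[OF assms(1) that assms(3)])
  then have "frechet_derivative (pd j f) (at x) = frechet_derivative (pd j g) (at x)" for j
    by (intro frechet_derivative_cong_open[OF assms(1,2)]) (simp add: pd_def)
  then show ?thesis
    using * assms(2,3) by (simp add: conf_op_def lap_def lop_def dirac_def pd_def)
qed

lemma dx_matrix_vector:
  assumes "smooth_on W K" "p \<in> W" shows "dx j (\<lambda>p. A *v K p) p = A *v dx j K p"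
proof -
  have "((\<lambda>p. A *v K p) has_derivative (\<lambda>v. A *v frechet_derivative K (at p) v)) (at p)"
    by (rule bounded_linear.has_derivative[OF bounded_linear_matrix_vector smooth_on_has_derivative[OF assms]])
  then show ?thesis by (simp add: dx_def frechet_derivative_at[symmetric])
qed

lemma dx_smult:
  assumes "open W" "p \<in> W" "smooth_on W H"
  shows "dx j (\<lambda>p. a *s H p) p = a *s dx j H p" "laplace_x (\<lambda>p. a *s H p) p = a *s laplace_x H p"
    "dirac_x \<rho> (\<lambda>p. a *s H p) p = a *s dirac_x \<rho> H p"
proof -
  note * = dx_combination[OF assms assms(3), where a = a and A = 0]
  show "dx j (\<lambda>p. a *s H p) p = a *s dx j H p" "laplace_x (\<lambda>p. a *s H p) p = a *s laplace_x H p"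
    using *(1,2) by simp_all
  have "0 ** rep_x \<rho> v = rep_x \<rho> v ** 0" for v
    by (simp add: matrix_matrix_mult_def)
  from *(3)[OF this] show "dirac_x \<rho> (\<lambda>p. a *s H p) p = a *s dirac_x \<rho> H p" by simp
qed

lemma rep_commute:
  "rep_x \<rho> v ** rep_y \<rho>' u = rep_y \<rho>' u ** rep_x \<rho> v"
  by (simp add: rep_x_def rep_y_def kron_mult)

lemma conf_x_combination:
  assumes W: "open W" "p \<in> W" and H: "smooth_on W H" and K: "smooth_on W K"
    and A: "\<And>v. A ** rep_x \<rho> v = rep_x \<rho> v ** A"
  shows "conf_x \<rho> s q (\<lambda>p. a *s H p - A *v K p) p = a *s conf_x \<rho> s q H p - A *v conf_x \<rho> s q K p"
proof -
  have A': "rep_x \<rho> v *v (A *v u) = A *v (rep_x \<rho> v *v u)" for v u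
    by (simp add: matrix_vector_mul_assoc A)
  have "(\<Sum>j\<in>UNIV. fst (snd q) $ j *\<^sub>R dx j (\<lambda>p. a *s H p - A *v K p) p) =
      a *s (\<Sum>j\<in>UNIV. fst (snd q) $ j *\<^sub>R dx j H p) - A *v (\<Sum>j\<in>UNIV. fst (snd q) $ j *\<^sub>R dx j K p)"
    unfolding dx_combination(1)[OF W H K]
    by (simp add: scaleR_diff_right sum_subtractf matrix_vector_mult_scaleR flip: sum_smult sum_matrix_vector)
      (simp add: vec_eq_iff algebra_simps)
  then show ?thesis
    unfolding conf_x_def dx_combination(2)[OF W H K] dx_combination(3)[OF W H K A]
    by (simp add: mv_rules A' scaleR_smult) (simp add: vec_eq_iff algebra_simps)
qed

lemma sum_clifford_components:
  assumes "clifford_map R"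
  shows "(\<Sum>j\<in>UNIV. d $ j *\<^sub>R (a *s X j - R (axis j 1) *v u)) = a *s (\<Sum>j\<in>UNIV. d $ j *\<^sub>R X j) - R d *v u"
  by (simp add: scaleR_diff_right sum_subtractf scaleR_smult[of _ "R _ *v _"] sum_basis_clifford_map[OF assms])
    (simp add: vec_eq_iff sum_distrib_left algebra_simps)

lemma clifford_map_zero: "clifford_map R \<Longrightarrow> R 0 = 0"
  by (rule linear_0[OF clifford_map_linear])

lemma clifford_map_minus: "clifford_map R \<Longrightarrow> R (- x) = - R x"
  by (rule linear_neg[OF clifford_map_linear])

lemma sum_axis_scaleR: "(\<Sum>i\<in>UNIV. axis j (1 :: real) $ i *\<^sub>R g i) = (g j :: 'b::real_vector)"
  by (simp add: axis_def if_distrib[of "\<lambda>x. x *\<^sub>R _"] cong: if_cong)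

text \<open>With 2 lam - n + 1 = s and 2 lam + 1 = s + n the coefficients of E become s and kappa,
  and likewise for mu. Expanding L_j in x times L_j in y gives the last four sums of E.\<close>

lemma E_op_contraction:
  fixes G :: "('n::finite, 's::finite) spinor_field"
  assumes module: "clifford_module \<rho>" "clifford_module \<rho>'"
    and W: "open W" "(x, y) \<in> W" and G: "smooth_on W G"
    and s: "s = 2 * lam - of_nat CARD('n) + 1" and r: "r = 2 * mu - of_nat CARD('n) + 1"
  shows "E_op \<rho> \<rho>' lam mu G (x, y) = contraction (\<lambda>p q. conf_x \<rho> s p (conf_y \<rho>' r q G) (x, y)) (x - y)"
proof -
  let ?z = "(x, y)" and ?n = "of_nat CARD('n) :: complex"
  note cx = clifford_map_rep(1)[OF module(1)] and cy = clifford_map_rep(2)[OF module(2)]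
  note zero = clifford_map_zero[OF cx] clifford_map_zero[OF cy]
  have Y: "conf_y \<rho>' r (1, 0, 0) G = laplace_y G"
    "conf_y \<rho>' r (0, axis j 1, 0) G = (\<lambda>p. r *s dy j G p - rep_y \<rho>' (axis j 1) *v dirac_y \<rho>' G p)"
    "conf_y \<rho>' r (0, 0, 1) G = (\<lambda>p. (r * (r + ?n)) *s G p)" for j
    by (simp_all add: conf_y_def zero fun_eq_iff sum_axis_scaleR vec_eq_iff)
  have X: "conf_x \<rho> s (1, 0, 0) H = laplace_x H"
    "conf_x \<rho> s (0, axis j 1, 0) H = (\<lambda>p. s *s dx j H p - rep_x \<rho> (axis j 1) *v dirac_x \<rho> H p)"
    "conf_x \<rho> s (0, 0, 1) H = (\<lambda>p. (s * (s + ?n)) *s H p)" for j and H :: "('n, 's) spinor_field"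
    by (simp_all add: conf_x_def zero fun_eq_iff sum_axis_scaleR vec_eq_iff)
  note C = dx_combination[OF W smooth_on_dxy(2)[OF G] smooth_on_dirac(2)[OF W(1) G]]
    dx_combination(3)[OF W smooth_on_dxy(2)[OF G] smooth_on_dirac(2)[OF W(1) G] rep_commute[symmetric]]
  have t3: "(\<Sum>j\<in>UNIV. (y $ j - x $ j) *\<^sub>R laplace_x (dy j G) ?z) = - (\<Sum>j\<in>UNIV. (x - y) $ j *\<^sub>R laplace_x (dy j G) ?z)"
    by (simp add: algebra_simps flip: sum_negf)
  have t2: "(\<Sum>j\<in>UNIV. (x $ j - y $ j) *\<^sub>R dx j (laplace_y G) ?z) = (\<Sum>j\<in>UNIV. (x - y) $ j *\<^sub>R dx j (laplace_y G) ?z)"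
    by simp
  have t9: "(\<Sum>j\<in>UNIV. dx j (\<lambda>p. rep_y \<rho>' (axis j 1) *v dirac_y \<rho>' G p) ?z) =
      (\<Sum>j\<in>UNIV. rep_y \<rho>' (axis j 1) *v dx j (dirac_y \<rho>' G) ?z)"
    by (simp add: dx_matrix_vector[OF smooth_on_dirac(2)[OF W(1) G] W(2)])
  have t11: "\<rho> (cc_of (cl_vec u)) \<otimes>\<^sub>K \<rho>' (cc_of (cl_vec v)) = rep_x \<rho> u ** rep_y \<rho>' v" for u v
    by (simp add: rep_x_def rep_y_def kron_mult)
  have E: "E_op \<rho> \<rho>' lam mu G ?z = (norm (x - y))\<^sup>2 *\<^sub>R laplace_x (laplace_y G) ?z
      + (2 * s) *s (\<Sum>j\<in>UNIV. (x - y) $ j *\<^sub>R dx j (laplace_y G) ?z)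
      - (2 * r) *s (\<Sum>j\<in>UNIV. (x - y) $ j *\<^sub>R laplace_x (dy j G) ?z)
      - 2 *s (rep_x \<rho> (x - y) *v dirac_x \<rho> (laplace_y G) ?z)
      + 2 *s (rep_y \<rho>' (x - y) *v laplace_x (dirac_y \<rho>' G) ?z)
      + (r * (r + ?n)) *s laplace_x G ?z + (s * (s + ?n)) *s laplace_y G ?z
      - (2 * s * r) *s (\<Sum>j\<in>UNIV. dx j (dy j G) ?z)
      + (2 * s) *s (\<Sum>j\<in>UNIV. rep_y \<rho>' (axis j 1) *v dx j (dirac_y \<rho>' G) ?z)
      + (2 * r) *s (\<Sum>j\<in>UNIV. rep_x \<rho> (axis j 1) *v dirac_x \<rho> (dy j G) ?z)
      - 2 *s (\<Sum>j\<in>UNIV. rep_x \<rho> (axis j 1) *v (rep_y \<rho>' (axis j 1) *v dirac_x \<rho> (dirac_y \<rho>' G) ?z))"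
  proof -
    have ry: "rep_y \<rho>' (y - x) = - rep_y \<rho>' (x - y)"
      using clifford_map_minus[OF cy, of "x - y"] by simp
    have neg: "(- A) *v u = - (A *v u)" for A :: "complex ^ ('s \<times> 's) ^ ('s \<times> 's)" and u
      by (simp add: matrix_vector_mult_def vec_eq_iff sum_negf)
    have "2 * lam + 1 = s + ?n" "2 * mu + 1 = r + ?n" by (simp_all add: s r)
    then show ?thesis
      unfolding E_op_def Let_def prod.case t11 unfolding rep_x_def[symmetric] rep_y_def[symmetric]
      unfolding s[symmetric] r[symmetric] t2 t3 t9 ry neg
      by (simp add: matrix_vector_mul_assoc[symmetric] vec_eq_iff algebra_simps)
  qed
  have T: "contraction (\<lambda>p q. conf_x \<rho> s p (conf_y \<rho>' r q G) ?z) (x - y) =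
      (norm (x - y))\<^sup>2 *\<^sub>R laplace_x (laplace_y G) ?z
      + 2 *\<^sub>R (s *s (\<Sum>j\<in>UNIV. (x - y) $ j *\<^sub>R dx j (laplace_y G) ?z)
        - rep_x \<rho> (x - y) *v dirac_x \<rho> (laplace_y G) ?z)
      - 2 *\<^sub>R (r *s (\<Sum>j\<in>UNIV. (x - y) $ j *\<^sub>R laplace_x (dy j G) ?z)
        - rep_y \<rho>' (x - y) *v laplace_x (dirac_y \<rho>' G) ?z)
      + (r * (r + ?n)) *s laplace_x G ?z + (s * (s + ?n)) *s laplace_y G ?z
      - 2 *\<^sub>R ((s * r) *s (\<Sum>j\<in>UNIV. dx j (dy j G) ?z)
        - s *s (\<Sum>j\<in>UNIV. rep_y \<rho>' (axis j 1) *v dx j (dirac_y \<rho>' G) ?z)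
        - r *s (\<Sum>j\<in>UNIV. rep_x \<rho> (axis j 1) *v dirac_x \<rho> (dy j G) ?z)
        + (\<Sum>j\<in>UNIV. rep_x \<rho> (axis j 1) *v (rep_y \<rho>' (axis j 1) *v dirac_x \<rho> (dirac_y \<rho>' G) ?z)))"
    unfolding contraction_def X Y C dx_smult[OF W G] sum_clifford_components[OF cx] sum_clifford_components[OF cy]
    by (simp add: mv_rules sum_subtractf sum.distrib flip: sum_smult)
  show ?thesis
    unfolding E T by (simp add: scaleR_smult vec_eq_iff algebra_simps)
qed

lemma conf_op_matrix_vector:
  assumes f: "smooth_on UNIV f" and A: "\<And>v. A ** R v = R v ** A"
  shows "conf_op R s x q (\<lambda>y. A *v f y) = A *v conf_op R s x q f"
proof -
  have A': "R v *v (A *v u) = A *v (R v *v u)" for u v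
    by (simp add: matrix_vector_mul_assoc A)
  have d: "frechet_derivative (\<lambda>y. A *v g y) (at z) = (\<lambda>v. A *v frechet_derivative g (at z) v)"
    if "smooth_on UNIV g" for g :: "real ^ 'a \<Rightarrow> complex ^ 'b" and z
    by (rule frechet_derivative_at[symmetric])
      (rule bounded_linear.has_derivative[OF bounded_linear_matrix_vector smooth_on_has_derivative[OF that UNIV_I]])
  have "pd j (\<lambda>y. A *v f y) = (\<lambda>y. A *v pd j f y)" for j
    by (simp add: pd_def[abs_def] d[OF f])
  moreover have "pd j (\<lambda>y. A *v pd j f y) z = A *v pd j (pd j f) z" for j z
    by (simp add: pd_def[of j "\<lambda>y. A *v _ y"] d[OF smooth_on_pd[OF f]]) (simp add: pd_def)
  ultimately show ?thesis
    unfolding conf_op_def lap_def lop_def dirac_def d[OF f]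
    by (simp add: A' mv_rules sum_matrix_vector)
qed

text \<open>As a matrix, the multiplier of one variable can be commuted past the operators of the
  other.\<close>

definition twist_matrix :: "(real ^ 'n \<Rightarrow> complex ^ 't ^ 't) \<Rightarrow> complex ^ 't ^ 't \<Rightarrow> complex \<Rightarrow> real ^ 'n \<Rightarrow>
    real ^ 'n::finite \<Rightarrow> complex ^ 't ^ 't::finite" where
  "twist_matrix R M lam c z =
     mat (exp (- ((2 * lam + 1) / 2) * of_real (ln (sc_norm c z)))) ** (M - R z ** (R c ** M))"

lemma mat_matrix_vector: "mat a *v u = a *s u" for u :: "complex ^ 't::finite"
  by (simp add: matrix_vector_mult_def mat_def vec_eq_iff if_distrib[of "\<lambda>x. x * _"] cong: if_cong)

lemma matrix_vector_mult_diff: "(A - B) *v u = A *v u - B *v u" for u :: "complex ^ 't::finite"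
  by (simp add: matrix_vector_mult_def vec_eq_iff left_diff_distrib sum_subtractf)

lemma twist_conv_matrix: "twist R M lam c z u = twist_matrix R M lam c z *v u"
  by (simp add: twist_def twist_matrix_def mat_matrix_vector matrix_vector_mult_diff flip: matrix_vector_mul_assoc)

lemma twist_matrix_commute:
  assumes "\<And>v. A ** R v = R v ** A" "A ** M = M ** A"
  shows "A ** twist_matrix R M lam c z = twist_matrix R M lam c z ** A"
proof -
  have "A *v (R v *v u) = R v *v (A *v u)" "A *v (M *v u) = M *v (A *v u)" for u v
    by (simp_all add: matrix_vector_mul_assoc assms)
  then show ?thesis
    by (simp add: matrix_eq twist_matrix_def mat_matrix_vector matrix_vector_mult_diff mv_rules
        flip: matrix_vector_mul_assoc)
qed

subsection \<open>The intertwining relation where the action is defined\<close>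

text \<open>By uniqueness, any explicit factorization evaluates the definite descriptions.\<close>

lemma factorization_values:
  assumes "(1 :: 'n::finite clifford) \<noteq> 0" and f: "factorization (h * nbar_elt x :: 'n clifford) y m a n"
  shows "act_defined h x" "act h x = y" "m_part h x = m" "a_part h x = a"
proof -
  note u = factorization_unique[OF assms(1), symmetric]
  show "act_defined h x" using f by (auto simp: act_defined_def)
  show "act h x = y" unfolding act_def using f u(1)[OF f] by (intro the_equality) blast+
  show "m_part h x = m" unfolding m_part_def using f u(2)[OF f] by (intro the_equality) blast+
  show "a_part h x = a" unfolding a_part_def using f u(3)[OF f] by (intro the_equality) blast+
qed

lemma sc_spin_euclid: "sc_spin c z \<in> euclid_clifford"
proof -
  have "1 - cl_vec c * cl_vec z = 1 + (- 1) *\<^sub>R (cl_vec c * cl_vec z)" by simp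
  then show ?thesis unfolding sc_spin_def
    by (metis euclid_clifford.intros)
qed

lemma module_minus_product:
  assumes "clifford_module \<rho>"
  shows "\<rho> (cc_of (sc_spin z c)) = inverse (sqrt (sc_norm c z)) *\<^sub>R
    (mat 1 - \<rho> (cc_of (cl_vec z)) ** \<rho> (cc_of (cl_vec c)))"
proof -
  have e: "cl_vec z * cl_vec c \<in> euclid_clifford" "1 \<in> euclid_clifford"
    "(- 1) *\<^sub>R (cl_vec z * cl_vec c) \<in> euclid_clifford"
    by (intro euclid_clifford.intros)+
  have "sc_spin z c = inverse (sqrt (sc_norm c z)) *\<^sub>R (1 + (- 1) *\<^sub>R (cl_vec z * cl_vec c))"
    by (simp add: sc_spin_def sc_norm_commute[of z c])
  then show ?thesis
    by (simp only: module_scaleR[OF assms euclid_clifford.add[OF e(2,3)]] module_add[OF assms e(2,3)]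
        module_scaleR[OF assms e(1)] module_mult[OF assms euclid_clifford.vec euclid_clifford.vec]
        module_one[OF assms]) simp
qed

lemma module_inverse:
  assumes "clifford_module \<rho>" "a \<in> euclid_clifford" "b \<in> euclid_clifford" "a * b = 1" "b * a = 1"
  shows "matrix_inv (\<rho> (cc_of a)) = \<rho> (cc_of b)"
proof -
  have *: "\<rho> (cc_of a) ** \<rho> (cc_of b) = mat 1" "\<rho> (cc_of b) ** \<rho> (cc_of a) = mat 1"
    using module_mult[OF assms(1,2,3)] module_mult[OF assms(1,3,2)] module_one[OF assms(1)] assms(4,5) by simp_all
  then have "\<rho> (cc_of a) ** matrix_inv (\<rho> (cc_of a)) = mat 1"
    unfolding matrix_inv_def by (metis (mono_tags, lifting) someI)
  then have "\<rho> (cc_of b) ** (\<rho> (cc_of a) ** matrix_inv (\<rho> (cc_of a))) = \<rho> (cc_of b)" by simp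
  then show ?thesis by (simp add: matrix_mul_assoc *)
qed

text \<open>\<open>sc_spin z c\<close> inverts \<open>sc_spin c z\<close>. Inversion thus replaces 1
  - c z by 1 - z c and puts it to the left of the inverse of m, as in \<open>twist\<close>.\<close>

lemma module_inverse_cocycle:
  assumes "clifford_module \<rho>" and m: "m \<in> Spin_M" "m' \<in> Spin_M" "m * m' = 1" "m' * m = 1"
    and N: "sc_norm c z > 0"
  shows "matrix_inv (\<rho> (cc_of (m * sc_spin c z))) = inverse (sqrt (sc_norm c z)) *\<^sub>R
    (\<rho> (cc_of m') - \<rho> (cc_of (cl_vec z)) ** (\<rho> (cc_of (cl_vec c)) ** \<rho> (cc_of m')))"
proof -
  note e = Spin_M_euclid[OF m(1)] Spin_M_euclid[OF m(2)] sc_spin_euclid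
  have N': "sc_norm z c > 0" using N by (simp add: sc_norm_commute)
  have "m * sc_spin c z * (sc_spin z c * m') = m * (sc_spin c z * sc_spin z c) * m'"
    "sc_spin z c * m' * (m * sc_spin c z) = sc_spin z c * (m' * m) * sc_spin c z"
    by (simp_all only: mult.assoc)
  then have "m * sc_spin c z * (sc_spin z c * m') = 1" "sc_spin z c * m' * (m * sc_spin c z) = 1"
    using m sc_spin_inverse[OF N] sc_spin_inverse[OF N'] by simp_all
  then have "matrix_inv (\<rho> (cc_of (m * sc_spin c z))) = \<rho> (cc_of (sc_spin z c * m'))"
    using e by (intro module_inverse[OF assms(1)] euclid_clifford.mult)
  also have "\<dots> = \<rho> (cc_of (sc_spin z c)) ** \<rho> (cc_of m')"
    by (rule module_mult[OF assms(1) e(3,2)])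
  also have "\<dots> = inverse (sqrt (sc_norm c z)) *\<^sub>R
    (\<rho> (cc_of m') - \<rho> (cc_of (cl_vec z)) ** (\<rho> (cc_of (cl_vec c)) ** \<rho> (cc_of m')))"
    unfolding module_minus_product[OF assms(1)]
    by (simp add: matrix_eq scaleR_matrix_vector_mult matrix_vector_mult_diff flip: matrix_vector_mul_assoc)
  finally show ?thesis .
qed

text \<open>N^(- lam) from the character at ln N / 2 and N^(- 1/2) from the spin factor combine to
  the exponent of \<open>twist\<close>.\<close>

lemma chi_cocycle:
  assumes "(1 :: 'n::finite clifford) \<noteq> 0" "N > 0"
  shows "inverse (chi lam (a_elt (t + ln N / 2) :: 'n clifford)) * of_real (inverse (sqrt N)) =
    exp (- (2 * of_real t * lam)) * exp (- ((2 * lam + 1) / 2) * of_real (ln N))"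
proof -
  have "sqrt N = exp (ln N / 2)" using assms(2) by (simp add: sqrt_def root_powr_inverse powr_def)
  then have "complex_of_real (inverse (sqrt N)) = exp (- (of_real (ln N) / 2))"
    by (simp add: exp_minus flip: exp_of_real)
  then show ?thesis
    by (simp add: chi_a_elt[OF assms(1)] flip: exp_minus exp_add)
      (rule arg_cong[where f = exp], simp add: algebra_simps add_divide_distrib)
qed

lemma matrix_mat_commute: "A ** (mat a ** B) = mat a ** (A ** B)" for A B :: "complex ^ 't::finite ^ 't"
  by (simp add: matrix_eq mat_matrix_vector matrix_vector_smult flip: matrix_vector_mul_assoc)

text \<open>The constant factors \<open>\<chi>\<^sub>\<lambda>(a)\<^sup>-\<^sup>1 \<rho>(m)\<^sup>-\<^sup>1\<close>; here \<open>k = m\<^sup>-\<^sup>1\<close> and \<open>a = a_elt t\<close>.\<close>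

definition factor_x :: "('n::finite complex_clifford \<Rightarrow> complex ^ 's::finite ^ 's) \<Rightarrow> complex \<Rightarrow> real \<Rightarrow>
    'n clifford \<Rightarrow> complex ^ ('s \<times> 's) ^ ('s \<times> 's)" where
  "factor_x \<rho> lam t k = mat (exp (- (2 * of_real t * lam))) ** (\<rho> (cc_of k) \<otimes>\<^sub>K mat 1)"

definition factor_y :: "('n::finite complex_clifford \<Rightarrow> complex ^ 's::finite ^ 's) \<Rightarrow> complex \<Rightarrow> real \<Rightarrow>
    'n clifford \<Rightarrow> complex ^ ('s \<times> 's) ^ ('s \<times> 's)" where
  "factor_y \<rho> lam t k = mat (exp (- (2 * of_real t * lam))) ** (mat 1 \<otimes>\<^sub>K \<rho> (cc_of k))"

lemma factor_commute:
  "rep_y \<rho>' v ** factor_x \<rho> lam t k = factor_x \<rho> lam t k ** rep_y \<rho>' v"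
  "rep_x \<rho> v ** factor_y \<rho>' mu t' k' = factor_y \<rho>' mu t' k' ** rep_x \<rho> v"
  "factor_x \<rho> lam t k ** factor_y \<rho>' mu t' k' = factor_y \<rho>' mu t' k' ** factor_x \<rho> lam t k"
  unfolding factor_x_def factor_y_def rep_x_def rep_y_def
  by (simp_all add: matrix_eq mat_matrix_vector matrix_vector_smult vector_smult_assoc kron_commute mult.commute
      flip: matrix_vector_mul_assoc)

text \<open>m v = w(v) m gives v k = k w(v) for the inverse k. This is the relation demanded of M in
  \<open>twist_jets\<close>.\<close>

lemma factor_rotation:
  assumes module: "clifford_module \<rho>" and m: "m \<in> Spin_M" "k \<in> Spin_M" "m * k = 1" "k * m = 1"
    and w: "\<And>v. m * cl_vec v = cl_vec (w v) * m"
  shows "rep_x \<rho> v ** factor_x \<rho> lam t k = factor_x \<rho> lam t k ** rep_x \<rho> (w v)"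
    "rep_y \<rho> v ** factor_y \<rho> lam t k = factor_y \<rho> lam t k ** rep_y \<rho> (w v)"
proof -
  have "cl_vec v * k = k * (m * cl_vec v) * k"
    by (simp add: m(4) flip: mult.assoc)
  also have "\<dots> = k * cl_vec (w v) * (m * k)"
    unfolding w by (simp only: mult.assoc)
  finally have "cl_vec v * k = k * cl_vec (w v)" by (simp add: m(3))
  then have "\<rho> (cc_of (cl_vec v)) ** \<rho> (cc_of k) = \<rho> (cc_of k) ** \<rho> (cc_of (cl_vec (w v)))"
    using module_mult[OF module euclid_clifford.vec Spin_M_euclid[OF m(2)]]
      module_mult[OF module Spin_M_euclid[OF m(2)] euclid_clifford.vec] by metis
  then show "rep_x \<rho> v ** factor_x \<rho> lam t k = factor_x \<rho> lam t k ** rep_x \<rho> (w v)"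
    "rep_y \<rho> v ** factor_y \<rho> lam t k = factor_y \<rho> lam t k ** rep_y \<rho> (w v)"
    unfolding factor_x_def factor_y_def rep_x_def rep_y_def
    by (simp_all add: matrix_mat_commute kron_mult flip: matrix_mul_assoc)
qed

lemma twist_matrix_factor:
  fixes \<rho> :: "'n::finite complex_clifford \<Rightarrow> complex ^ 's::finite ^ 's"
  assumes module: "clifford_module \<rho>" and m: "m \<in> Spin_M" "k \<in> Spin_M" "m * k = 1" "k * m = 1"
    and N: "sc_norm c z > 0"
  shows "inverse (chi lam (a_elt (t + ln (sc_norm c z) / 2) :: 'n clifford)) *s
      ((matrix_inv (\<rho> (cc_of (m * sc_spin c z))) \<otimes>\<^sub>K mat 1) *v u) =
      twist_matrix (rep_x \<rho>) (factor_x \<rho> lam t k) lam c z *v u"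
    and "inverse (chi lam (a_elt (t + ln (sc_norm c z) / 2) :: 'n clifford)) *s
      ((mat 1 \<otimes>\<^sub>K matrix_inv (\<rho> (cc_of (m * sc_spin c z)))) *v u) =
      twist_matrix (rep_y \<rho>) (factor_y \<rho> lam t k) lam c z *v u"
proof -
  note chi = chi_cocycle[OF clifford_one_neq_zero[OF module] N]
  define A where "A = \<rho> (cc_of k)"
  define B where "B = \<rho> (cc_of (cl_vec z)) ** (\<rho> (cc_of (cl_vec c)) ** A)"
  have inv: "matrix_inv (\<rho> (cc_of (m * sc_spin c z))) = inverse (sqrt (sc_norm c z)) *\<^sub>R (A - B)"
    unfolding A_def B_def by (rule module_inverse_cocycle[OF module m N])
  have eq: "inverse (chi lam (a_elt (t + ln (sc_norm c z) / 2) :: 'n clifford)) *s (inverse (sqrt (sc_norm c z)) *\<^sub>R X) =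
      exp (- ((2 * lam + 1) / 2) * of_real (ln (sc_norm c z))) *s (exp (- (2 * of_real t * lam)) *s X)"
    for X :: "complex ^ ('s \<times> 's)"
    unfolding scaleR_smult vector_smult_assoc chi by (simp add: mult.commute)
  have "B \<otimes>\<^sub>K mat 1 = rep_x \<rho> z ** (rep_x \<rho> c ** (A \<otimes>\<^sub>K mat 1))"
    "mat 1 \<otimes>\<^sub>K B = rep_y \<rho> z ** (rep_y \<rho> c ** (mat 1 \<otimes>\<^sub>K A))"
    by (simp_all add: B_def rep_x_def rep_y_def kron_mult)
  then show "inverse (chi lam (a_elt (t + ln (sc_norm c z) / 2) :: 'n clifford)) *s
      ((matrix_inv (\<rho> (cc_of (m * sc_spin c z))) \<otimes>\<^sub>K mat 1) *v u) =
      twist_matrix (rep_x \<rho>) (factor_x \<rho> lam t k) lam c z *v u"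
    "inverse (chi lam (a_elt (t + ln (sc_norm c z) / 2) :: 'n clifford)) *s
      ((mat 1 \<otimes>\<^sub>K matrix_inv (\<rho> (cc_of (m * sc_spin c z)))) *v u) =
      twist_matrix (rep_y \<rho>) (factor_y \<rho> lam t k) lam c z *v u"
    unfolding inv kron_scaleR scaleR_matrix_vector_mult eq kron_diff
    by (simp_all add: twist_matrix_def factor_x_def factor_y_def mat_matrix_vector matrix_vector_mult_diff
        mv_rules A_def flip: matrix_vector_mul_assoc) 
      (simp_all add: vec_eq_iff algebra_simps)
qed

text \<open>\<open>factorization_translate\<close> provides factorizations at x + z and y + z'
  separately, and splitting the Kronecker product separates the two multipliers.\<close>

lemma pi_tensor_near:
  fixes \<rho> \<rho>' :: "'n::finite complex_clifford \<Rightarrow> complex ^ 's::finite ^ 's"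
  assumes module: "clifford_module \<rho>" "clifford_module \<rho>'" and h: "cl_inv g = h"
    and x: "factorization (h * nbar_elt x) b m (a_elt t) (n_elt c)" "k \<in> Spin_M" "m * k = 1" "k * m = 1"
      "\<And>v. m * cl_vec v = cl_vec (w v) * m" "orthogonal_transformation w" "sc_norm c z > 0"
    and y: "factorization (h * nbar_elt y) b' m' (a_elt t') (n_elt c')" "k' \<in> Spin_M" "m' * k' = 1" "k' * m' = 1"
      "\<And>v. m' * cl_vec v = cl_vec (w' v) * m'" "orthogonal_transformation w'" "sc_norm c' z' > 0"
  shows "pi_tensor \<rho> \<rho>' lam mu g F (x + z, y + z') =
    twist_matrix (rep_x \<rho>) (factor_x \<rho> lam t k) lam c z *v
    (twist_matrix (rep_y \<rho>') (factor_y \<rho>' mu t' k') mu c' z' *v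
      F (b + exp (- 2 * t) *\<^sub>R w (sc_map c z), b' + exp (- 2 * t') *\<^sub>R w' (sc_map c' z')))"
proof -
  note ne = clifford_one_neq_zero[OF module(1)]
  have m: "m \<in> Spin_M" "m' \<in> Spin_M" using x(1) y(1) by (auto simp: factorization_def)
  obtain n where n: "factorization (h * nbar_elt (x + z)) (b + exp (- 2 * t) *\<^sub>R w (sc_map c z))
    (m * sc_spin c z) (a_elt (t + ln (sc_norm c z) / 2)) n"
    using factorization_translate[OF x(1,5) orthogonal_transformation_linear[OF x(6)] x(7)] by blast
  obtain n' where n': "factorization (h * nbar_elt (y + z')) (b' + exp (- 2 * t') *\<^sub>R w' (sc_map c' z'))
    (m' * sc_spin c' z') (a_elt (t' + ln (sc_norm c' z') / 2)) n'"
    using factorization_translate[OF y(1,5) orthogonal_transformation_linear[OF y(6)] y(7)] by blast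
  note v = factorization_values[OF ne n] and v' = factorization_values[OF ne n']
  show ?thesis
    unfolding pi_tensor_def prod.case h Let_def
    unfolding v v' if_True simp_thms
    unfolding kron_split[of "matrix_inv _" "matrix_inv _"] twist_matrix_factor(1)[OF module(1) m(1) x(2,3,4,7), symmetric]
      twist_matrix_factor(2)[OF module(2) m(2) y(2,3,4,7), symmetric]
    by (simp add: v(1) v'(1) matrix_vector_smult vector_smult_assoc flip: matrix_vector_mul_assoc)
qed

text \<open>\<open>twist_jets\<close> is used once per variable. While y varies, the multiplier in x
  is a constant matrix that commutes with the operators in y; the result at y is again a twisted
  field in x.\<close>

lemma conf_pi_tensor:
  fixes \<rho> \<rho>' :: "'n::finite complex_clifford \<Rightarrow> complex ^ 's::finite ^ 's"
  assumes module: "clifford_module \<rho>" "clifford_module \<rho>'" and h: "cl_inv g = h" and F: "smooth_on UNIV F"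
    and x: "factorization (h * nbar_elt x) b m (a_elt t) (n_elt c)" "k \<in> Spin_M" "m * k = 1" "k * m = 1"
      "\<And>v. m * cl_vec v = cl_vec (w v) * m" "orthogonal_transformation w"
    and y: "factorization (h * nbar_elt y) b' m' (a_elt t') (n_elt c')" "k' \<in> Spin_M" "m' * k' = 1" "k' * m' = 1"
      "\<And>v. m' * cl_vec v = cl_vec (w' v) * m'" "orthogonal_transformation w'"
    and s: "s = 2 * lam - of_nat CARD('n) + 1" and r: "r = 2 * mu - of_nat CARD('n) + 1"
  defines "W \<equiv> {p. sc_norm c (fst p - x) > 0 \<and> sc_norm c' (snd p - y) > 0}"
  shows "open W" "(x, y) \<in> W" "smooth_on W (pi_tensor \<rho> \<rho>' lam mu g F)"
    and "conf_x \<rho> s p (conf_y \<rho>' r q (pi_tensor \<rho> \<rho>' lam mu g F)) (x, y) =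
      factor_x \<rho> lam t k *v (factor_y \<rho>' mu t' k' *v
        conf_x \<rho> s (jet_map w c (exp (- 2 * t)) p) (conf_y \<rho>' r (jet_map w' c' (exp (- 2 * t')) q) F) (b, b'))"
proof -
  let ?G = "pi_tensor \<rho> \<rho>' lam mu g F"
  let ?Rx = "rep_x \<rho>" and ?Ry = "rep_y \<rho>'"
  let ?Mx = "factor_x \<rho> lam t k" and ?My = "factor_y \<rho>' mu t' k'"
  define X where "X u = b + exp (- 2 * t) *\<^sub>R w (sc_map c (u - x))" for u
  define Y where "Y u = b' + exp (- 2 * t') *\<^sub>R w' (sc_map c' (u - y))" for u
  define TX where "TX u = twist_matrix ?Rx ?Mx lam c (u - x)" for u
  define TY where "TY u = twist_matrix ?Ry ?My mu c' (u - y)" for u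
  have m: "m \<in> Spin_M" "m' \<in> Spin_M" using x(1) y(1) by (auto simp: factorization_def)
  note R = clifford_map_rep(1)[OF module(1)] clifford_map_rep(2)[OF module(2)]
  note Mx = factor_rotation(1)[OF module(1) m(1) x(2-5)] and My = factor_rotation(2)[OF module(2) m(2) y(2-5)]
  show W: "open W" "(x, y) \<in> W"
    unfolding W_def sc_norm_def by (auto intro!: open_Collect_conj open_Collect_less continuous_intros)
  have G: "?G (u, v) = TX u *v (TY v *v F (X u, Y v))" if "(u, v) \<in> W" for u v
    using pi_tensor_near[OF module h x, of "u - x" y b' m' t' c' k' w' "v - y"] y that
    by (simp add: TX_def TY_def X_def Y_def W_def)
  have "smooth_on W (\<lambda>p. twist ?Rx ?Mx lam c (fst p - x) (twist ?Ry ?My mu c' (snd p - y) (F (X (fst p), Y (snd p)))))"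
  proof -
    have fs: "smooth_on W (\<lambda>p. fst p - x)" "smooth_on W (\<lambda>p. snd p - y)"
      by (intro smooth_on_diff smooth_on_const W smooth_on_bounded_linear[OF _ bounded_linear_fst]
          smooth_on_bounded_linear[OF _ bounded_linear_snd] smooth_on_id)+
    have "smooth_on W (\<lambda>p. X (fst p))" "smooth_on W (\<lambda>p. Y (snd p))"
      unfolding X_def Y_def
      by (intro smooth_on_add smooth_on_const W smooth_on_bounded_linear[OF _ bounded_linear_scaleR_right]
          smooth_on_linear[OF _ orthogonal_transformation_linear[OF x(6)]]
          smooth_on_linear[OF _ orthogonal_transformation_linear[OF y(6)]] smooth_on_sc_map fs; simp add: W_def)+
    then have XY: "smooth_on W (\<lambda>p. (X (fst p), 0) + (0, Y (snd p)))"
      by (intro smooth_on_add W smooth_on_linear[of W "\<lambda>u. (u, 0)" "\<lambda>p. X (fst p)"]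
          smooth_on_linear[of W "\<lambda>u. (0, u)" "\<lambda>p. Y (snd p)"]) (auto intro: linearI)
    then have "smooth_on W (\<lambda>p. F (X (fst p), Y (snd p)))"
      using smooth_on_compose[OF W(1) F XY] by simp
    then show ?thesis
      by (intro smooth_on_twist R W fs) (auto simp: W_def)
  qed
  then show sG: "smooth_on W ?G"
    by (rule smooth_on_cong[OF W(1), rotated]) (auto simp: G TX_def TY_def twist_conv_matrix)
  have commute: "TX u ** ?Ry v = ?Ry v ** TX u" "TX u ** ?My = ?My ** TX u" "TX u ** TY v = TY v ** TX u" for u v
  proof -
    have 1: "TX u ** ?Ry v = ?Ry v ** TX u" for v
      unfolding TX_def by (rule twist_matrix_commute[symmetric]) (rule rep_commute[symmetric] factor_commute)+
    have 2: "TX u ** ?My = ?My ** TX u"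
      unfolding TX_def by (rule twist_matrix_commute[symmetric]) (rule factor_commute[symmetric])+
    show "TX u ** ?Ry v = ?Ry v ** TX u" "TX u ** ?My = ?My ** TX u" by fact+
    show "TX u ** TY v = TY v ** TX u"
      unfolding TY_def by (rule twist_matrix_commute) (rule 1 2)+
  qed
  \<comment> \<open>The field in x that remains once the operator in y has been evaluated, with the
    multiplier \<open>TX\<close> split off.\<close>
  define H where "H u = ?My *v conf_y \<rho>' r (jet_map w' c' (exp (- 2 * t')) q) F (u, b')" for u
  have sF: "smooth_on UNIV (\<lambda>v. F (u, v))" for u
    using smooth_on_slice(2)[OF open_UNIV F, of u] by simp
  have Hs: "smooth_on UNIV (\<lambda>u. conf_y \<rho>' r q F (u, b'))" for q
    using smooth_on_slice(1)[OF open_UNIV smooth_on_conf_y[OF open_UNIV F], of b'] by simp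
  have step: "conf_y \<rho>' r q ?G (u, y) = TX u *v H (X u)" if "(u, y) \<in> W" for u
  proof -
    define \<phi> where "\<phi> v = twist ?Ry ?My mu c' (v - y) (TX u *v F (X u, Y v))" for v
    have "conf_y \<rho>' r q ?G (u, y) = conf_op ?Ry r y q (\<lambda>v. ?G (u, v))"
      by (rule conf_slice(2)[OF W(1) sG that])
    also have "\<dots> = conf_op ?Ry r y q \<phi>"
    proof (rule conf_op_cong)
      show "open {v. (u, v) \<in> W}" by (rule smooth_on_slice(4)[OF W(1) sG])
      show "?G (u, v) = \<phi> v" if "v \<in> {v. (u, v) \<in> W}" for v
      proof -
        have "?G (u, v) = (TX u ** TY v) *v F (X u, Y v)"
          using that G by (simp only: mem_Collect_eq matrix_vector_mul_assoc)
        also have "\<dots> = TY v *v (TX u *v F (X u, Y v))"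
          unfolding commute(3) matrix_vector_mul_assoc ..
        finally show ?thesis unfolding \<phi>_def twist_conv_matrix TY_def .
      qed
    qed (use that in simp)
    also have "\<dots> = ?My *v conf_op ?Ry r b' (jet_map w' c' (exp (- 2 * t')) q) (\<lambda>v. TX u *v F (X u, v))"
      by (rule twist_jets(2)[OF R(2) smooth_on_bounded_linear[OF open_UNIV bounded_linear_matrix_vector sF] y(6) My _ r])
        (simp add: \<phi>_def Y_def)
    also have "\<dots> = ?My *v (TX u *v conf_op ?Ry r b' (jet_map w' c' (exp (- 2 * t')) q) (\<lambda>v. F (X u, v)))"
      by (subst conf_op_matrix_vector[OF sF commute(1)]) (rule HOL.refl)
    also have "\<dots> = TX u *v H (X u)"
      unfolding H_def conf_slice(2)[OF open_UNIV F UNIV_I]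
      by (simp add: matrix_vector_mul_assoc commute)
    finally show ?thesis .
  qed
  have "conf_x \<rho> s p (conf_y \<rho>' r q ?G) (x, y) = conf_op ?Rx s x p (\<lambda>u. conf_y \<rho>' r q ?G (u, y))"
    by (rule conf_slice(1)[OF W(1) smooth_on_conf_y[OF W(1) sG] W(2)])
  also have "\<dots> = conf_op ?Rx s x p (\<lambda>u. twist ?Rx ?Mx lam c (u - x) (H (X u)))"
  proof (rule conf_op_cong)
    show "open {u. (u, y) \<in> W}" by (rule smooth_on_slice(3)[OF W(1) sG])
    show "conf_y \<rho>' r q ?G (u, y) = twist ?Rx ?Mx lam c (u - x) (H (X u))" if "u \<in> {u. (u, y) \<in> W}" for u
      using that by (simp add: step twist_conv_matrix TX_def)
  qed (use W in simp)
  also have "\<dots> = ?Mx *v conf_op ?Rx s b (jet_map w c (exp (- 2 * t)) p) H"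
    by (rule twist_jets(2)[OF R(1) _ x(6) Mx _ s])
      (simp_all add: X_def H_def[abs_def] smooth_on_bounded_linear[OF open_UNIV bounded_linear_matrix_vector Hs])
  also have "conf_op ?Rx s b (jet_map w c (exp (- 2 * t)) p) H =
      ?My *v conf_op ?Rx s b (jet_map w c (exp (- 2 * t)) p)
        (\<lambda>u. conf_y \<rho>' r (jet_map w' c' (exp (- 2 * t')) q) F (u, b'))"
    unfolding H_def[abs_def] by (rule conf_op_matrix_vector[OF Hs factor_commute(2)[symmetric]])
  also have "conf_op ?Rx s b (jet_map w c (exp (- 2 * t)) p)
        (\<lambda>u. conf_y \<rho>' r (jet_map w' c' (exp (- 2 * t')) q) F (u, b')) =
      conf_x \<rho> s (jet_map w c (exp (- 2 * t)) p) (conf_y \<rho>' r (jet_map w' c' (exp (- 2 * t')) q) F) (b, b')"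
    by (rule conf_slice(1)[OF open_UNIV smooth_on_conf_y[OF open_UNIV F] UNIV_I, symmetric])
  finally show "conf_x \<rho> s p (conf_y \<rho>' r q ?G) (x, y) = ?Mx *v (?My *v
      conf_x \<rho> s (jet_map w c (exp (- 2 * t)) p) (conf_y \<rho>' r (jet_map w' c' (exp (- 2 * t')) q) F) (b, b'))" .
qed

lemma contraction_linear: "linear l \<Longrightarrow> contraction (\<lambda>p q. l (T p q)) d = l (contraction T d)"
  by (simp add: contraction_def linear_add linear_diff linear_scale linear_sum)

lemma smult_scaleR: "a *s (r *\<^sub>R u) = r *\<^sub>R (a *s u)" for u :: "complex ^ 'n"
  by (simp add: vec_eq_iff)

lemma smult_add: "a *s (u + v) = a *s u + a *s v" for u :: "complex ^ 'n"
  by (simp add: vec_eq_iff algebra_simps)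

lemma linear_conf:
  assumes "clifford_module \<rho>"
  shows "linear (\<lambda>q. conf_x \<rho> s q G z)" "linear (\<lambda>q. conf_y \<rho> s q G z)"
proof -
  note c = clifford_map_linear[OF clifford_map_rep(1)[OF assms]] clifford_map_linear[OF clifford_map_rep(2)[OF assms]]
  note add = linear_add[OF c(1)] linear_add[OF c(2)] scaleR_add_left sum.distrib smult_add matrix_vector_mult_add_rdistrib
  note scale = linear_scale[OF c(1)] linear_scale[OF c(2)] smult_scaleR scaleR_matrix_vector_mult
  have 1: "(\<Sum>j\<in>UNIV. (r * f j) *\<^sub>R X j) = r *\<^sub>R (\<Sum>j\<in>UNIV. f j *\<^sub>R X j)"
    for r f and X :: "_ \<Rightarrow> complex ^ ('b \<times> 'b)"
    by (simp add: scaleR_sum_right)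
  show "linear (\<lambda>q. conf_x \<rho> s q G z)" "linear (\<lambda>q. conf_y \<rho> s q G z)"
    by (rule linearI; simp add: conf_x_def conf_y_def add scale 1 scaleR_add_right scaleR_diff_right)+
qed

text \<open>The triple q sits under the derivatives in x, so its linearity is extracted by
  \<open>conf_x_combination\<close> with scalar matrices for A.\<close>

lemma bilinear_conf:
  assumes module: "clifford_module \<rho>" "clifford_module \<rho>'" and F: "smooth_on UNIV F"
  shows "bilinear (\<lambda>p q. conf_x \<rho> s p (conf_y \<rho>' r q F) z)"
proof -
  note H = smooth_on_conf_y[OF open_UNIV F]
  have mat: "mat a ** rep_x \<rho> v = rep_x \<rho> v ** mat a" for a v
    by (simp only: matrix_eq mat_matrix_vector matrix_vector_smult matrix_vector_mul_assoc[symmetric] simp_thms)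
  have comb: "conf_x \<rho> s p (\<lambda>z. a *s conf_y \<rho>' r q F z - mat b *v conf_y \<rho>' r q' F z) z =
      a *s conf_x \<rho> s p (conf_y \<rho>' r q F) z - mat b *v conf_x \<rho> s p (conf_y \<rho>' r q' F) z" for a b p q q'
    by (rule conf_x_combination[OF open_UNIV UNIV_I H H mat])
  have "linear (\<lambda>q. conf_x \<rho> s p (conf_y \<rho>' r q F) z)" for p
  proof (rule linearI)
    fix q q' and a :: real
    have 1: "conf_y \<rho>' r (q + q') F = (\<lambda>z. 1 *s conf_y \<rho>' r q F z - mat (- 1) *v conf_y \<rho>' r q' F z)"
      unfolding mat_matrix_vector by (simp add: fun_eq_iff linear_add[OF linear_conf(2)[OF module(2)]])
    show "conf_x \<rho> s p (conf_y \<rho>' r (q + q') F) z =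
        conf_x \<rho> s p (conf_y \<rho>' r q F) z + conf_x \<rho> s p (conf_y \<rho>' r q' F) z"
      unfolding 1 comb unfolding mat_matrix_vector by (simp add: vec_eq_iff)
    have 2: "conf_y \<rho>' r (a *\<^sub>R q) F = (\<lambda>z. of_real a *s conf_y \<rho>' r q F z - mat 0 *v conf_y \<rho>' r q F z)"
      unfolding mat_matrix_vector scaleR_smult[symmetric]
      by (rule ext) (simp only: linear_scale[OF linear_conf(2)[OF module(2)]], simp)
    show "conf_x \<rho> s p (conf_y \<rho>' r (a *\<^sub>R q) F) z = a *\<^sub>R conf_x \<rho> s p (conf_y \<rho>' r q F) z"
      unfolding 2 comb unfolding mat_matrix_vector scaleR_smult by simp
  qed
  then show ?thesis
    using linear_conf(1)[OF module(1)] unfolding bilinear_def by blast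
qed

text \<open>Raising lam by one contributes \<open>exp (- 2 * t)\<close>, the scale of the dilation.
  The two shifts together absorb the factor r r' of \<open>contraction_invariant\<close>.\<close>

lemma factor_shift:
  "factor_x \<rho> (lam + 1) t k *v u = exp (- 2 * t) *\<^sub>R (factor_x \<rho> lam t k *v u)"
  "factor_y \<rho> (lam + 1) t k *v u = exp (- 2 * t) *\<^sub>R (factor_y \<rho> lam t k *v u)"
proof -
  have "- (2 * of_real t * (lam + 1)) = complex_of_real (- 2 * t) + - (2 * of_real t * lam)"
    by (simp add: algebra_simps)
  then have "exp (- (2 * of_real t * (lam + 1))) = complex_of_real (exp (- 2 * t)) * exp (- (2 * of_real t * lam))"
    by (simp only: exp_add exp_of_real)
  then show "factor_x \<rho> (lam + 1) t k *v u = exp (- 2 * t) *\<^sub>R (factor_x \<rho> lam t k *v u)"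
    "factor_y \<rho> (lam + 1) t k *v u = exp (- 2 * t) *\<^sub>R (factor_y \<rho> lam t k *v u)"
    by (simp_all add: factor_x_def factor_y_def mat_matrix_vector scaleR_smult vector_smult_assoc
        flip: matrix_vector_mul_assoc)
qed

lemma twist_matrix_zero:
  assumes "clifford_map R" shows "twist_matrix R M lam c 0 = M"
  by (simp add: matrix_eq twist_matrix_def sc_norm_def clifford_map_zero[OF assms])

lemma act_definedE:
  assumes "act_defined h x"
  obtains b m t c k w where "factorization (h * nbar_elt x) b m (a_elt t) (n_elt c)" "k \<in> Spin_M" "m * k = 1" "k * m = 1"
      "\<And>v. m * cl_vec v = cl_vec (w v) * m" "orthogonal_transformation w"
proof -
  from assms obtain b m a n where f: "factorization (h * nbar_elt x) b m a n" by (auto simp: act_defined_def)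
  then obtain t c where a: "m \<in> Spin_M" "a = a_elt t" "n = n_elt c" by (auto simp: factorization_def)
  obtain k where "k \<in> Spin_M" "m * k = 1" "k * m = 1" using Spin_M_inverse[OF a(1)] by metis
  moreover obtain w where "orthogonal_transformation w" "\<And>v. m * cl_vec v = cl_vec (w v) * m"
    using Spin_M_rotation[OF a(1)] by metis
  ultimately show ?thesis using that f a by blast
qed

lemma E_op_pi_tensor_defined:
  fixes \<rho> \<rho>' :: "'n::finite complex_clifford \<Rightarrow> complex ^ 's::finite ^ 's"
  assumes module: "clifford_module \<rho>" "clifford_module \<rho>'" and F: "smooth_on UNIV F"
    and h: "cl_inv g = h" "h * g = 1" and d: "act_defined h x" "act_defined h y"
  shows "E_op \<rho> \<rho>' lam mu (pi_tensor \<rho> \<rho>' lam mu g F) (x, y) =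
    pi_tensor \<rho> \<rho>' (lam + 1) (mu + 1) g (E_op \<rho> \<rho>' lam mu F) (x, y)"
proof -
  obtain b m t c k w where x: "factorization (h * nbar_elt x) b m (a_elt t) (n_elt c)" "k \<in> Spin_M" "m * k = 1"
      "k * m = 1" "\<And>v. m * cl_vec v = cl_vec (w v) * m" "orthogonal_transformation w"
    using act_definedE[OF d(1)] by metis
  obtain b' m' t' c' k' w' where y: "factorization (h * nbar_elt y) b' m' (a_elt t') (n_elt c')" "k' \<in> Spin_M"
      "m' * k' = 1" "k' * m' = 1" "\<And>v. m' * cl_vec v = cl_vec (w' v) * m'" "orthogonal_transformation w'"
    using act_definedE[OF d(2)] by metis
  define s where "s = 2 * lam - of_nat CARD('n) + 1"
  define r where "r = 2 * mu - of_nat CARD('n) + 1"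
  define T where "T p q = conf_x \<rho> s p (conf_y \<rho>' r q F) (b, b')" for p q
  define Mx where "Mx = factor_x \<rho> lam t k"
  define My where "My = factor_y \<rho>' mu t' k'"
  note P = conf_pi_tensor[OF module h(1) F x y s_def r_def]
  have lin: "linear (\<lambda>u. Mx *v (My *v u))"
    by (rule linearI) (simp_all add: mv_rules)
  have "bilinear T" unfolding T_def[abs_def] by (rule bilinear_conf[OF module F])
  then have inv: "contraction (\<lambda>p q. T (jet_map w c (exp (- 2 * t)) p) (jet_map w' c' (exp (- 2 * t')) q)) (x - y) =
      (exp (- 2 * t) * exp (- 2 * t')) *\<^sub>R contraction T (b - b')"
    by (rule contraction_invariant[OF clifford_one_neq_zero[OF module(1)] h(2) _ x(1,5,6) HOL.refl y(1,5,6) HOL.refl])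
  have "E_op \<rho> \<rho>' lam mu (pi_tensor \<rho> \<rho>' lam mu g F) (x, y) =
      contraction (\<lambda>p q. Mx *v (My *v T (jet_map w c (exp (- 2 * t)) p) (jet_map w' c' (exp (- 2 * t')) q))) (x - y)"
    unfolding E_op_contraction[OF module P(1-3) s_def r_def] P(4) T_def Mx_def My_def ..
  also have "\<dots> = Mx *v (My *v ((exp (- 2 * t) * exp (- 2 * t')) *\<^sub>R contraction T (b - b')))"
    unfolding inv[symmetric] by (rule contraction_linear[OF lin])
  also have "contraction T (b - b') = E_op \<rho> \<rho>' lam mu F (b, b')"
    unfolding E_op_contraction[OF module open_UNIV UNIV_I F s_def r_def] T_def ..
  also have "Mx *v (My *v ((exp (- 2 * t) * exp (- 2 * t')) *\<^sub>R E_op \<rho> \<rho>' lam mu F (b, b'))) =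
      factor_x \<rho> (lam + 1) t k *v (factor_y \<rho>' (mu + 1) t' k' *v E_op \<rho> \<rho>' lam mu F (b, b'))"
    unfolding factor_shift by (simp add: Mx_def My_def mv_rules)
  also have "\<dots> = pi_tensor \<rho> \<rho>' (lam + 1) (mu + 1) g (E_op \<rho> \<rho>' lam mu F) (x, y)"
  proof -
    \<comment> \<open>At zero displacement the multipliers reduce to the constant factors, which
      evaluates the right side at (x, y).\<close>
    have "sc_norm c 0 > 0" "sc_norm c' 0 > 0" by (simp_all add: sc_norm_def)
    from pi_tensor_near[OF module h(1) x this(1) y this(2), of "lam + 1" "mu + 1" "E_op \<rho> \<rho>' lam mu F"]
    show ?thesis
      using orthogonal_transformation_linear[OF x(6)] orthogonal_transformation_linear[OF y(6)]
      by (simp add: twist_matrix_zero[OF clifford_map_rep(1)[OF module(1)]]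
          twist_matrix_zero[OF clifford_map_rep(2)[OF module(2)]] sc_map_def linear_0)
  qed
  finally show ?thesis .
qed

subsection \<open>Supports\<close>

lemma conf_zero:
  assumes "open V" "\<And>p. p \<in> V \<Longrightarrow> G p = 0" "p \<in> V"
  shows "conf_x \<rho> s q G p = 0" "conf_y \<rho> s q G p = 0"
proof -
  have const: "dx j (\<lambda>p. 0) p = (0 :: complex ^ ('b \<times> 'b))" "dy j (\<lambda>p. 0) p = (0 :: complex ^ ('b \<times> 'b))"
    for p :: "(real ^ 'a) \<times> (real ^ 'a)" and j
    by (simp_all add: dx_def dy_def frechet_derivative_const)
  have d: "dx j G p = 0" "dy j G p = 0" if "p \<in> V" for p j
    using dx_cong[OF assms(1) that, of G "\<lambda>_. 0"] assms(2) by (simp_all add: const)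
  have dd: "dx j (dx j G) p = 0" "dy j (dy j G) p = 0" for j
    using dx_cong(1)[OF assms(1,3), of "dx j G" "\<lambda>_. 0"] dx_cong(2)[OF assms(1,3), of "dy j G" "\<lambda>_. 0"] d
    by (simp_all add: const)
  show "conf_x \<rho> s q G p = 0" "conf_y \<rho> s q G p = 0"
    using assms by (simp_all add: conf_x_def conf_y_def laplace_x_def laplace_y_def dirac_x_def dirac_y_def d dd)
qed

lemma E_op_zero:
  assumes module: "clifford_module \<rho>" "clifford_module \<rho>'"
    and V: "open V" "(x, y) \<in> V" "\<And>p. p \<in> V \<Longrightarrow> G p = 0"
  shows "E_op \<rho> \<rho>' lam mu G (x, y) = 0"
proof -
  have G: "smooth_on V G"
    by (rule smooth_on_cong[OF V(1) _ smooth_on_const[OF V(1), of 0]]) (simp add: V(3))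
  show ?thesis
    unfolding E_op_contraction[OF module V(1,2) G HOL.refl HOL.refl] contraction_def
    by (simp add: conf_zero(1)[OF V(1) conf_zero(2)[OF V(1,3)] V(2)])
qed

lemma Spin0_inverse:
  assumes "g \<in> Spin0"
  obtains h where "g * h = 1" "h * g = 1" "cl_inv g = h"
proof -
  have "\<exists>h. prod_list (map cl_vector vs) * h = 1 \<and> h * prod_list (map cl_vector vs) = (1 :: 'a clifford)"
    if "\<forall>v\<in>set vs. mink_form v v = 1 \<or> mink_form v v = - 1" for vs :: "'a minkowski list"
    using that
  proof (induction vs)
    case (Cons v vs)
    then obtain h where h: "prod_list (map cl_vector vs) * h = 1" "h * prod_list (map cl_vector vs) = (1 :: 'a clifford)"
      by auto
    \<comment> \<open>v^2 = Q(v) is 1 or - 1, so Q(v) v inverts v.\<close>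
    define u where "u = mink_form v v *\<^sub>R (cl_vector v :: 'a clifford)"
    have u: "cl_vector v * u = 1" "u * cl_vector v = 1"
      using Cons.prems by (auto simp: u_def cl_vector_square)
    have "cl_vector v * prod_list (map cl_vector vs) * (h * u) = cl_vector v * (prod_list (map cl_vector vs) * h) * u"
      "h * u * (cl_vector v * prod_list (map cl_vector vs)) = h * (u * cl_vector v) * prod_list (map cl_vector vs)"
      by (simp_all only: mult.assoc)
    then show ?case using h u by (intro exI[of _ "h * u"]) simp
  qed simp
  then obtain h where h: "g * h = 1" "h * g = 1" using assms by (auto simp: Spin0_def)
  have "h' = h" if "g * h' = 1" for h'
  proof -
    have "h * (g * h') = h * g * h'" by (simp only: mult.assoc)
    then show ?thesis using that h by simp
  qed
  then have "cl_inv g = h" unfolding cl_inv_def using h by (intro the_equality) blast+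
  then show ?thesis using that h by blast
qed

text \<open>Near x the action is a special conformal map followed by a similarity. Continuity is
  needed for the image of the compact support to be compact.\<close>

lemma continuous_act:
  fixes g :: "'n::finite clifford"
  assumes ne: "(1 :: 'n clifford) \<noteq> 0" and d: "act_defined g x"
  shows "isCont (act g) x"
proof -
  obtain b m t c k w where f: "factorization (g * nbar_elt x) b m (a_elt t) (n_elt c)"
      "\<And>v. m * cl_vec v = cl_vec (w v) * m" "orthogonal_transformation w"
    using act_definedE[OF d] by metis
  define U where "U = {y. sc_norm c (y - x) > 0}"
  define \<phi> where "\<phi> y = b + exp (- 2 * t) *\<^sub>R w (sc_map c (y - x))" for y
  have U: "open U" "x \<in> U"
    unfolding U_def sc_norm_def by (auto intro!: open_Collect_less continuous_intros)
  have "act g y = \<phi> y" if "y \<in> U" for y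
    using factorization_translate[OF f(1,2) orthogonal_transformation_linear[OF f(3)], of "y - x"]
      factorization_values(2)[OF ne] that by (fastforce simp: U_def \<phi>_def)
  moreover have "smooth_on U \<phi>"
    unfolding \<phi>_def by (intro smooth_on_add smooth_on_const U smooth_on_bounded_linear[OF _ bounded_linear_scaleR_right]
        smooth_on_linear[OF _ orthogonal_transformation_linear[OF f(3)]] smooth_on_sc_map smooth_on_diff smooth_on_id)
      (simp add: U_def)
  ultimately have "smooth_on U (act g)"
    using smooth_on_cong[OF U(1), of \<phi> "act g"] by simp
  then show ?thesis
    using smooth_on_differentiable[OF _ U(2)] differentiable_imp_continuous_within by blast
qed

theorem theorem4p12:
  fixes \<rho> \<rho>' :: "'n::finite complex_clifford \<Rightarrow> complex ^ 's::finite ^ 's"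
    and lam mu :: complex
    and g :: "'n clifford"
    and F :: "(real ^ 'n) \<times> (real ^ 'n) \<Rightarrow> complex ^ ('s \<times> 's)"
  assumes "clifford_module \<rho>"
    and "dual_module \<rho> \<rho>'"
    and "g \<in> Spin0"
    and "smooth F"
    and "compact (supp F)"
    and "\<forall>(x, y) \<in> supp F. act_defined g x \<and> act_defined g y"
  shows "E_op \<rho> \<rho>' lam mu (pi_tensor \<rho> \<rho>' lam mu g F)
       = pi_tensor \<rho> \<rho>' (lam + 1) (mu + 1) g (E_op \<rho> \<rho>' lam mu F)"
proof
  fix p :: "(real ^ 'n) \<times> (real ^ 'n)"
  obtain x y where p: "p = (x, y)" by (cases p)
  note module = assms(1) assms(2)[unfolded dual_module_def, THEN conjunct1]
  note ne = clifford_one_neq_zero[OF module(1)]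
  obtain h where h: "g * h = 1" "h * g = 1" "cl_inv g = h" using Spin0_inverse[OF assms(3)] by metis
  \<comment> \<open>Needed in both directions: from g back by h, and from h back by g.\<close>
  have inverse: "act_defined g' (act h' u) \<and> act g' (act h' u) = u" if d: "act_defined h' u" and gh: "g' * h' = 1"
    for g' h' :: "'n clifford" and u
  proof -
    from d obtain b m a n where f: "factorization (h' * nbar_elt u) b m a n" by (auto simp: act_defined_def)
    obtain m a n where f': "factorization (g' * nbar_elt b) u m a n"
      using factorization_inverse(2)[OF gh f] by blast
    show ?thesis using factorization_values(1,2)[OF ne f'] factorization_values(2)[OF ne f] by simp
  qed
  show "E_op \<rho> \<rho>' lam mu (pi_tensor \<rho> \<rho>' lam mu g F) p =
      pi_tensor \<rho> \<rho>' (lam + 1) (mu + 1) g (E_op \<rho> \<rho>' lam mu F) p"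
  proof (cases "act_defined h x \<and> act_defined h y")
    case True
    then show ?thesis
      unfolding p using E_op_pi_tensor_defined[OF module smooth_imp_smooth_on[OF assms(4)] h(3,2)] by blast
  next
    case False
    \<comment> \<open>The image of the support under g. It is compact, hence closed, and the
      transformed function vanishes off it.\<close>
    define K where "K = (\<lambda>(u, v). (act g u, act g v)) ` supp F"
    have "compact K" unfolding K_def
    proof (rule compact_continuous_image[OF _ assms(5)])
      have "isCont (\<lambda>z. (act g (fst z), act g (snd z))) z" if "z \<in> supp F" for z
      proof (intro continuous_Pair)
        have "act_defined g (fst z)" "act_defined g (snd z)" using assms(6) that by auto
        then show "isCont (\<lambda>z. act g (fst z)) z" "isCont (\<lambda>z. act g (snd z)) z"
          by (auto intro!: isCont_o2[OF _ continuous_act[OF ne]] continuous_intros)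
      qed
      then show "continuous_on (supp F) (\<lambda>(u, v). (act g u, act g v))"
        by (simp add: split_def continuous_at_imp_continuous_on)
    qed
    then have "open (- K)" by (simp add: compact_imp_closed open_Compl)
    \<comment> \<open>At points of K both components are images under g, so h is defined there; at
      (x, y) it is not.\<close>
    moreover have "(x, y) \<in> - K"
      using False assms(6) inverse[OF _ h(2)] by (auto simp: K_def)
    \<comment> \<open>A nonzero value at z would put the image of z under h into the support, and g
      leads from there back to z.\<close>
    moreover have "pi_tensor \<rho> \<rho>' lam mu g F z = 0" if "z \<in> - K" for z
    proof -
      obtain u v where z: "z = (u, v)" by (cases z)
      have "F (act h u, act h v) = 0" if d: "act_defined h u" "act_defined h v"
      proof (rule ccontr)
        assume "F (act h u, act h v) \<noteq> 0"
        then have "(act h u, act h v) \<in> supp F"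
          unfolding supp_def by (intro subsetD[OF closure_subset]) simp
        then have "(act g (act h u), act g (act h v)) \<in> K"
          unfolding K_def by (rule rev_image_eqI) simp
        then show False using \<open>z \<in> - K\<close> inverse[OF d(1) h(1)] inverse[OF d(2) h(1)] by (simp add: z)
      qed
      then show ?thesis by (simp add: pi_tensor_def z h(3) Let_def)
    qed
    ultimately have "E_op \<rho> \<rho>' lam mu (pi_tensor \<rho> \<rho>' lam mu g F) (x, y) = 0"
      by (rule E_op_zero[OF module])
    then show ?thesis using False by (auto simp: p pi_tensor_def h(3) Let_def)
  qed
qed

end
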